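(* Let $k$ and $m$ be positive integers and let $U$ be a $2^m\times 2^m$ unitary matrix. Then $U$ can be exactly represented by an $m$-qubit circuit over $\mathcal{G}_{2^k}$ (possibly using ancillas) if and only if every entry of $U$ lies in $\mathbb{Z}[1/2,\zeta_{2^k}]$. Moreover, such a circuit for $U$ can be constructed using a single ancilla when $k\leq 2$, and using at most $k-2$ ancillas when $k>2$.
   Context: Let $\zeta_n=e^{2\pi i/n}$ and let $\mathbb{Z}[1/2,\zeta_n]$ denote the smallest subring of $\mathbb{C}$ containing $1/2$ and $\zeta_n$. Define the gates $H'=\frac12\begin{bmatrix}1+i&1+i\\1+i&-1-i\end{bmatrix}$ (so $H'=\zeta_8H$ with $H=\frac{1}{\sqrt2}\begin{bmatrix}1&1\\1&-1\end{bmatrix}$ the Hadamard gate), $T_n=\mathrm{diag}(1,\zeta_n)$, $S=\mathrm{diag}(1,i)$, $X=\begin{bmatrix}0&1\\1&0\end{bmatrix}$, $CX=I_2\oplus X$ (controlled-NOT), $CCX=I_6\oplus X$ (Toffoli), and $H\otimes H$. The gate sets are: for $n\geq 8$ divisible by 4, $\mathcal{G}_n=\{H',S,CX,T_n\}$; $\mathcal{G}_2=\{X,CX,CCX,H\otimes H\}$; $\mathcal{G}_4=\{X,CX,CCX,S,H'\}$. A circuit over a gate set is a composition of gates from the set applied to arbitrary (ordered) subsets of the qubits, tensored with identities elsewhere. An $m$-qubit circuit using $a$ ancillas exactly represents $U$ if it is a circuit $C$ on $m+a$ qubits such that $C(\ket{u}\otimes\ket{0}^{\otimes a})=(U\ket{u})\otimes\ket{0}^{\otimes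 a}$ for every $\ket{u}\in\mathbb{C}^{2^m}$ (ancillas are initialized and terminated in $\ket{0}$). *)

theory Defs
  imports Complex_Main "Jordan_Normal_Form.Schur_Decomposition"
begin

definition zeta :: "nat \<Rightarrow> complex" where
  "zeta n = cis (2 * pi / real n)"

inductive_set Zhalf_zeta :: "nat \<Rightarrow> complex set" for n :: nat where
  one: "1 \<in> Zhalf_zeta n"
| half: "1/2 \<in> Zhalf_zeta n"
| root: "zeta n \<in> Zhalf_zeta n"
| uminus: "x \<in> Zhalf_zeta n \<Longrightarrow> - x \<in> Zhalf_zeta n"
| add: "x \<in> Zhalf_zeta n \<Longrightarrow> y \<in> Zhalf_zeta n \<Longrightarrow> x + y \<in> Zhalf_zeta n"
| mult: "x \<in> Zhalf_zeta n \<Longrightarrow> y \<in> Zhalf_zeta n \<Longrightarrow> x * y \<in> Zhalf_zeta n"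

definition unitary_mat :: "nat \<Rightarrow> complex mat \<Rightarrow> bool" where
  "unitary_mat d U \<longleftrightarrow> U \<in> carrier_mat d d \<and> U * mat_adjoint U = 1\<^sub>m d \<and> mat_adjoint U * U = 1\<^sub>m d"

definition H' :: "complex mat" where
  "H' = mat 2 2 (\<lambda>(i,j). if i = 1 \<and> j = 1 then - (1 + \<i>) / 2 else (1 + \<i>) / 2)"

definition Tgate :: "nat \<Rightarrow> complex mat" where
  "Tgate n = mat 2 2 (\<lambda>(i,j). if i \<noteq> j then 0 else if i = 0 then 1 else zeta n)"

definition Sgate :: "complex mat" where
  "Sgate = mat 2 2 (\<lambda>(i,j). if i \<noteq> j then 0 else if i = 0 then 1 else \<i>)"

definition Xgate :: "complex mat" where
  "Xgate = mat 2 2 (\<lambda>(i,j). if i \<noteq> j then 1 else 0)"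

definition CXgate :: "complex mat" where
  "CXgate = mat 4 4 (\<lambda>(i,j). if i < 2 \<or> j < 2 then (if i = j then 1 else 0)
                               else (if i \<noteq> j then 1 else 0))"

definition CCXgate :: "complex mat" where
  "CCXgate = mat 8 8 (\<lambda>(i,j). if i < 6 \<or> j < 6 then (if i = j then 1 else 0)
                               else (if i \<noteq> j then 1 else 0))"

text \<open>H tensor H: entry (i,j) = (1/2) (-1)^(popcount (i AND j)), i.e. Kronecker product.\<close>
definition HHgate :: "complex mat" where
  "HHgate = mat 4 4 (\<lambda>(i,j).
     (if (i div 2) = 1 \<and> (j div 2) = 1 then -1 else 1) *
     (if (i mod 2) = 1 \<and> (j mod 2) = 1 then -1 else 1) / 2)"

definition gate_set :: "nat \<Rightarrow> complex mat set" where
  "gate_set n =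
     (if n = 2 then {Xgate, CXgate, CCXgate, HHgate}
      else if n = 4 then {Xgate, CXgate, CCXgate, Sgate, H'}
      else {H', Sgate, CXgate, Tgate n})"

text \<open>Qubits of an N-qubit register are numbered 0..N-1; qubit 0 is the leftmost tensor
  factor (most significant bit of the basis index).\<close>
definition qbit :: "nat \<Rightarrow> nat \<Rightarrow> nat \<Rightarrow> nat" where
  "qbit N i q = (i div 2 ^ (N - 1 - q)) mod 2"

text \<open>Index of the basis state of the qubits qs (in the given order, first = most significant).\<close>
definition subidx :: "nat \<Rightarrow> nat list \<Rightarrow> nat \<Rightarrow> nat" where
  "subidx N qs i = (\<Sum>t<length qs. qbit N i (qs ! t) * 2 ^ (length qs - 1 - t))"

text \<open>The gate G acting on the ordered list of qubits qs, tensored with identities elsewhere.\<close>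
definition embed_gate :: "nat \<Rightarrow> complex mat \<Rightarrow> nat list \<Rightarrow> complex mat" where
  "embed_gate N G qs = mat (2 ^ N) (2 ^ N) (\<lambda>(r,c).
     if (\<forall>q<N. q \<notin> set qs \<longrightarrow> qbit N r q = qbit N c q)
     then G $$ (subidx N qs r, subidx N qs c) else 0)"

inductive_set circuits :: "nat \<Rightarrow> complex mat set \<Rightarrow> complex mat set" for N \<G> where
  empty: "1\<^sub>m (2 ^ N) \<in> circuits N \<G>"
| step: "C \<in> circuits N \<G> \<Longrightarrow> G \<in> \<G> \<Longrightarrow> G \<in> carrier_mat (2 ^ length qs) (2 ^ length qs) \<Longrightarrow>
         distinct qs \<Longrightarrow> set qs \<subseteq> {..<N} \<Longrightarrow> embed_gate N G qs * C \<in> circuits N \<G>"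

text \<open>u tensor |0>^a (ancillas are the last a qubits).\<close>
definition anc_ext :: "nat \<Rightarrow> complex vec \<Rightarrow> complex vec" where
  "anc_ext a u = vec (dim_vec u * 2 ^ a) (\<lambda>i. if i mod 2 ^ a = 0 then u $ (i div 2 ^ a) else 0)"

definition exactly_represents :: "nat \<Rightarrow> nat \<Rightarrow> complex mat \<Rightarrow> complex mat \<Rightarrow> bool" where
  "exactly_represents m a C U \<longleftrightarrow>
     (\<forall>u \<in> carrier_vec (2 ^ m). C *\<^sub>v anc_ext a u = anc_ext a (U *\<^sub>v u))"

definition representable :: "complex mat set \<Rightarrow> nat \<Rightarrow> nat \<Rightarrow> complex mat \<Rightarrow> bool" where
  "representable \<G> m a U \<longleftrightarrow> (\<exists>C \<in> circuits (m + a) \<G>. exactly_represents m a C U)"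

end

theory Submission
  imports Defs "HOL-Combinatorics.Transposition"
begin

text \<open>
  Entries of circuits clearly lie in the ring, so the content is synthesis.
  For \<open>n = 2, 4, 8\<close> the element \<open>\<delta> = 1 - \<zeta>\<close> generates the prime above 2 of \<open>\<int>[\<zeta>]\<close>, with residue field
  of order 2. Write a unit column as \<open>w / \<delta>^(e+1)\<close>. Since \<open>\<Sum> |w|\<^sup>2 = |\<delta>|^(2e+2)\<close>, the number of
  odd entries is even. For \<open>n = 4, 8\<close> every odd entry is a power of \<open>\<zeta>\<close> modulo \<open>\<delta> (1 - \<i>)\<close>, so a power
  of \<open>\<zeta>\<close> on one level followed by \<open>H'\<close> on two levels makes two odd entries even; for \<open>n = 2\<close> the same works
  with signs and \<open>H \<otimes> H\<close> on four levels. Hence the denominators can be removed, and an integral unit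
  vector is a root of unity times a basis vector.

  The level operators are built from gates with one ancilla: permutations use it as a borrowed
  qubit, and the multiply controlled phase uses it as a clean one.

  For \<open>n = 2^k > 8\<close> the residue argument fails. There, \<open>\<zeta>\<^bsub>2n\<^esub>\<close> is replaced by the 2-by-2 matrix
  with rows \<open>(0, \<zeta>\<^bsub>n\<^esub>)\<close> and \<open>(1, 0)\<close>, which turns \<open>U\<close> into a unitary on one more qubit with entries in the
  smaller ring; the original \<open>U\<close> is recovered by feeding that qubit with the eigenvector
  \<open>(1, \<zeta>\<^bsub>2n\<^esub>\<inverse>) / \<surd>2\<close>, which is prepared by \<open>H'\<close> and a power of \<open>T\<close> and left unchanged.
\<close>

section \<open>Linear independence in cyclotomic fields\<close>

text \<open>For \<open>n \<ge> 2\<close> a power of two, 1 and \<open>zeta (2 * n)\<close> are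
  independent over the field of \<open>zeta n\<close>. This one fact makes \<delta> a nonunit,
  drives the descent to integral unit vectors, and splits orthonormality over the larger ring into
  equations over the smaller one. It comes from a tower of quadratic extensions of the Gaussian
  rationals. The matrix M with rows (0, w), (1, 0) can replace a square root of w because M^2 = w I,
  and because M is unitary, so that conjugating the root corresponds to taking the adjoint of M.
  Each doubling of n thus costs one qubit, and n = 8 itself costs one ancilla, whence k - 2. The
  arithmetic half sees circuits only as a monoid of operators. The inverse of each reducing move is
  again a product of available operators, so closure under inverses is never assumed. Amplitudes are
  indexed by bit assignments that are \<open>False\<close> beyond the register. A clean ancilla is
  then just a further bit that is \<open>False\<close>, and no tensor products occur. The gate set
  for n = 8 contains no Toffoli gate; it is first rebuilt from T.\<close>

lemma zeta_sq: "zeta (2 * n) * zeta (2 * n) = zeta n"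
  by (simp add: zeta_def cis_mult field_simps)

lemma zeta_2: "zeta 2 = -1" by (simp add: zeta_def)
lemma zeta_4: "zeta 4 = \<i>" by (simp add: zeta_def)

lemma zeta_nz [simp]: "zeta n \<noteq> 0" by (simp add: zeta_def)

lemma zeta_cnj: "zeta n * cnj (zeta n) = 1"
  by (simp add: zeta_def cis_cnj flip: cis_inverse)

lemma zeta_pow: "n > 0 \<Longrightarrow> zeta n ^ n = 1"
  by (simp add: zeta_def DeMoivre)

text \<open>Since \<open>inverse 0 = 0\<close>, closure under inverses can be asked of all elements
  at once.\<close>

definition subfield_set :: "complex set \<Rightarrow> bool" where
  "subfield_set F \<longleftrightarrow> 1 \<in> F \<and> (\<forall>x\<in>F. \<forall>y\<in>F. x + y \<in> F \<and> x * y \<in> F) \<and> (\<forall>x\<in>F. - x \<in> F \<and> inverse x \<in> F)"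

lemma subfield_setD:
  assumes "subfield_set F"
  shows "1 \<in> F" "x \<in> F \<Longrightarrow> y \<in> F \<Longrightarrow> x + y \<in> F" "x \<in> F \<Longrightarrow> y \<in> F \<Longrightarrow> x * y \<in> F"
    "x \<in> F \<Longrightarrow> - x \<in> F" "x \<in> F \<Longrightarrow> inverse x \<in> F" "0 \<in> F"
    "x \<in> F \<Longrightarrow> y \<in> F \<Longrightarrow> x - y \<in> F" "x \<in> F \<Longrightarrow> y \<in> F \<Longrightarrow> x / y \<in> F"
proof -
  show *: "1 \<in> F" "x \<in> F \<Longrightarrow> y \<in> F \<Longrightarrow> x + y \<in> F" "x \<in> F \<Longrightarrow> y \<in> F \<Longrightarrow> x * y \<in> F"
    "x \<in> F \<Longrightarrow> - x \<in> F" "x \<in> F \<Longrightarrow> inverse x \<in> F" for x y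
    using assms by (auto simp: subfield_set_def)
  from *(2)[OF *(1) *(4)[OF *(1)]] show "0 \<in> F" by simp
  show "x \<in> F \<Longrightarrow> y \<in> F \<Longrightarrow> x - y \<in> F" using *(2)[of x "-y"] *(4)[of y] by simp
  show "x \<in> F \<Longrightarrow> y \<in> F \<Longrightarrow> x / y \<in> F" using *(3)[of x "inverse y"] *(5)[of y] by (simp add: divide_inverse)
qed

definition adjoin :: "complex set \<Rightarrow> complex \<Rightarrow> complex set" where
  "adjoin F z = {a + b * z | a b. a \<in> F \<and> b \<in> F}"

definition nonsquare_in :: "complex set \<Rightarrow> complex \<Rightarrow> bool" where
  "nonsquare_in F w \<longleftrightarrow> (\<forall>x\<in>F. x * x \<noteq> w)"

lemma sqrt_independent:
  assumes F: "subfield_set F" and w: "nonsquare_in F w" and z: "z * z = w"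
    and ab: "a \<in> F" "b \<in> F" and 0: "a + b * z = 0"
  shows "a = 0 \<and> b = 0"
proof (cases "b = 0")
  case False
  then have "z = - a / b" using 0 by (simp add: field_simps eq_neg_iff_add_eq_0)
  moreover have "- a / b \<in> F" using subfield_setD(8)[OF F subfield_setD(4)[OF F ab(1)] ab(2)] .
  ultimately show ?thesis using w z by (auto simp: nonsquare_in_def)
qed (use 0 in simp)

lemma adjoin_mult:
  assumes "z * z = w"
  shows "(a + b * z) * (c + d * z) = (a * c + b * d * w) + (a * d + b * c) * (z::complex)"
  using assms[symmetric] by (simp add: algebra_simps)

text \<open>The invariant of the quadratic tower: what is shown of \<open>z\<close> over the new
  field was assumed of \<open>w\<close> over the old one. If \<open>z\<close> were a square, so
  would be its norm \<open>- w\<close>, and with \<open>\<i>\<close> at hand also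
  \<open>w\<close>.\<close>

lemma adjoin_sqrt:
  assumes F: "subfield_set F" and i: "\<i> \<in> F" and w: "nonsquare_in F w" "w \<in> F" and z: "z * z = w"
  shows "subfield_set (adjoin F z)" "nonsquare_in (adjoin F z) z" "\<i> \<in> adjoin F z" "z \<in> adjoin F z" "F \<subseteq> adjoin F z"
proof -
  note D = subfield_setD[OF F]
  have I: "a + b * z \<in> adjoin F z" if "a \<in> F" "b \<in> F" for a b using that by (auto simp: adjoin_def)
  show sub: "F \<subseteq> adjoin F z" using I[OF _ D(6)] by auto
  then show "\<i> \<in> adjoin F z" using i by auto
  show "z \<in> adjoin F z" using I[OF D(6) D(1)] by simp
  have inv: "inverse (a + b * z) \<in> adjoin F z" if ab: "a \<in> F" "b \<in> F" for a b
  proof (cases "a + b * z = 0")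
    case True then show ?thesis using sub D(6) by auto
  next
    case False
    \<comment> \<open>\<open>?n\<close> is the norm of \<open>a + b * z\<close> over
      \<open>F\<close>; the inverse is the conjugate divided by it.\<close>
    let ?n = "a * a - b * b * w"
    have prod: "(a + b * z) * (a - b * z) = ?n" using adjoin_mult[OF z, of a b a "-b"] by simp
    have nz: "a - b * z \<noteq> 0"
    proof
      assume "a - b * z = 0"
      then have "a = 0 \<and> - b = 0" using sqrt_independent[OF F w(1) z, of a "-b"] ab D(4) by simp
      then show False using False by simp
    qed
    have "inverse (a + b * z) = a / ?n + (- b / ?n) * z"
      unfolding prod[symmetric] using False nz by (simp add: divide_simps)
    moreover have n: "?n \<in> F" by (intro D(3,7) ab w(2))
    ultimately show ?thesis using I[OF D(8)[OF ab(1) n] D(8)[OF D(4)[OF ab(2)] n]] by simp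
  qed
  show "subfield_set (adjoin F z)"
    unfolding subfield_set_def
  proof (intro conjI ballI)
    show "1 \<in> adjoin F z" using sub D(1) by auto
    fix x assume "x \<in> adjoin F z"
    then obtain a b where x: "x = a + b * z" "a \<in> F" "b \<in> F" by (auto simp: adjoin_def)
    then show "inverse x \<in> adjoin F z" using inv by simp
    show "- x \<in> adjoin F z" using I[of "-a" "-b"] x D(4) by simp
    fix y assume "y \<in> adjoin F z"
    then obtain c d where y: "y = c + d * z" "c \<in> F" "d \<in> F" by (auto simp: adjoin_def)
    show "x + y \<in> adjoin F z" using I[of "a+c" "b+d"] x y D(2) by (simp add: algebra_simps)
    show "x * y \<in> adjoin F z" unfolding x y adjoin_mult[OF z] by (intro I D(2,3) x y w(2))
  qed
  txt \<open>If \<open>z = (a + b z)\<^sup>2\<close> then \<open>a\<^sup>2 = - b\<^sup>2 w\<close> and \<open>2 a b = 1\<close>, so that \<open>w = (2 a\<^sup>2 \<i>)\<^sup>2\<close>.\<close>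
  show "nonsquare_in (adjoin F z) z" unfolding nonsquare_in_def
  proof (intro ballI notI)
    fix x assume "x \<in> adjoin F z" and sq: "x * x = z"
    then obtain a b where x: "x = a + b * z" "a \<in> F" "b \<in> F" by (auto simp: adjoin_def)
    have "(a * a + b * b * w) + (a * b + b * a - 1) * z = 0"
      using sq unfolding x(1) adjoin_mult[OF z] by (simp add: algebra_simps)
    moreover have "a * a + b * b * w \<in> F" "a * b + b * a - 1 \<in> F" by (intro D x w(2))+
    ultimately have "a * a + b * b * w = 0" "a * b + b * a - 1 = 0"
      using sqrt_independent[OF F w(1) z] by blast+
    then have e: "a * a + b * b * w = 0" "2 * (a * b) = 1" by (auto simp: algebra_simps)
    then have aa: "a * a = - (b * b * w)" by (simp add: eq_neg_iff_add_eq_0)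
    have "(2 * (a * a) * \<i>) * (2 * (a * a) * \<i>) = - (4 * (a * a) * (a * a))" by (simp add: algebra_simps)
    also have "\<dots> = (2 * (a * b)) * (2 * (a * b)) * w" by (subst (2) aa) (simp add: algebra_simps)
    also have "\<dots> = w" using e by simp
    finally have "(2 * (a * a) * \<i>) * (2 * (a * a) * \<i>) = w" .
    moreover have "2 * (a * a) * \<i> \<in> F" using x i D(2)[OF D(1) D(1)] D(3) by simp
    ultimately show False using w(1) by (auto simp: nonsquare_in_def)
  qed
qed

text \<open>Irrationality of the square root of 1/2. A square root of \<open>\<i>\<close> among the
  Gaussian rationals would have real and imaginary part equal up to sign, with twice their product
  equal to 1.\<close>

lemma double_square_rat: "2 * (r * r) \<noteq> (1::rat)"
proof
  assume h: "2 * (r * r) = 1"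
  obtain p q where pq: "quotient_of r = (p, q)" by fastforce
  have q: "q > 0" and r: "r = of_int p / of_int q" and c: "coprime p q"
    using quotient_of_denom_pos[OF pq] quotient_of_div[OF pq] quotient_of_coprime[OF pq] by auto
  have "(of_int (2 * (p * p)) :: rat) = of_int (q * q)"
    using h q unfolding r by (simp add: field_simps)
  then have e: "2 * (p * p) = q * q" by (simp only: of_int_eq_iff)
  then have "even q" by (metis dvd_triv_left even_mult_iff)
  then obtain s where "q = 2 * s" by blast
  with e have "p * p = 2 * (s * s)" by simp
  then have "even p" by (metis dvd_triv_left even_mult_iff)
  with \<open>even q\<close> c show False using coprime_common_divisor by fastforce
qed

lemma gauss_rationals:
  shows "subfield_set (adjoin \<rat> \<i>)" "nonsquare_in (adjoin \<rat> \<i>) \<i>"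
proof -
  have I: "a + b * \<i> \<in> adjoin \<rat> \<i>" if "a \<in> \<rat>" "b \<in> \<rat>" for a b using that by (auto simp: adjoin_def)
  show "subfield_set (adjoin \<rat> \<i>)" unfolding subfield_set_def
  proof (intro conjI ballI)
    show "1 \<in> adjoin \<rat> \<i>" using I[of 1 0] by simp
    fix x assume "x \<in> adjoin \<rat> \<i>"
    then obtain a b where x: "x = of_rat a + of_rat b * \<i>" by (auto simp: adjoin_def Rats_def)
    show "- x \<in> adjoin \<rat> \<i>" using I[of "- of_rat a" "- of_rat b"] x by simp
    have "inverse x = of_rat (a / (a*a+b*b)) + of_rat (- b / (a*a+b*b)) * \<i>"
    proof (cases "a*a+b*b = 0")
      case True
      then have "a = 0" "b = 0" by (simp_all add: sum_squares_eq_zero_iff)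
      then show ?thesis by (simp add: x)
    next
      case False
      have "x * (of_rat (a / (a*a+b*b)) + of_rat (- b / (a*a+b*b)) * \<i>)
         = of_rat (a * (a / (a*a+b*b)) - b * (- b / (a*a+b*b))) + of_rat (a * (- b / (a*a+b*b)) + b * (a / (a*a+b*b))) * \<i>"
        by (simp only: x of_rat_add of_rat_mult of_rat_diff) (simp add: algebra_simps)
      also have "a * (a / (a*a+b*b)) - b * (- b / (a*a+b*b)) = (a*a+b*b) / (a*a+b*b)" by (simp only: add_divide_distrib) simp
      also have "\<dots> = 1" using False by (rule divide_self)
      also have "a * (- b / (a*a+b*b)) + b * (a / (a*a+b*b)) = 0" by simp
      finally show ?thesis by (intro inverse_unique) simp
    qed
    then show "inverse x \<in> adjoin \<rat> \<i>" using I by simp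
    fix y assume "y \<in> adjoin \<rat> \<i>"
    then obtain c d where y: "y = of_rat c + of_rat d * \<i>" by (auto simp: adjoin_def Rats_def)
    show "x + y \<in> adjoin \<rat> \<i>" using I[of "of_rat a + of_rat c" "of_rat b + of_rat d"] unfolding x y by (simp add: algebra_simps)
    show "x * y \<in> adjoin \<rat> \<i>"
      using I[of "of_rat a * of_rat c - of_rat b * of_rat d" "of_rat a * of_rat d + of_rat b * of_rat c"]
      unfolding x y by (simp add: algebra_simps)
  qed
  show "nonsquare_in (adjoin \<rat> \<i>) \<i>" unfolding nonsquare_in_def
  proof (intro ballI notI)
    fix x assume "x \<in> adjoin \<rat> \<i>" and sq: "x * x = \<i>"
    then obtain a b where x: "x = of_rat a + of_rat b * \<i>" by (auto simp: adjoin_def Rats_def)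
    have q: "of_rat r = (complex_of_real (of_rat r))" for r
    proof -
      obtain p s where "quotient_of r = (p, s)" by fastforce
      then have "r = of_int p / of_int s" by (rule quotient_of_div)
      then show ?thesis by (simp add: of_rat_divide)
    qed
    have "Re (x * x) = of_rat (a * a - b * b)" "Im (x * x) = of_rat (2 * (a * b))"
      unfolding x q by (simp_all add: of_rat_mult of_rat_diff)
    then have "a * a - b * b = 0" "2 * (a * b) = 1"
      using sq by (auto simp: of_rat_eq_iff simp del: of_rat_mult of_rat_diff)
    then have e: "a * a = b * b" "2 * (a * b) = 1" by auto
    then have "a = b \<or> a = - b" by (simp add: square_eq_iff)
    then show False
    proof
      assume "a = - b"
      then have "2 * (b * b) = -1" using e by simp
      moreover have "b * b \<ge> 0" by simp
      ultimately show False by linarith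
    qed (use double_square_rat e in auto)
  qed
qed

text \<open>\<open>tower j\<close> is the cyclotomic field of order \<open>2 ^ (j + 2)\<close>. It
  starts at the Gaussian rationals because \<open>adjoin_sqrt\<close> wants \<open>\<i>\<close> in
  the base field.\<close>

fun tower :: "nat \<Rightarrow> complex set" where
  "tower 0 = adjoin \<rat> \<i>"
| "tower (Suc j) = adjoin (tower j) (zeta (2 ^ (j + 3)))"

lemma tower_props:
  "subfield_set (tower j) \<and> \<i> \<in> tower j \<and> zeta (2 ^ (j + 2)) \<in> tower j \<and> nonsquare_in (tower j) (zeta (2 ^ (j + 2)))"
proof (induction j)
  case 0
  have "\<i> \<in> adjoin \<rat> \<i>" unfolding adjoin_def by (intro CollectI exI[of _ 0] exI[of _ 1]) auto
  then show ?case using gauss_rationals zeta_4 by auto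
next
  case (Suc j)
  have "zeta (2 ^ (j + 3)) * zeta (2 ^ (j + 3)) = zeta (2 ^ (j + 2))"
    using zeta_sq[of "2 ^ (j+2)"] by (simp add: eval_nat_numeral)
  from adjoin_sqrt[OF _ _ _ _ this, of "tower j"] Suc show ?case
    by (simp add: eval_nat_numeral)
qed

lemma Zhalf_subset_subfield:
  assumes "subfield_set F" "zeta n \<in> F" shows "Zhalf_zeta n \<subseteq> F"
proof
  note D = subfield_setD[OF assms(1)]
  fix x assume "x \<in> Zhalf_zeta n"
  then show "x \<in> F"
  proof induction
    case half
    show ?case using D(8)[OF D(1) D(2)[OF D(1) D(1)]] by simp
  qed (use D assms in auto)
qed

text \<open>The ring lies in a field of the tower, over which \<open>zeta (2 ^ Suc k)\<close> is the
  root of a nonsquare. The bound on \<open>k\<close> reflects that the tower starts at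
  \<open>\<i>\<close>.\<close>

lemma zeta_independent:
  assumes "k \<ge> 2" "a \<in> Zhalf_zeta (2 ^ k)" "b \<in> Zhalf_zeta (2 ^ k)" "a + b * zeta (2 ^ Suc k) = 0"
  shows "a = 0" "b = 0"
proof -
  obtain j where k: "k = j + 2" using assms(1) by (metis add.commute le_Suc_ex)
  note T = tower_props[of j]
  have "Zhalf_zeta (2 ^ k) \<subseteq> tower j" using T Zhalf_subset_subfield k by blast
  moreover have "zeta (2 ^ Suc k) * zeta (2 ^ Suc k) = zeta (2 ^ k)" using zeta_sq[of "2^k"] by simp
  ultimately have "a = 0 \<and> b = 0"
    using sqrt_independent[of "tower j" "zeta (2^k)" "zeta (2^Suc k)" a b] T k assms by blast
  then show "a = 0" "b = 0" by auto
qed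

section \<open>Closure properties of the ring and its splitting over the ring of half the
  order\<close>

lemma Zhalf_0: "0 \<in> Zhalf_zeta n"
  using Zhalf_zeta.add[OF Zhalf_zeta.one Zhalf_zeta.uminus[OF Zhalf_zeta.one]] by simp

lemma Zhalf_diff: "x \<in> Zhalf_zeta n \<Longrightarrow> y \<in> Zhalf_zeta n \<Longrightarrow> x - y \<in> Zhalf_zeta n"
  using Zhalf_zeta.add[OF _ Zhalf_zeta.uminus] by fastforce

lemma Zhalf_pow: "x \<in> Zhalf_zeta n \<Longrightarrow> x ^ j \<in> Zhalf_zeta n"
  by (induction j) (auto intro: Zhalf_zeta.intros)

lemma Zhalf_sum: "(\<And>x. x \<in> A \<Longrightarrow> f x \<in> Zhalf_zeta n) \<Longrightarrow> sum f A \<in> Zhalf_zeta n"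
  by (induction A rule: infinite_finite_induct) (auto intro: Zhalf_zeta.intros Zhalf_0)

lemma cnj_zeta_pow: "n > 0 \<Longrightarrow> cnj (zeta n) = zeta n ^ (n - 1)"
proof -
  assume "n > 0"
  then have "zeta n * zeta n ^ (n - 1) = 1" using zeta_pow[of n] by (metis power_eq_if less_numeral_extra(3))
  then show ?thesis using zeta_cnj[of n] zeta_nz[of n] by (metis mult_left_cancel)
qed

lemma Zhalf_cnj: "x \<in> Zhalf_zeta n \<Longrightarrow> n > 0 \<Longrightarrow> cnj x \<in> Zhalf_zeta n"
  by (induction rule: Zhalf_zeta.induct)
    (auto intro: Zhalf_zeta.intros Zhalf_pow simp: cnj_zeta_pow)

lemma zeta_Suc_sq: "zeta (2 ^ Suc k) * zeta (2 ^ Suc k) = zeta (2 ^ k)"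
  using zeta_sq[of "2^k"] by simp

lemma Zhalf_Suc_decomp:
  "x \<in> Zhalf_zeta (2 ^ Suc k) \<Longrightarrow> \<exists>a\<in>Zhalf_zeta (2 ^ k). \<exists>b\<in>Zhalf_zeta (2 ^ k). x = a + b * zeta (2 ^ Suc k)"
proof (induction rule: Zhalf_zeta.induct)
  case one show ?case by (intro bexI[of _ 1] bexI[of _ 0]) (auto intro: Zhalf_zeta.intros Zhalf_0)
next
  case half show ?case by (intro bexI[of _ "1/2"] bexI[of _ 0]) (auto intro: Zhalf_zeta.intros Zhalf_0)
next
  case root show ?case by (intro bexI[of _ 0] bexI[of _ 1]) (auto intro: Zhalf_zeta.intros Zhalf_0)
next
  case (uminus x)
  then obtain a b where "a \<in> Zhalf_zeta (2 ^ k)" "b \<in> Zhalf_zeta (2 ^ k)" "x = a + b * zeta (2 ^ Suc k)" by blast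
  then show ?case by (intro bexI[of _ "-a"] bexI[of _ "-b"]) (auto intro: Zhalf_zeta.intros)
next
  case (add x y)
  then obtain a b c d where "a \<in> Zhalf_zeta (2 ^ k)" "b \<in> Zhalf_zeta (2 ^ k)" "x = a + b * zeta (2 ^ Suc k)"
    "c \<in> Zhalf_zeta (2 ^ k)" "d \<in> Zhalf_zeta (2 ^ k)" "y = c + d * zeta (2 ^ Suc k)" by blast
  then show ?case
    by (intro bexI[of _ "a+c"] bexI[of _ "b+d"]) (auto intro: Zhalf_zeta.intros simp: algebra_simps)
next
  case (mult x y)
  then obtain a b c d where h: "a \<in> Zhalf_zeta (2 ^ k)" "b \<in> Zhalf_zeta (2 ^ k)" "x = a + b * zeta (2 ^ Suc k)"
    "c \<in> Zhalf_zeta (2 ^ k)" "d \<in> Zhalf_zeta (2 ^ k)" "y = c + d * zeta (2 ^ Suc k)" by blast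
  have "a * c + b * d * zeta (2 ^ k) \<in> Zhalf_zeta (2 ^ k)" "a * d + b * c \<in> Zhalf_zeta (2 ^ k)"
    by (intro Zhalf_zeta.add Zhalf_zeta.mult h Zhalf_zeta.root)+
  then show ?case unfolding h adjoin_mult[OF zeta_Suc_sq] by blast
qed


section \<open>Cyclotomic integers\<close>

text \<open>The ring of numerators: from here on denominators are powers of \<delta> instead of
  powers of 2.\<close>

inductive_set Zzeta :: "nat \<Rightarrow> complex set" for n :: nat where
  one: "1 \<in> Zzeta n"
| root: "zeta n \<in> Zzeta n"
| uminus: "x \<in> Zzeta n \<Longrightarrow> - x \<in> Zzeta n"
| add: "x \<in> Zzeta n \<Longrightarrow> y \<in> Zzeta n \<Longrightarrow> x + y \<in> Zzeta n"
| mult: "x \<in> Zzeta n \<Longrightarrow> y \<in> Zzeta n \<Longrightarrow> x * y \<in> Zzeta n"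

lemma Zzeta_0: "0 \<in> Zzeta n"
  using Zzeta.add[OF Zzeta.one Zzeta.uminus[OF Zzeta.one]] by simp

lemma Zzeta_diff: "x \<in> Zzeta n \<Longrightarrow> y \<in> Zzeta n \<Longrightarrow> x - y \<in> Zzeta n"
  using Zzeta.add[OF _ Zzeta.uminus] by fastforce

lemma Zzeta_pow: "x \<in> Zzeta n \<Longrightarrow> x ^ j \<in> Zzeta n"
  by (induction j) (auto intro: Zzeta.intros)

lemma Zzeta_sum: "(\<And>x. x \<in> A \<Longrightarrow> f x \<in> Zzeta n) \<Longrightarrow> sum f A \<in> Zzeta n"
  by (induction A rule: infinite_finite_induct) (auto intro: Zzeta.intros Zzeta_0)

lemma Zzeta_of_nat: "of_nat j \<in> Zzeta n"
  by (induction j) (auto intro: Zzeta.intros Zzeta_0)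

lemma Zzeta_numeral: "numeral m \<in> Zzeta n"
  using Zzeta_of_nat[of "numeral m"] by simp

lemmas Zzeta_intros = Zzeta.intros Zzeta_0 Zzeta_diff Zzeta_pow Zzeta_sum Zzeta_numeral

lemma Zzeta_cnj: "x \<in> Zzeta n \<Longrightarrow> n > 0 \<Longrightarrow> cnj x \<in> Zzeta n"
  by (induction rule: Zzeta.induct)
    (auto intro: Zzeta.intros Zzeta_pow simp: cnj_zeta_pow)

lemma Zzeta_Zhalf: "x \<in> Zzeta n \<Longrightarrow> x \<in> Zhalf_zeta n"
  by (induction rule: Zzeta.induct) (auto intro: Zhalf_zeta.intros)

lemma Zzeta_Suc_decomp:
  "x \<in> Zzeta (2 ^ Suc k) \<Longrightarrow> \<exists>a\<in>Zzeta (2 ^ k). \<exists>b\<in>Zzeta (2 ^ k). x = a + b * zeta (2 ^ Suc k)"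
proof (induction rule: Zzeta.induct)
  case one show ?case by (intro bexI[of _ 1] bexI[of _ 0]) (auto intro: Zzeta_intros)
next
  case root show ?case by (intro bexI[of _ 0] bexI[of _ 1]) (auto intro: Zzeta_intros)
next
  case (uminus x)
  then obtain a b where "a \<in> Zzeta (2 ^ k)" "b \<in> Zzeta (2 ^ k)" "x = a + b * zeta (2 ^ Suc k)" by blast
  then show ?case by (intro bexI[of _ "-a"] bexI[of _ "-b"]) (auto intro: Zzeta_intros)
next
  case (add x y)
  then obtain a b c d where "a \<in> Zzeta (2 ^ k)" "b \<in> Zzeta (2 ^ k)" "x = a + b * zeta (2 ^ Suc k)"
    "c \<in> Zzeta (2 ^ k)" "d \<in> Zzeta (2 ^ k)" "y = c + d * zeta (2 ^ Suc k)" by blast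
  then show ?case
    by (intro bexI[of _ "a+c"] bexI[of _ "b+d"]) (auto intro: Zzeta.intros simp: algebra_simps)
next
  case (mult x y)
  then obtain a b c d where h: "a \<in> Zzeta (2 ^ k)" "b \<in> Zzeta (2 ^ k)" "x = a + b * zeta (2 ^ Suc k)"
    "c \<in> Zzeta (2 ^ k)" "d \<in> Zzeta (2 ^ k)" "y = c + d * zeta (2 ^ Suc k)" by blast
  have "a * c + b * d * zeta (2 ^ k) \<in> Zzeta (2 ^ k)" "a * d + b * c \<in> Zzeta (2 ^ k)"
    by (intro Zzeta.add Zzeta.mult h Zzeta.root)+
  then show ?case unfolding h adjoin_mult[OF zeta_Suc_sq] by blast
qed

lemma Zzeta_2: "x \<in> Zzeta 2 \<Longrightarrow> x \<in> \<int>"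
  by (induction rule: Zzeta.induct) (auto simp: zeta_2)

text \<open>Adds the case \<open>k = 1\<close>, where the coefficients are integers and real and
  imaginary parts can be compared.\<close>

lemma Zzeta_independent:
  assumes k: "k \<ge> 1" and a: "a \<in> Zzeta (2 ^ k)" and b: "b \<in> Zzeta (2 ^ k)"
    and 0: "a + b * zeta (2 ^ Suc k) = 0"
  shows "a = 0" "b = 0"
proof -
  have "a = 0 \<and> b = 0"
  proof (cases "k = 1")
    case True
    then obtain p q where "a = of_int p" "b = of_int q" using a b Zzeta_2[of a] Zzeta_2[of b] by (auto elim!: Ints_cases)
    then show ?thesis using 0 True by (auto simp: zeta_4 complex_eq_iff)
  next
    case False
    then show ?thesis using zeta_independent[of k a b] k a b 0 by (auto intro: Zzeta_Zhalf)
  qed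
  then show "a = 0" "b = 0" by auto
qed

section \<open>The prime above 2 and integral vectors of norm one\<close>

abbreviation \<delta> :: "nat \<Rightarrow> complex" where "\<delta> n \<equiv> 1 - zeta n"

text \<open>Descent: if \<open>p + q * ?z\<close> inverts \<delta>, comparing coefficients gives
  \<open>q = p\<close>, and then \<open>p\<close> inverts the \<delta> of half the order. At the
  bottom, 2 would be invertible among the integers.\<close>

lemma \<delta>_nonunit:
  assumes "r \<in> Zzeta (2 ^ Suc j)" shows "\<delta> (2 ^ Suc j) * r \<noteq> 1"
  using assms
proof (induction j arbitrary: r)
  case 0
  then obtain p where "r = of_int p" using Zzeta_2 by (auto elim!: Ints_cases)
  then have "\<delta> (2 ^ Suc 0) * r = of_int (2 * p)" by (simp add: zeta_2)
  moreover have "2 * p \<noteq> 1" by presburger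
  ultimately show ?case by (metis of_int_1 of_int_eq_iff)
next
  case (Suc j)
  let ?z = "zeta (2 ^ Suc (Suc j))"
  obtain p q where r: "p \<in> Zzeta (2 ^ Suc j)" "q \<in> Zzeta (2 ^ Suc j)" "r = p + q * ?z"
    using Zzeta_Suc_decomp[OF Suc.prems] by blast
  show ?case
  proof
    assume "(1 - ?z) * r = 1"
    then have "(p - q * (?z * ?z) - 1) + (q - p) * ?z = 0" unfolding r(3) by (simp add: algebra_simps)
    then have "(p - q * zeta (2 ^ Suc j) - 1) + (q - p) * ?z = 0" unfolding zeta_Suc_sq .
    moreover have "p - q * zeta (2 ^ Suc j) - 1 \<in> Zzeta (2 ^ Suc j)" "q - p \<in> Zzeta (2 ^ Suc j)"
      by (intro Zzeta_intros r)+
    ultimately have "p - q * zeta (2 ^ Suc j) - 1 = 0" "q - p = 0"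
      using Zzeta_independent[of "Suc j" "p - q * zeta (2 ^ Suc j) - 1" "q - p"] by auto
    then have "\<delta> (2 ^ Suc j) * p = 1" by (simp add: algebra_simps)
    with Suc.IH r show False by blast
  qed
qed

lemma sum_squares_1_int:
  assumes "finite A" "(\<Sum>x\<in>A. c x * c x) = (1::int)"
  shows "\<exists>x\<in>A. (c x = 1 \<or> c x = -1) \<and> (\<forall>y\<in>A - {x}. c y = 0)"
proof -
  have "\<exists>x\<in>A. c x \<noteq> 0"
  proof (rule ccontr)
    assume "\<not> ?thesis"
    then have "(\<Sum>x\<in>A. c x * c x) = 0" by (intro sum.neutral) auto
    then show False using assms by simp
  qed
  then obtain x where x: "x \<in> A" "c x \<noteq> 0" by blast
  have s: "c x * c x + (\<Sum>y\<in>A - {x}. c y * c y) = 1" using assms x by (simp add: sum.remove)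
  have "c x * c x \<noteq> 0" "c x * c x \<ge> 0" using x by auto
  then have "c x * c x > 0" by linarith
  moreover have ge: "(\<Sum>y\<in>A - {x}. c y * c y) \<ge> 0" by (intro sum_nonneg) simp
  ultimately have 1: "c x * c x = 1" "(\<Sum>y\<in>A - {x}. c y * c y) = 0" using s by linarith+
  then have "\<forall>y\<in>A - {x}. c y * c y = 0" using assms by (subst (asm) sum_nonneg_eq_0_iff) auto
  then show ?thesis using x 1 by (auto simp: zmult_eq_1_iff)
qed

text \<open>Descent to integers. Splitting each entry as \<open>p + q * ?z\<close>, the constant
  coefficient of the norm equation says that the entries of \<open>p\<close> and \<open>q\<close>
  together again have norm one over the smaller ring. They are interleaved at the indices
  \<open>2 * x\<close> and \<open>2 * x + 1\<close>, so the doubled index set stays within the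
  naturals. Finally, integers whose squares sum to 1 are all zero but one.\<close>

lemma Zzeta_norm_1_nat:
  fixes A :: "nat set"
  assumes "finite A" "\<And>x. x \<in> A \<Longrightarrow> w x \<in> Zzeta (2 ^ Suc j)" "(\<Sum>x\<in>A. w x * cnj (w x)) = 1"
  shows "\<exists>x\<in>A. (\<exists>i. w x = zeta (2 ^ Suc j) ^ i) \<and> (\<forall>y\<in>A - {x}. w y = 0)"
  using assms
proof (induction j arbitrary: A w)
  case 0
  have "\<exists>c. \<forall>x\<in>A. w x = of_int (c x)"
    using 0 Zzeta_2 by (intro bchoice) (auto elim!: Ints_cases)
  then obtain c where c: "\<And>x. x \<in> A \<Longrightarrow> w x = of_int (c x)" by blast
  have "of_int (\<Sum>x\<in>A. c x * c x) = (\<Sum>x\<in>A. w x * cnj (w x))" using c by simp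
  then have "(\<Sum>x\<in>A. c x * c x) = 1" using 0 by (metis of_int_1 of_int_eq_iff)
  from sum_squares_1_int[OF 0(1) this] obtain x where
    x: "x \<in> A" "c x = 1 \<or> c x = -1" "\<forall>y\<in>A - {x}. c y = 0" by blast
  have "\<exists>i. w x = zeta (2 ^ Suc 0) ^ i" using x c zeta_2
    by (auto intro: exI[of _ "0::nat"] exI[of _ "1::nat"])
  then show ?case using x c by auto
next
  case (Suc j)
  let ?z = "zeta (2 ^ Suc (Suc j))" and ?z' = "zeta (2 ^ Suc j)"
  have "\<forall>x\<in>A. \<exists>pq. fst pq \<in> Zzeta (2 ^ Suc j) \<and> snd pq \<in> Zzeta (2 ^ Suc j) \<and> w x = fst pq + snd pq * ?z"
    using Zzeta_Suc_decomp[OF Suc.prems(2)] by fastforce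
  from bchoice[OF this] obtain f where f: "\<And>x. x \<in> A \<Longrightarrow> fst (f x) \<in> Zzeta (2 ^ Suc j)"
     "\<And>x. x \<in> A \<Longrightarrow> snd (f x) \<in> Zzeta (2 ^ Suc j)" "\<And>x. x \<in> A \<Longrightarrow> w x = fst (f x) + snd (f x) * ?z" by blast
  define p q where "p = fst \<circ> f" and "q = snd \<circ> f"
  have pq: "\<And>x. x \<in> A \<Longrightarrow> p x \<in> Zzeta (2 ^ Suc j)" "\<And>x. x \<in> A \<Longrightarrow> q x \<in> Zzeta (2 ^ Suc j)"
      "\<And>x. x \<in> A \<Longrightarrow> w x = p x + q x * ?z" using f by (auto simp: p_def q_def)
  let ?P = "\<Sum>x\<in>A. p x * cnj (p x) + q x * cnj (q x)" and ?Q = "\<Sum>x\<in>A. q x * cnj (p x) + p x * cnj (q x) * cnj ?z'"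
  \<comment> \<open>Turns the cross terms into a multiple of \<open>?z\<close> whose coefficient
    lies in the smaller ring.\<close>
  have zc: "cnj ?z = cnj ?z' * ?z"
  proof -
    have "cnj ?z' = cnj (?z * ?z)" by (simp only: zeta_Suc_sq)
    then have "cnj ?z' * ?z = cnj ?z * (?z * cnj ?z)" by (simp only: complex_cnj_mult mult_ac)
    then show ?thesis by (simp only: zeta_cnj mult_1_right)
  qed
  have "w x * cnj (w x) = (p x * cnj (p x) + q x * cnj (q x)) + (q x * cnj (p x) + p x * cnj (q x) * cnj ?z') * ?z" if "x \<in> A" for x
  proof -
    have "w x * cnj (w x) = (p x * cnj (p x) + q x * cnj (q x) * (?z * cnj ?z)) + (q x * cnj (p x) * ?z + p x * cnj (q x) * cnj ?z)"
      unfolding pq(3)[OF that] by (simp add: algebra_simps)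
    then show ?thesis unfolding zeta_cnj unfolding zc by (simp add: algebra_simps)
  qed
  then have "(\<Sum>x\<in>A. w x * cnj (w x)) = (\<Sum>x\<in>A. (p x * cnj (p x) + q x * cnj (q x)) + (q x * cnj (p x) + p x * cnj (q x) * cnj ?z') * ?z)"
    by (intro sum.cong) auto
  also have "\<dots> = ?P + ?Q * ?z" by (subst sum.distrib) (simp only: sum_distrib_right)
  finally have "?P + ?Q * ?z = 1" using Suc.prems(3) by simp
  then have e0: "(?P - 1) + ?Q * ?z = 0" by (simp only: diff_add_eq right_minus_eq)
  have m: "?P - 1 \<in> Zzeta (2 ^ Suc j)" "?Q \<in> Zzeta (2 ^ Suc j)"
    by (intro Zzeta_intros Zzeta_cnj pq; simp)+
  have "?P - 1 = 0" by (rule Zzeta_independent(1)[OF _ m e0]) simp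
  then have P: "?P = 1" by (simp only: right_minus_eq)
  define v where "v = (\<lambda>x. if even x then p (x div 2) else q (x div 2))"
  define B where "B = (\<lambda>x. 2 * x) ` A \<union> (\<lambda>x. 2 * x + 1) ` A"
  have disj: "(\<lambda>x. 2 * x) ` A \<inter> (\<lambda>x. 2 * x + 1) ` A = {}"
    by (auto, presburger)
  have "(\<Sum>x\<in>B. v x * cnj (v x)) = ?P" unfolding B_def
    by (subst sum.union_disjoint[OF _ _ disj])
      (use Suc.prems(1) in \<open>auto simp: sum.reindex inj_on_def v_def sum.distrib\<close>)
  with P have "\<exists>x\<in>B. (\<exists>i. v x = ?z' ^ i) \<and> (\<forall>y\<in>B - {x}. v y = 0)"
    by (intro Suc.IH) (use Suc.prems(1) pq in \<open>auto simp: B_def v_def\<close>)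
  then obtain s i where s: "s \<in> B" "v s = ?z' ^ i" "\<And>y. y \<in> B \<Longrightarrow> y \<noteq> s \<Longrightarrow> v y = 0" by blast
  have z: "\<And>y. y \<in> A \<Longrightarrow> 2 * y \<noteq> s \<Longrightarrow> p y = 0" "\<And>y. y \<in> A \<Longrightarrow> 2 * y + 1 \<noteq> s \<Longrightarrow> q y = 0"
    using s(3)[of "2 * _"] s(3)[of "2 * _ + 1"] by (auto simp: v_def B_def)
  have zp: "?z' ^ i = ?z ^ (2 * i)" by (simp only: power_mult power2_eq_square zeta_Suc_sq)
  from s(1) consider x where "x \<in> A" "s = 2 * x" | x where "x \<in> A" "s = 2 * x + 1" by (auto simp: B_def)
  then show ?case
  proof cases
    case (1 x)
    have "q x = 0" using 1 by (intro z) auto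
    then have "w x = ?z ^ (2 * i)" using s(2) 1 pq(3)[of x] zp by (simp add: v_def)
    moreover have "w y = 0" if "y \<in> A - {x}" for y
    proof -
      have "2 * y + 1 \<noteq> s" using 1 by presburger
      then show ?thesis using that z[of y] pq(3)[of y] 1 by auto
    qed
    ultimately show ?thesis using 1 by blast
  next
    case (2 x)
    have "2 * x \<noteq> s" using 2 by presburger
    then have "p x = 0" using 2 by (intro z) auto
    then have "w x = ?z ^ (2 * i + 1)" using s(2) 2 pq(3)[of x] zp by (simp add: v_def)
    moreover have "w y = 0" if "y \<in> A - {x}" for y
    proof -
      have "2 * y \<noteq> s" using 2 by presburger
      then show ?thesis using that z[of y] pq(3)[of y] 2 by auto
    qed
    ultimately show ?thesis using 2 by blast
  qed
qed

lemma Zzeta_norm_1: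
  assumes "finite A" "\<And>x. x \<in> A \<Longrightarrow> w x \<in> Zzeta (2 ^ Suc j)" "(\<Sum>x\<in>A. w x * cnj (w x)) = 1"
  shows "\<exists>x\<in>A. (\<exists>i. w x = zeta (2 ^ Suc j) ^ i) \<and> (\<forall>y\<in>A - {x}. w y = 0)"
proof -
  obtain h where h: "bij_betw h {0..<card A} A" using ex_bij_betw_nat_finite[OF assms(1)] by blast
  have hA: "\<And>i. i \<in> {0..<card A} \<Longrightarrow> h i \<in> A" using h bij_betw_apply by metis
  have "(\<Sum>i\<in>{0..<card A}. w (h i) * cnj (w (h i))) = 1"
    using sum.reindex_bij_betw[OF h, of "\<lambda>x. w x * cnj (w x)"] assms(3) by simp
  from Zzeta_norm_1_nat[OF _ _ this] assms(2) hA obtain i l where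
    i: "i \<in> {0..<card A}" "w (h i) = zeta (2 ^ Suc j) ^ l" "\<forall>y\<in>{0..<card A} - {i}. w (h y) = 0" by blast
  have "w y = 0" if y: "y \<in> A - {h i}" for y
  proof -
    obtain l where "l \<in> {0..<card A}" "y = h l" using h y by (metis DiffD1 bij_betw_imp_surj_on imageE)
    then show ?thesis using i y by auto
  qed
  then show ?thesis using i hA by blast
qed

lemma i_in_Zzeta: "\<i> \<in> Zzeta 4" "\<i> \<in> Zzeta 8"
proof -
  show "\<i> \<in> Zzeta 4" using Zzeta.root[of 4] by (simp add: zeta_4)
  show "\<i> \<in> Zzeta 8" using Zzeta.mult[OF Zzeta.root Zzeta.root, of 8] zeta_sq[of 4] by (simp add: zeta_4)
qed

lemma zeta_8_sq: "zeta 8 * zeta 8 = \<i>" using zeta_sq[of 4] by (simp add: zeta_4)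

lemma two_multiple_\<delta>:
  assumes "n \<in> {2,4,8}" shows "\<exists>r\<in>Zzeta n. 2 = \<delta> n * r"
proof -
  consider "n = 2" | "n = 4" | "n = 8" using assms by auto
  then show ?thesis
  proof cases
    case 1 then show ?thesis by (intro bexI[of _ 1]) (auto simp: zeta_2 intro: Zzeta.one)
  next
    case 2
    have "1 + \<i> \<in> Zzeta 4" by (intro Zzeta_intros i_in_Zzeta)
    with 2 show ?thesis by (intro bexI[of _ "1 + \<i>"]) (auto simp: zeta_4 algebra_simps)
  next
    case 3
    have "(1 + zeta 8) * (1 + \<i>) \<in> Zzeta 8" by (intro Zzeta_intros i_in_Zzeta)
    moreover have "\<delta> 8 * ((1 + zeta 8) * (1 + \<i>)) = (1 - zeta 8 * zeta 8) * (1 + \<i>)" by (simp add: algebra_simps)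
    then have "\<delta> 8 * ((1 + zeta 8) * (1 + \<i>)) = 2" unfolding zeta_8_sq by (simp add: algebra_simps)
    ultimately show ?thesis using 3 by (intro bexI[of _ "(1 + zeta 8) * (1 + \<i>)"]) auto
  qed
qed

text \<open>2 is a unit times the power n/2 of \<delta>. The numerator is that power divided by 2,
  which is integral in each of the three cases.\<close>

lemma half_over_\<delta>:
  assumes "n \<in> {2,4,8}" shows "\<exists>r\<in>Zzeta n. \<exists>e. 1/2 = r / \<delta> n ^ e"
proof -
  consider "n = 2" | "n = 4" | "n = 8" using assms by auto
  then show ?thesis
  proof cases
    case 1 then show ?thesis by (intro bexI[of _ 1] exI[of _ 1]) (auto simp: zeta_2 intro: Zzeta.one)
  next
    case 2
    have "- \<i> \<in> Zzeta 4" by (intro Zzeta_intros i_in_Zzeta)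
    moreover have "\<delta> 4 ^ 2 = - 2 * \<i>" by (simp add: zeta_4 power2_eq_square algebra_simps)
    then have "1/2 = (- \<i>) / \<delta> 4 ^ 2" by simp
    ultimately show ?thesis using 2 by blast
  next
    case 3
    define w where "w = zeta 8"
    have w: "w * w = \<i>" unfolding w_def by (rule zeta_8_sq)
    have "w \<noteq> 1" using w by auto
    have "(1 - w) ^ 4 = 1 - 4 * w + 6 * (w * w) - 4 * (w * w) * w + (w * w) * (w * w)"
      by (simp add: power4_eq_xxxx algebra_simps)
    also have "\<dots> = 2 * (3 * \<i> - 2 * w - 2 * (w * \<i>))" unfolding w by (simp add: algebra_simps)
    finally have "1/2 = (3 * \<i> - 2 * w - 2 * (w * \<i>)) / (1 - w) ^ 4" using \<open>w \<noteq> 1\<close>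
      by (simp add: field_simps)
    moreover have "3 * \<i> - 2 * zeta 8 - 2 * (zeta 8 * \<i>) \<in> Zzeta 8" by (intro Zzeta_intros i_in_Zzeta)
    ultimately show ?thesis using 3 unfolding w_def by blast
  qed
qed

section \<open>Parity modulo \<delta>\<close>

locale small_cyclotomic =
  fixes n :: nat
  assumes n: "n \<in> {2,4,8}"
begin

lemma n_pos: "n > 0" using n by auto

definition even_elt :: "complex \<Rightarrow> bool" where "even_elt u \<longleftrightarrow> (\<exists>r\<in>Zzeta n. u = \<delta> n * r)"

lemma not_even_1: "\<not> even_elt 1"
  using \<delta>_nonunit[of _ 0] \<delta>_nonunit[of _ 1] \<delta>_nonunit[of _ 2] n
  by (auto simp: even_elt_def eval_nat_numeral)

lemma \<delta>_nz: "\<delta> n \<noteq> 0" using not_even_1 two_multiple_\<delta>[OF n] by auto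

lemma even_add: "even_elt u \<Longrightarrow> even_elt v \<Longrightarrow> even_elt (u + v)"
  unfolding even_elt_def by (metis Zzeta.add distrib_left)

lemma even_mult: "even_elt u \<Longrightarrow> v \<in> Zzeta n \<Longrightarrow> even_elt (u * v)"
  unfolding even_elt_def by (metis Zzeta.mult mult.assoc)

lemma even_minus: "even_elt u \<Longrightarrow> even_elt (- u)"
  unfolding even_elt_def by (metis Zzeta.uminus mult_minus_right)

lemma even_diff: "even_elt u \<Longrightarrow> even_elt v \<Longrightarrow> even_elt (u - v)"
  using even_add[OF _ even_minus] by fastforce

lemma even_2: "even_elt 2" using two_multiple_\<delta>[OF n] by (auto simp: even_elt_def)

lemma even_\<delta>: "even_elt (\<delta> n)" unfolding even_elt_def using Zzeta.one by force

lemma even_0: "even_elt 0" unfolding even_elt_def using Zzeta_0 by force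

text \<open>Both generators, 1 and \<open>zeta n\<close>, are congruent to 1, and 2 is even; so
  there are at most two residue classes.\<close>

lemma even_or_odd: "u \<in> Zzeta n \<Longrightarrow> even_elt u \<or> even_elt (u - 1)"
proof (induction rule: Zzeta.induct)
  case one show ?case using even_0 by simp
next
  case root show ?case using even_minus[OF even_\<delta>] by simp
next
  case (uminus x)
  have "- x - 1 = - (x - 1) - 2" by simp
  then show ?case using uminus even_minus even_diff even_2 by metis
next
  case (add x y)
  have "x + y - 1 = x + (y - 1)" "x + y - 1 = x - 1 + y" "x + y = (x - 1) + (y - 1) + 2" by simp_all
  then show ?case using add even_add even_2 by metis
next
  case (mult x y)
  have "x * y - 1 = (x - 1) * y + (y - 1)" by (simp add: algebra_simps)
  then show ?case using mult even_add even_mult by (metis mult.commute)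
qed

text \<open>The conjugate of \<delta> is \<delta> times the unit
  \<open>- cnj (zeta n)\<close>.\<close>

lemma even_cnj: "even_elt u \<Longrightarrow> even_elt (cnj u)"
proof -
  assume "even_elt u"
  then obtain r where r: "r \<in> Zzeta n" "u = \<delta> n * r" by (auto simp: even_elt_def)
  have "cnj (\<delta> n) = \<delta> n * (- cnj (zeta n))" using zeta_cnj[of n] by (simp add: algebra_simps)
  then have "cnj u = \<delta> n * (- cnj (zeta n) * cnj r)" using r by (simp add: mult.assoc)
  then show ?thesis using r(1) n_pos even_elt_def by (metis Zzeta.mult Zzeta.root Zzeta.uminus Zzeta_cnj)
qed

lemma even_Zzeta: "even_elt u \<Longrightarrow> u \<in> Zzeta n"
  unfolding even_elt_def by (auto intro: Zzeta_intros)

lemma Zhalf_over_\<delta>: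
  "x \<in> Zhalf_zeta n \<Longrightarrow> \<exists>r\<in>Zzeta n. \<exists>e. x = r / \<delta> n ^ e"
proof (induction rule: Zhalf_zeta.induct)
  case one show ?case by (intro bexI[of _ 1] exI[of _ 0]) (auto intro: Zzeta_intros)
next
  case half show ?case using half_over_\<delta>[OF n] by blast
next
  case root show ?case by (intro bexI[of _ "zeta n"] exI[of _ 0]) (auto intro: Zzeta_intros)
next
  case (uminus x) then show ?case by (metis Zzeta.uminus minus_divide_left)
next
  case (add x y)
  then obtain r e s f where h: "r \<in> Zzeta n" "x = r / \<delta> n ^ e" "s \<in> Zzeta n" "y = s / \<delta> n ^ f" by blast
  have "x + y = (r * \<delta> n ^ f + s * \<delta> n ^ e) / \<delta> n ^ (e + f)"
    using \<delta>_nz by (simp add: h field_simps power_add)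
  moreover have "r * \<delta> n ^ f + s * \<delta> n ^ e \<in> Zzeta n" by (intro Zzeta_intros h)
  ultimately show ?case by blast
next
  case (mult x y)
  then obtain r e s f where h: "r \<in> Zzeta n" "x = r / \<delta> n ^ e" "s \<in> Zzeta n" "y = s / \<delta> n ^ f" by blast
  have "x * y = (r * s) / \<delta> n ^ (e + f)" by (simp add: h power_add)
  then show ?case using h by (blast intro: Zzeta_intros)
qed

text \<open>Modulo \<delta>, \<open>w x * cnj (w x)\<close> is 1 for odd and 0 for even entries, so
  the norm counts the odd ones. The exponent \<open>Suc e\<close> makes the right-hand side even,
  whereas an odd number is not, as 1 is not.\<close>

lemma odd_count:
  assumes "finite A" "\<And>x. x \<in> A \<Longrightarrow> w x \<in> Zzeta n"
    and s: "(\<Sum>x\<in>A. w x * cnj (w x)) = (\<delta> n * cnj (\<delta> n)) ^ Suc e"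
  shows "even (card {x\<in>A. \<not> even_elt (w x)})"
proof (rule ccontr)
  let ?O = "{x\<in>A. \<not> even_elt (w x)}"
  assume odd: "odd (card ?O)"
  have sq: "even_elt (w x * cnj (w x) - (if even_elt (w x) then 0 else 1))" if "x \<in> A" for x
  proof (cases "even_elt (w x)")
    case True then show ?thesis using even_mult Zzeta_cnj[OF assms(2)] that n_pos by simp
  next
    case False
    then have "even_elt (w x - 1)" using even_or_odd assms(2) that by blast
    moreover from even_cnj[OF this] have "even_elt (cnj (w x) - 1)" by simp
    moreover have "w x * cnj (w x) - 1 = (w x - 1) * cnj (w x) + (cnj (w x) - 1)" by (simp add: algebra_simps)
    moreover have "cnj (w x) \<in> Zzeta n" using Zzeta_cnj[OF assms(2)] that n_pos by simp
    ultimately have "even_elt (w x * cnj (w x) - 1)" by (metis even_add even_mult)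
    then show ?thesis using False by simp
  qed
  have ev: "even_elt (sum f B)" if "\<And>x. x \<in> B \<Longrightarrow> even_elt (f x)" for f B
    using that by (induction B rule: infinite_finite_induct) (auto intro: even_0 even_add)
  have "even_elt (\<Sum>x\<in>A. w x * cnj (w x) - (if even_elt (w x) then 0 else 1))" by (intro ev sq)
  also have "(\<Sum>x\<in>A. w x * cnj (w x) - (if even_elt (w x) then 0 else 1)) = (\<Sum>x\<in>A. w x * cnj (w x)) - of_nat (card ?O)"
    using assms(1) by (simp add: sum_subtractf sum.If_cases Int_def conj_commute)
  finally have "even_elt ((\<Sum>x\<in>A. w x * cnj (w x)) - of_nat (card ?O))" .
  moreover have "even_elt (\<Sum>x\<in>A. w x * cnj (w x))" unfolding s power_Suc mult.assoc
    by (intro even_mult even_\<delta> Zzeta_intros Zzeta_cnj n_pos)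
  ultimately have "even_elt (of_nat (card ?O))" using even_diff by (metis diff_diff_eq2 add_diff_cancel_left' diff_add_cancel)
  moreover obtain j where "card ?O = 2 * j + 1" using odd by (elim oddE)
  moreover have "even_elt (2 * of_nat j)"
    using even_mult[OF even_2 Zzeta_of_nat] .
  ultimately have "even_elt (1 + 2 * of_nat j)" by (simp add: algebra_simps)
  with \<open>even_elt (2 * of_nat j)\<close> have "even_elt (1 + 2 * of_nat j - 2 * of_nat j)" by (rule even_diff[rotated])
  then show False using not_even_1 by simp
qed

end

text \<open>The modulus is \<open>\<delta>\<^sup>2\<close> for \<open>n = 4\<close> and \<open>\<delta>\<^sup>3\<close> for \<open>n = 8\<close>, up to units, and the powers of \<open>\<zeta>\<close> exhaust the
  units of the quotient ring. For \<open>n = 16\<close> the modulus would be \<open>\<delta>\<^sup>5\<close>, whose quotient has 16 units,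
  but \<open>\<zeta>\<close> has order 8 in it.\<close>
lemma odd_congruent_root:
  assumes n: "n \<in> {4,8}" and u: "u \<in> Zzeta n" and odd: "\<not> small_cyclotomic.even_elt n u"
  shows "\<exists>j. \<exists>r\<in>Zzeta n. u = zeta n ^ j + \<delta> n * (1 - \<i>) * r"
proof -
  interpret small_cyclotomic n using n by unfold_locales auto
  obtain r where r: "r \<in> Zzeta n" "u = 1 + \<delta> n * r"
    using even_or_odd[OF u] odd by (auto simp: even_elt_def algebra_simps eq_diff_eq)
  have rest: "\<exists>s\<in>Zzeta n. r = \<delta> n * s \<or> r = 1 + \<delta> n * s" if "r \<in> Zzeta n" for r
    using even_or_odd[OF that] by (auto simp: even_elt_def algebra_simps eq_diff_eq)
  obtain s where s: "s \<in> Zzeta n" "r = \<delta> n * s \<or> r = 1 + \<delta> n * s" using rest r by blast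
  show ?thesis
  proof (cases "n = 4")
    case True
    have [simp]: "zeta n = \<i>" using True zeta_4 by simp
    from s(2) show ?thesis
    proof
      assume "r = \<delta> n * s"
      then have "u = 1 + \<delta> n * (\<delta> n * s)" using r by simp
      then have "u = zeta n ^ 0 + \<delta> n * (1 - \<i>) * s" by simp
      then show ?thesis using s by blast
    next
      assume "r = 1 + \<delta> n * s"
      then have "u = 1 + \<delta> n * (1 + \<delta> n * s)" using r by simp
      then have "u = zeta n ^ 1 + \<delta> n * (1 - \<i>) * (1 + \<i> + s)" by (simp add: algebra_simps)
      moreover have "1 + \<i> + s \<in> Zzeta n" using True s i_in_Zzeta by (auto intro!: Zzeta_intros)
      ultimately show ?thesis by blast
    qed
  next
    case False
    then have n8: "n = 8" using assms(1) by simp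
    define w where "w = zeta 8"
    have zw [simp]: "zeta n = w" using n8 w_def by simp
    have w: "w * w = \<i>" using zeta_sq[of 4] by (simp add: zeta_4 w_def)
    then have w': "w * (w * a) = \<i> * a" for a by (metis mult.assoc)
    have ii: "\<i> * (\<i> * a) = - a" for a by (simp flip: mult.assoc)
    obtain t where t: "t \<in> Zzeta n" "s = \<delta> n * t \<or> s = 1 + \<delta> n * t" using rest s by blast
    have mem: "w \<in> Zzeta n" "\<i> \<in> Zzeta n" using n8 i_in_Zzeta Zzeta.root by (auto simp: w_def)
    \<comment> \<open>\<open>y\<close>, \<open>g\<close> and \<open>h\<close> are the quotients of
      \<delta>^3 \<open>t\<close>, of 2 and of \<delta>^3 by the modulus
      \<open>(1 - w) * (1 - \<i>)\<close>.\<close>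
    define y where "y = (\<i> - w - w * \<i>) * t"
    define g where "g = \<i> * (1 + w)"
    have yg: "y \<in> Zzeta n" "g \<in> Zzeta n" unfolding y_def g_def by (intro Zzeta_intros mem t)+
    have ey: "(1 - w) * (1 - w) * ((1 - w) * t) = (1 - w) * (1 - \<i>) * y"
      unfolding y_def using w by (simp add: algebra_simps w' ii)
    have eg: "(1 - w) * (1 - \<i>) * g = 2" unfolding g_def using w by (simp add: algebra_simps w' ii)
    let ?C = "\<lambda>j z. u = w ^ j + (1 - w) * (1 - \<i>) * z"
    have C: ?thesis if "u = w ^ j + (1 - w) * (1 - \<i>) * z" "z \<in> Zzeta n" for j z
      using that by auto
    \<comment> \<open>The two \<delta>-adic digits after the leading 1. In this order the four cases
      are matched with \<open>w ^ 0\<close>, \<open>w ^ 1\<close>, \<open>w ^ 2\<close>,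
      \<open>w ^ 3\<close>; the discrepancies are multiples of 2 or of \<delta>^3, hence of the
      modulus.\<close>
    have cases: "u = 1 + (1-w)*(1-w)*((1-w)*t) \<or> u = 1 + (1-w) + (1-w)*(1-w)*((1-w)*t)
       \<or> u = 1 + (1-w)*(1-w) + (1-w)*(1-w)*((1-w)*t) \<or> u = 1 + (1-w) + (1-w)*(1-w) + (1-w)*(1-w)*((1-w)*t)"
      using r(2) s(2) t(2) unfolding zw by (elim disjE; simp (no_asm_simp) add: algebra_simps)
    define h where "h = \<i> - w - w * \<i>"
    have eh: "(1 - w) * (1 - w) * (1 - w) = (1 - w) * (1 - \<i>) * h"
      unfolding h_def using w by (simp add: algebra_simps w' ii)
    have mh: "h \<in> Zzeta n" unfolding h_def by (intro Zzeta_intros mem)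
    from cases show ?thesis
    proof (elim disjE)
      assume "u = 1 + (1-w)*(1-w)*((1-w)*t)"
      then have "u = w ^ 0 + (1 - w) * (1 - \<i>) * y" using ey by simp
      then show ?thesis using C yg by blast
    next
      assume "u = 1 + (1-w) + (1-w)*(1-w)*((1-w)*t)"
      then have "u = w + (1 - w) * 2 + (1 - w) * (1 - \<i>) * y" using ey by simp
      also have "\<dots> = w ^ 1 + (1 - w) * (1 - \<i>) * (y + (1-w) * g)" unfolding eg[symmetric] by (simp add: algebra_simps)
      finally show ?thesis by (rule C) (intro Zzeta_intros mem yg)
    next
      assume "u = 1 + (1-w)*(1-w) + (1-w)*(1-w)*((1-w)*t)"
      then have "u = w ^ 2 + (1 - w) * 2 + (1 - w) * (1 - \<i>) * y"
        unfolding ey by (simp add: algebra_simps power2_eq_square)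
      also have "\<dots> = w ^ 2 + (1 - w) * (1 - \<i>) * (y + (1-w) * g)" unfolding eg[symmetric] by (simp add: algebra_simps)
      finally show ?thesis by (rule C) (intro Zzeta_intros mem yg)
    next
      assume "u = 1 + (1-w) + (1-w)*(1-w) + (1-w)*(1-w)*((1-w)*t)"
      then have "u = w ^ 3 + 2 * (1 - w) * (1 + w) + (1 - w) * (1 - w) * (1 - w) + (1 - w) * (1 - \<i>) * y"
        unfolding ey by (simp add: algebra_simps power3_eq_cube)
      also have "\<dots> = w ^ 3 + (1 - w) * (1 - \<i>) * (y + (1-w) * (1 + w) * g + h)"
        unfolding eg[symmetric] eh by (simp add: algebra_simps)
      finally show ?thesis by (rule C) (intro Zzeta_intros mem yg mh)
    qed
  qed
qed

section \<open>Reducing unitary families to the identity\<close>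

type_synonym 'x op = "('x \<Rightarrow> complex) \<Rightarrow> 'x \<Rightarrow> complex"

definition level_phase :: "complex \<Rightarrow> 'x \<Rightarrow> 'x op" where
  "level_phase c y \<psi> = \<psi>(y := c * \<psi> y)"

definition level_swap :: "'x \<Rightarrow> 'x \<Rightarrow> 'x op" where
  "level_swap a b \<psi> = \<psi> \<circ> transpose a b"

definition level_had :: "'x \<Rightarrow> 'x \<Rightarrow> 'x op" where
  "level_had y z \<psi> = \<psi>(y := (1 + \<i>) / 2 * (\<psi> y + \<psi> z), z := (1 + \<i>) / 2 * (\<psi> y - \<psi> z))"

text \<open>The gate \<open>HHgate\<close> with \<open>a\<close>, \<open>b\<close>,
  \<open>c\<close>, \<open>d\<close> in the roles of the basis states 00, 01, 10, 11.\<close>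

definition level_hh :: "'x \<Rightarrow> 'x \<Rightarrow> 'x \<Rightarrow> 'x \<Rightarrow> 'x op" where
  "level_hh a b c d \<psi> = \<psi>(a := (\<psi> a + \<psi> b + \<psi> c + \<psi> d) / 2, b := (\<psi> a - \<psi> b + \<psi> c - \<psi> d) / 2,
     c := (\<psi> a + \<psi> b - \<psi> c - \<psi> d) / 2, d := (\<psi> a - \<psi> b - \<psi> c + \<psi> d) / 2)"

definition ket :: "'x \<Rightarrow> 'x \<Rightarrow> complex" where
  "ket y = (\<lambda>x. if x = y then 1 else 0)"

definition inner_on :: "'x set \<Rightarrow> ('x \<Rightarrow> complex) \<Rightarrow> ('x \<Rightarrow> complex) \<Rightarrow> complex" where
  "inner_on X \<psi> \<phi> = (\<Sum>x\<in>X. \<psi> x * cnj (\<phi> x))"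

text \<open>Reduces the isometry of a level operator to the few points that it touches.\<close>

lemma ip_local:
  assumes "finite X" "B \<subseteq> X" "\<And>x. x \<notin> B \<Longrightarrow> \<psi>' x = \<psi> x" "\<And>x. x \<notin> B \<Longrightarrow> \<phi>' x = \<phi> x" "inner_on B \<psi>' \<phi>' = inner_on B \<psi> \<phi>"
  shows "inner_on X \<psi>' \<phi>' = inner_on X \<psi> \<phi>"
proof -
  have "inner_on X f g = inner_on (X - B) f g + inner_on B f g" for f g
    unfolding inner_on_def by (rule sum.subset_diff[OF assms(2,1)])
  moreover have "inner_on (X - B) \<psi>' \<phi>' = inner_on (X - B) \<psi> \<phi>" unfolding inner_on_def using assms by (intro sum.cong) auto
  ultimately show ?thesis using assms by simp
qed

lemma ip_ket: "finite X \<Longrightarrow> y \<in> X \<Longrightarrow> inner_on X \<psi> (ket y) = \<psi> y"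
  unfolding inner_on_def ket_def by (simp add: if_distrib sum.delta cong: if_cong)

text \<open>Separates the arithmetic from the circuits. \<open>S\<close> will be the set of
  operators that can be carried out with one clean ancilla.\<close>

locale synthesis = small_cyclotomic n for n +
  fixes X :: "'x set" and S :: "'x op set"
  assumes finX: "finite X"
    and S_id: "(\<lambda>\<psi>. \<psi>) \<in> S"
    and S_comp: "P \<in> S \<Longrightarrow> Q \<in> S \<Longrightarrow> (\<lambda>\<psi>. P (Q \<psi>)) \<in> S"
    and S_lev: "y \<in> X \<Longrightarrow> level_phase (zeta n) y \<in> S"
    and S_tr: "a \<in> X \<Longrightarrow> b \<in> X \<Longrightarrow> level_swap a b \<in> S"
    and S_h2: "n \<noteq> 2 \<Longrightarrow> y \<in> X \<Longrightarrow> z \<in> X \<Longrightarrow> y \<noteq> z \<Longrightarrow> level_had y z \<in> S"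
    and S_h4: "n = 2 \<Longrightarrow> {a,b,c,d} \<subseteq> X \<Longrightarrow> distinct [a,b,c,d] \<Longrightarrow> level_hh a b c d \<in> S"
begin

definition admissible :: "('x \<Rightarrow> complex) \<Rightarrow> bool" where
  "admissible \<psi> \<longleftrightarrow> (\<forall>x. x \<notin> X \<longrightarrow> \<psi> x = 0) \<and> (\<forall>x. \<psi> x \<in> Zhalf_zeta n)"

text \<open>Moves for reducing columns to basis vectors. It is the inverse that must lie in
  \<open>S\<close>, since synthesis undoes the reduction. \<open>Y\<close> holds the columns already
  finished, which later moves must leave alone.\<close>

definition reducers :: "'x set \<Rightarrow> 'x op set" where
  "reducers Y = {P. (\<exists>Q\<in>S. \<forall>\<psi>. Q (P \<psi>) = \<psi>) \<and> (\<forall>\<psi> \<phi>. inner_on X (P \<psi>) (P \<phi>) = inner_on X \<psi> \<phi>)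
      \<and> (\<forall>\<psi>. admissible \<psi> \<longrightarrow> admissible (P \<psi>)) \<and> (\<forall>y\<in>Y. P (ket y) = ket y)}"

lemma reducers_comp:
  assumes "P \<in> reducers Y" "Q \<in> reducers Y" shows "(\<lambda>\<psi>. P (Q \<psi>)) \<in> reducers Y"
proof -
  obtain P' where P': "P' \<in> S" "\<And>\<psi>. P' (P \<psi>) = \<psi>" using assms(1) unfolding reducers_def by blast
  obtain Q' where Q': "Q' \<in> S" "\<And>\<psi>. Q' (Q \<psi>) = \<psi>" using assms(2) unfolding reducers_def by blast
  have "\<exists>R\<in>S. \<forall>\<psi>. R (P (Q \<psi>)) = \<psi>"
    by (rule bexI[OF _ S_comp[OF Q'(1) P'(1)]]) (simp add: P' Q')
  then show ?thesis using assms by (simp add: reducers_def)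
qed

lemma reducers_id: "(\<lambda>\<psi>. \<psi>) \<in> reducers Y"
  using S_id by (auto simp: reducers_def)

lemma lev_pow: "y \<in> X \<Longrightarrow> level_phase (zeta n ^ j) y \<in> S"
proof (induction j)
  case 0
  have "level_phase (zeta n ^ 0) y = (\<lambda>\<psi>. \<psi>)" by (auto simp: level_phase_def)
  then show ?case using S_id by simp
next
  case (Suc j)
  have "level_phase (zeta n ^ Suc j) y = (\<lambda>\<psi>. level_phase (zeta n) y (level_phase (zeta n ^ j) y \<psi>))"
    by (auto simp: level_phase_def fun_eq_iff)
  then show ?case using S_comp[OF S_lev Suc.IH] Suc.prems by simp
qed

lemma zeta_pow_inverse: "\<exists>i. zeta n ^ i * zeta n ^ j = 1"
proof -
  have "zeta n ^ (n * j - j) * zeta n ^ j = (zeta n ^ n) ^ j"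
    using n_pos by (simp flip: power_add power_mult)
  then show ?thesis using zeta_pow[OF n_pos] by auto
qed

lemma lev_reducers:
  assumes "y \<in> X" "y \<notin> Y" shows "level_phase (zeta n ^ j) y \<in> reducers Y"
proof -
  obtain i where i: "zeta n ^ i * zeta n ^ j = 1" using zeta_pow_inverse by blast
  have "\<And>\<psi>. level_phase (zeta n ^ i) y (level_phase (zeta n ^ j) y \<psi>) = \<psi>"
    using i by (auto simp: level_phase_def fun_eq_iff simp flip: mult.assoc)
  then have 1: "\<exists>Q\<in>S. \<forall>\<psi>. Q (level_phase (zeta n ^ j) y \<psi>) = \<psi>" using lev_pow[OF assms(1)] by blast
  have z: "zeta n ^ j * cnj (zeta n ^ j) = 1"
    using zeta_cnj[of n] by (simp flip: power_mult_distrib)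
  have 2: "inner_on X (level_phase (zeta n ^ j) y \<psi>) (level_phase (zeta n ^ j) y \<phi>) = inner_on X \<psi> \<phi>" for \<psi> \<phi>
  proof (rule ip_local[OF finX, of "{y}"])
    have "(zeta n ^ j * \<psi> y) * cnj (zeta n ^ j * \<phi> y) = (zeta n ^ j * cnj (zeta n ^ j)) * (\<psi> y * cnj (\<phi> y))"
      by (simp add: algebra_simps)
    then show "inner_on {y} (level_phase (zeta n ^ j) y \<psi>) (level_phase (zeta n ^ j) y \<phi>) = inner_on {y} \<psi> \<phi>"
      unfolding z by (simp add: inner_on_def level_phase_def)
  qed (use assms in \<open>auto simp: level_phase_def\<close>)
  have 3: "admissible \<psi> \<Longrightarrow> admissible (level_phase (zeta n ^ j) y \<psi>)" for \<psi>
    using assms by (auto simp: admissible_def level_phase_def intro: Zhalf_zeta.intros Zhalf_pow)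
  have 4: "x \<in> Y \<Longrightarrow> level_phase (zeta n ^ j) y (ket x) = ket x" for x
    using assms by (auto simp: level_phase_def ket_def)
  show ?thesis using 1 2 3 4 by (simp add: reducers_def)
qed

lemma tr_reducers:
  assumes "a \<in> X" "b \<in> X" "a \<notin> Y" "b \<notin> Y" shows "level_swap a b \<in> reducers Y"
proof -
  have "\<And>\<psi>. level_swap a b (level_swap a b \<psi>) = \<psi>" by (auto simp: level_swap_def fun_eq_iff)
  then have 1: "\<exists>Q\<in>S. \<forall>\<psi>. Q (level_swap a b \<psi>) = \<psi>" using S_tr assms by blast
  have 2: "inner_on X (level_swap a b \<psi>) (level_swap a b \<phi>) = inner_on X \<psi> \<phi>" for \<psi> \<phi>
  proof (rule ip_local[OF finX, of "{a,b}"])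
    show "inner_on {a, b} (level_swap a b \<psi>) (level_swap a b \<phi>) = inner_on {a, b} \<psi> \<phi>"
      by (cases "a = b") (auto simp: inner_on_def level_swap_def)
  qed (use assms in \<open>auto simp: level_swap_def transpose_def\<close>)
  have 3: "admissible \<psi> \<Longrightarrow> admissible (level_swap a b \<psi>)" for \<psi>
    using assms by (auto simp: admissible_def level_swap_def transpose_def)
  have 4: "x \<in> Y \<Longrightarrow> level_swap a b (ket x) = ket x" for x
    using assms by (auto simp: level_swap_def ket_def transpose_def fun_eq_iff)
  show ?thesis using 1 2 3 4 by (simp add: reducers_def)
qed

lemma i_props:
  assumes "n \<noteq> 2"
  shows "\<exists>j. zeta n ^ j = - \<i>" "\<i> \<in> Zzeta n" "even_elt (1 + \<i>)"
proof -
  consider "n = 4" | "n = 8" using n assms by auto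
  then have "(\<exists>j. zeta n ^ j = - \<i>) \<and> \<i> \<in> Zzeta n \<and> even_elt (1 + \<i>)"
  proof cases
    case 1
    have "1 + \<i> = \<delta> n * \<i>" using 1 zeta_4 by (simp add: algebra_simps)
    moreover have "zeta n ^ 3 = - \<i>" using 1 zeta_4 by (simp add: power3_eq_cube)
    ultimately show ?thesis using 1 i_in_Zzeta unfolding even_elt_def by blast
  next
    case 2
    have "\<delta> n * (\<i> * (1 + zeta n)) = \<i> * (1 - zeta n * zeta n)" by (simp add: algebra_simps)
    also have "\<dots> = 1 + \<i>" using 2 zeta_8_sq by (simp add: algebra_simps)
    finally have "1 + \<i> = \<delta> n * (\<i> * (1 + zeta n))" ..
    moreover have "\<i> * (1 + zeta n) \<in> Zzeta n" using 2 i_in_Zzeta by (auto intro!: Zzeta_intros)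
    moreover have "zeta n ^ 6 = zeta n * zeta n * (zeta n * zeta n) * (zeta n * zeta n)" by (simp add: eval_nat_numeral)
    then have "zeta n ^ 6 = - \<i>" using 2 zeta_8_sq by simp
    ultimately show ?thesis using 2 i_in_Zzeta unfolding even_elt_def by blast
  qed
  then show "\<exists>j. zeta n ^ j = - \<i>" "\<i> \<in> Zzeta n" "even_elt (1 + \<i>)" by auto
qed

lemma Zhalf_div2: "x \<in> Zhalf_zeta n \<Longrightarrow> x / 2 \<in> Zhalf_zeta n"
  using Zhalf_zeta.mult[OF _ Zhalf_zeta.half, of x n] by simp

lemma h2_reducers:
  assumes n2: "n \<noteq> 2" and yz: "y \<in> X" "z \<in> X" "y \<noteq> z" "y \<notin> Y" "z \<notin> Y" shows "level_had y z \<in> reducers Y"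
proof -
  obtain j where j: "zeta n ^ j = - \<i>" using i_props[OF n2] by blast
  \<comment> \<open>\<open>H'\<close> squares to \<open>\<i>\<close>, so a second \<open>H'\<close>
    and the phase \<open>- \<i>\<close> on both levels invert it; \<open>- \<i>\<close> is a power
    of \<open>zeta n\<close>.\<close>
  have "level_phase (- \<i>) y (level_phase (- \<i>) z (level_had y z (level_had y z \<psi>))) = \<psi>" for \<psi>
    using yz(3) by (auto simp: level_phase_def level_had_def fun_eq_iff field_simps)
  moreover have "(\<lambda>\<psi>. level_phase (- \<i>) y (level_phase (- \<i>) z (level_had y z \<psi>))) \<in> S"
    unfolding j[symmetric] by (intro S_comp[OF lev_pow S_comp[OF lev_pow S_h2]] yz n2)
  ultimately have 1: "\<exists>Q\<in>S. \<forall>\<psi>. Q (level_had y z \<psi>) = \<psi>"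
    by (intro bexI[of _ "\<lambda>\<psi>. level_phase (- \<i>) y (level_phase (- \<i>) z (level_had y z \<psi>))"]) simp_all
  have 2: "inner_on X (level_had y z \<psi>) (level_had y z \<phi>) = inner_on X \<psi> \<phi>" for \<psi> \<phi>
  proof (rule ip_local[OF finX, of "{y,z}"])
    show "inner_on {y, z} (level_had y z \<psi>) (level_had y z \<phi>) = inner_on {y, z} \<psi> \<phi>"
      using yz(3) by (simp add: inner_on_def level_had_def field_simps)
  qed (use yz in \<open>auto simp: level_had_def\<close>)
  have "1 + \<i> \<in> Zhalf_zeta n"
    using i_props[OF n2] by (intro Zhalf_zeta.intros Zzeta_Zhalf)
  then have 3: "admissible \<psi> \<Longrightarrow> admissible (level_had y z \<psi>)" for \<psi>
    using yz by (auto simp: admissible_def level_had_def intro!: Zhalf_div2 Zhalf_zeta.mult Zhalf_zeta.add[of "\<psi> _"] Zhalf_diff)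
  have 4: "x \<in> Y \<Longrightarrow> level_had y z (ket x) = ket x" for x
    using yz by (auto simp: level_had_def ket_def)
  show ?thesis using 1 2 3 4 by (simp add: reducers_def)
qed

lemma h4_reducers:
  assumes n2: "n = 2" and d: "distinct [a,b,c,d]" and X: "{a,b,c,d} \<subseteq> X - Y" shows "level_hh a b c d \<in> reducers Y"
proof -
  have "level_hh a b c d (level_hh a b c d \<psi>) = \<psi>" for \<psi>
    using d by (auto simp: level_hh_def fun_eq_iff field_simps)
  then have 1: "\<exists>Q\<in>S. \<forall>\<psi>. Q (level_hh a b c d \<psi>) = \<psi>" using S_h4[OF n2 _ d] X by blast
  have 2: "inner_on X (level_hh a b c d \<psi>) (level_hh a b c d \<phi>) = inner_on X \<psi> \<phi>" for \<psi> \<phi>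
  proof (rule ip_local[OF finX, of "{a,b,c,d}"])
    show "inner_on {a,b,c,d} (level_hh a b c d \<psi>) (level_hh a b c d \<phi>) = inner_on {a,b,c,d} \<psi> \<phi>"
      using d by (simp add: inner_on_def level_hh_def field_simps)
  qed (use X in \<open>auto simp: level_hh_def\<close>)
  have 3: "admissible \<psi> \<Longrightarrow> admissible (level_hh a b c d \<psi>)" for \<psi>
    using X d by (auto simp: admissible_def level_hh_def intro!: Zhalf_div2 Zhalf_zeta.add Zhalf_diff)
  have 4: "x \<in> Y \<Longrightarrow> level_hh a b c d (ket x) = ket x" for x
    using X by (auto simp: level_hh_def ket_def)
  show ?thesis using 1 2 3 4 by (simp add: reducers_def)
qed

definition scaled :: "nat \<Rightarrow> ('x \<Rightarrow> complex) \<Rightarrow> 'x \<Rightarrow> complex" where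
  "scaled e w = (\<lambda>x. w x / \<delta> n ^ e)"

text \<open>A power of \<open>zeta n\<close> on level \<open>z\<close> makes both odd entries
  congruent to \<open>zeta n ^ a\<close> modulo \<open>\<delta> n * (1 - \<i>)\<close>. The
  prefactor of \<open>H'\<close> is the inverse of \<open>1 - \<i>\<close>. Hence the difference
  becomes a multiple of \<delta>, and the sum becomes \<open>(1 + \<i>) * zeta n ^ a\<close> plus
  such a multiple, where \<open>1 + \<i>\<close> is itself even.\<close>

lemma reduce_pair:
  assumes n2: "n \<noteq> 2" and w: "\<And>x. w x \<in> Zzeta n"
    and yz: "y \<in> X - Y" "z \<in> X - Y" "y \<noteq> z" and odd: "\<not> even_elt (w y)" "\<not> even_elt (w z)"
  shows "\<exists>P\<in>reducers Y. \<exists>w'. (\<forall>x. w' x \<in> Zzeta n) \<and> P (scaled e w) = scaled e w'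
     \<and> {x. \<not> even_elt (w' x)} \<subset> {x. \<not> even_elt (w x)}"
proof -
  have n48: "n \<in> {4, 8}" using n n2 by auto
  obtain a r where r: "r \<in> Zzeta n" "w y = zeta n ^ a + \<delta> n * (1 - \<i>) * r"
    using odd_congruent_root[OF n48 w odd(1)] by blast
  obtain b s where s: "s \<in> Zzeta n" "w z = zeta n ^ b + \<delta> n * (1 - \<i>) * s"
    using odd_congruent_root[OF n48 w odd(2)] by blast
  obtain b' where b': "zeta n ^ b' * zeta n ^ b = 1" using zeta_pow_inverse by blast
  define c where "c = zeta n ^ (a + b')"
  have c: "c * zeta n ^ b = zeta n ^ a" using b' by (simp add: c_def power_add mult.assoc)
  have cz: "c * w z = zeta n ^ a + \<delta> n * (1 - \<i>) * (c * s)" unfolding s(2) distrib_left c by (simp add: algebra_simps)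
  have cZ: "c \<in> Zzeta n" unfolding c_def by (intro Zzeta_intros)
  define w' where "w' = w(y := (1 + \<i>) * zeta n ^ a + \<delta> n * (r + c * s), z := \<delta> n * (r - c * s))"
  have h: "(1 + \<i>) / 2 * (1 - \<i>) = 1" by (simp add: field_simps)
  have p: "(1 + \<i>) / 2 * (w y + c * w z) = (1 + \<i>) * zeta n ^ a + ((1 + \<i>) / 2 * (1 - \<i>)) * (\<delta> n * (r + c * s))"
    unfolding cz r(2) by (simp add: field_simps)
  have m: "(1 + \<i>) / 2 * (w y - c * w z) = ((1 + \<i>) / 2 * (1 - \<i>)) * (\<delta> n * (r - c * s))"
    unfolding cz r(2) by (simp add: field_simps)
  have "level_had y z (level_phase c z (scaled e w)) = scaled e (w(y := (1 + \<i>) / 2 * (w y + c * w z), z := (1 + \<i>) / 2 * (w y - c * w z)))"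
    using yz(3) by (auto simp: level_had_def level_phase_def scaled_def fun_eq_iff simp flip: add_divide_distrib diff_divide_distrib)
  also have "\<dots> = scaled e w'" unfolding p m h w'_def by simp
  finally have eq: "level_had y z (level_phase c z (scaled e w)) = scaled e w'" .
  have e1: "even_elt (\<delta> n * (r + c * s))" "even_elt (\<delta> n * (r - c * s))"
    by (intro even_mult even_\<delta> Zzeta_intros r s cZ)+
  have e2: "even_elt ((1 + \<i>) * zeta n ^ a)" by (intro even_mult i_props n2 Zzeta_intros)
  have ev: "even_elt (w' y)" "even_elt (w' z)" using e1 e2 yz even_add by (auto simp: w'_def)
  have "w' x \<in> Zzeta n" for x
    using ev w[of x] even_Zzeta by (cases "x = y \<or> x = z") (auto simp: w'_def)
  moreover have "(\<lambda>\<psi>. level_had y z (level_phase c z \<psi>)) \<in> reducers Y"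
    unfolding c_def by (intro reducers_comp[OF h2_reducers lev_reducers] n2) (use yz in auto)
  moreover have "{x. \<not> even_elt (w' x)} \<subset> {x. \<not> even_elt (w x)}"
  proof (intro psubsetI subsetI)
    show "{x. \<not> even_elt (w' x)} \<noteq> {x. \<not> even_elt (w x)}" using ev odd by blast
    fix x assume "x \<in> {x. \<not> even_elt (w' x)}"
    then show "x \<in> {x. \<not> even_elt (w x)}" using ev by (cases "x = y \<or> x = z") (auto simp: w'_def)
  qed
  ultimately show ?thesis using eq
    by (intro bexI[of _ "\<lambda>\<psi>. level_had y z (level_phase c z \<psi>)"] exI[of _ w'] conjI allI)
qed

lemma even_elt_int: "n = 2 \<Longrightarrow> even_elt (of_int i) \<longleftrightarrow> even i"
proof
  assume n2: "n = 2"
  { assume "even_elt (of_int i)"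
    then obtain r where "r \<in> Zzeta n" "of_int i = \<delta> n * r" unfolding even_elt_def by blast
    then have r: "r \<in> Zzeta 2" "of_int i = 2 * r" using n2 zeta_2 by auto
    then obtain k where "r = of_int k" using Zzeta_2 Ints_cases by metis
    then have "(of_int i :: complex) = of_int (2 * k)" using r by simp
    then show "even i" by (simp only: of_int_eq_iff) simp }
  assume "even i"
  then obtain k where "i = 2 * k" by blast
  then have "of_int i = 2 * (of_int k :: complex)" by simp
  moreover have "of_int k \<in> Zzeta n" by (cases k) (auto intro: Zzeta_of_nat Zzeta.intros Zzeta_diff)
  ultimately show "even_elt (of_int i)" using even_mult[OF even_2] by simp
qed

text \<open>Signs make the four odd integers congruent to 1 modulo 4. Each signed sum formed by
  \<open>level_hh\<close> is then divisible by 4, and half of it is even.\<close>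

lemma reduce_quad:
  assumes n2: "n = 2" and w: "\<And>x. w x \<in> Zzeta n"
    and X: "{a,b,c,d} \<subseteq> X - Y" "distinct [a,b,c,d]" and odd: "\<And>x. x \<in> {a,b,c,d} \<Longrightarrow> \<not> even_elt (w x)"
  shows "\<exists>P\<in>reducers Y. \<exists>w'. (\<forall>x. w' x \<in> Zzeta n) \<and> P (scaled e w) = scaled e w'
     \<and> {x. \<not> even_elt (w' x)} \<subset> {x. \<not> even_elt (w x)}"
proof -
  have sg: "\<exists>j k. zeta n ^ j * w x = of_int (4 * k + 1)" if "x \<in> {a,b,c,d}" for x
  proof -
    obtain i where i: "w x = of_int i" using w[of x] Zzeta_2 n2 by (auto elim!: Ints_cases)
    then have "odd i" using odd[OF that] even_elt_int[OF n2] by auto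
    then have "i mod 4 = 1 \<or> i mod 4 = 3" by presburger
    then have "i = 4 * (i div 4) + 1 \<or> - i = 4 * (- (i div 4) - 1) + 1" by presburger
    then consider "i = 4 * (i div 4) + 1" | "- i = 4 * (- (i div 4) - 1) + 1" by blast
    then show ?thesis
    proof cases
      case 1
      have "zeta n ^ 0 * w x = of_int (4 * (i div 4) + 1)" using 1 i by simp
      then show ?thesis by blast
    next
      case 2
      have "zeta n ^ 1 * w x = of_int (- i)" using i n2 zeta_2 by simp
      then show ?thesis using 2 by metis
    qed
  qed
  obtain ja ka where a: "zeta n ^ ja * w a = of_int (4 * ka + 1)" using sg[of a] by auto
  obtain jb kb where b: "zeta n ^ jb * w b = of_int (4 * kb + 1)" using sg[of b] by auto
  obtain jc kc where c: "zeta n ^ jc * w c = of_int (4 * kc + 1)" using sg[of c] by auto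
  obtain jd kd where d: "zeta n ^ jd * w d = of_int (4 * kd + 1)" using sg[of d] by auto
  let ?L = "\<lambda>\<psi>. level_phase (zeta n ^ ja) a (level_phase (zeta n ^ jb) b (level_phase (zeta n ^ jc) c (level_phase (zeta n ^ jd) d \<psi>)))"
  let ?v = "w(a := zeta n ^ ja * w a, b := zeta n ^ jb * w b, c := zeta n ^ jc * w c, d := zeta n ^ jd * w d)"
  define w' where "w' = w(a := of_int (2 * (ka+kb+kc+kd+1)), b := of_int (2 * (ka-kb+kc-kd)),
     c := of_int (2 * (ka+kb-kc-kd)), d := of_int (2 * (ka-kb-kc+kd)))"
  have "?L (scaled e w) = scaled e ?v"
    using X(2) by (auto simp: level_phase_def scaled_def fun_eq_iff)
  moreover have "level_hh a b c d (scaled e ?v) = scaled e (level_hh a b c d ?v)"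
    using X(2) by (auto simp: level_hh_def scaled_def fun_eq_iff add_divide_distrib diff_divide_distrib mult.commute)
  moreover have "level_hh a b c d ?v = w'" unfolding a b c d w'_def level_hh_def
    using X(2) by (auto simp: fun_eq_iff)
  ultimately have eq: "level_hh a b c d (?L (scaled e w)) = scaled e w'" by simp
  have P: "(\<lambda>\<psi>. level_hh a b c d (?L \<psi>)) \<in> reducers Y"
    by (intro reducers_comp[OF h4_reducers reducers_comp[OF lev_reducers reducers_comp[OF lev_reducers reducers_comp[OF lev_reducers lev_reducers]]]] n2 X) (use X in auto)
  have ev: "x \<in> {a,b,c,d} \<Longrightarrow> even_elt (w' x)" for x
    using X(2) even_elt_int[OF n2] by (auto simp: w'_def simp del: of_int_mult of_int_add of_int_diff)
  have "w' x \<in> Zzeta n" for x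
    using ev w[of x] even_Zzeta by (cases "x \<in> {a,b,c,d}") (auto simp: w'_def)
  moreover have "{x. \<not> even_elt (w' x)} \<subset> {x. \<not> even_elt (w x)}"
  proof (intro psubsetI subsetI)
    show "{x. \<not> even_elt (w' x)} \<noteq> {x. \<not> even_elt (w x)}" using ev[of a] odd[of a] by blast
    fix x assume "x \<in> {x. \<not> even_elt (w' x)}"
    then show "x \<in> {x. \<not> even_elt (w x)}" using ev by (cases "x \<in> {a,b,c,d}") (auto simp: w'_def)
  qed
  ultimately show ?thesis using eq P
    by (intro bexI[of _ "\<lambda>\<psi>. level_hh a b c d (?L \<psi>)"] exI[of _ w'] conjI allI)
qed

text \<open>\<open>level_hh\<close> takes four odd entries at a time, so parity of the count is too
  weak. Odd squares are 1 and even squares 0 modulo 4, while the total is a power of 4 with positive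
  exponent.\<close>

lemma int_odd_count:
  assumes n2: "n = 2" and "finite A" "\<And>x. x \<in> A \<Longrightarrow> w x \<in> Zzeta n"
    and s: "(\<Sum>x\<in>A. w x * cnj (w x)) = (\<delta> n * cnj (\<delta> n)) ^ Suc e"
  shows "4 dvd card {x\<in>A. \<not> even_elt (w x)}"
proof -
  have "\<exists>c. \<forall>x\<in>A. w x = of_int (c x)"
    using assms Zzeta_2 by (intro bchoice) (auto elim!: Ints_cases)
  then obtain c where c: "\<And>x. x \<in> A \<Longrightarrow> w x = of_int (c x)" by blast
  have O: "{x\<in>A. \<not> even_elt (w x)} = {x\<in>A. odd (c x)}" using c even_elt_int[OF n2] by auto
  have "of_int (\<Sum>x\<in>A. c x * c x) = (\<Sum>x\<in>A. w x * cnj (w x))" using c by simp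
  also have "\<dots> = of_int (4 ^ Suc e)" unfolding s using n2 zeta_2 by simp
  finally have cs: "(\<Sum>x\<in>A. c x * c x) = 4 ^ Suc e" by (simp only: of_int_eq_iff)
  have "4 dvd (\<Sum>x\<in>A. c x * c x - (if odd (c x) then 1 else 0))"
  proof (rule dvd_sum)
    fix x assume "x \<in> A"
    show "4 dvd c x * c x - (if odd (c x) then 1 else 0)"
    proof (cases "odd (c x)")
      case True
      then obtain k where k: "c x = 2 * k + 1" by (elim oddE)
      have "c x * c x - 1 = 4 * (k * k + k)" unfolding k by (simp add: algebra_simps)
      then show ?thesis using True by simp
    next
      case False
      then obtain k where "c x = 2 * k" by blast
      then show ?thesis by simp
    qed
  qed
  also have "(\<Sum>x\<in>A. c x * c x - (if odd (c x) then 1 else 0)) = 4 ^ Suc e - int (card {x\<in>A. odd (c x)})"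
    using assms(2) cs by (simp add: sum_subtractf sum.If_cases Int_def conj_commute)
  finally have "4 dvd int (card {x\<in>A. odd (c x)})"
    by (metis dvd_diff_commute dvd_diffD1 dvd_power dvd_refl diff_add_cancel dvd_add_right_iff dvd_triv_left power_Suc dvd_diff_right_iff zdvd_zdiffD)
  then show ?thesis unfolding O by (metis int_dvd_int_iff of_nat_numeral)
qed

lemma reduce_odd:
  assumes w: "\<And>x. w x \<in> Zzeta n" and supp: "\<And>x. x \<notin> X - Y \<Longrightarrow> w x = 0"
    and norm: "inner_on X (scaled (Suc e) w) (scaled (Suc e) w) = 1" and odd: "{x. \<not> even_elt (w x)} \<noteq> {}"
  shows "\<exists>P\<in>reducers Y. \<exists>w'. (\<forall>x. w' x \<in> Zzeta n) \<and> P (scaled (Suc e) w) = scaled (Suc e) w'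
     \<and> {x. \<not> even_elt (w' x)} \<subset> {x. \<not> even_elt (w x)}"
proof -
  let ?O = "{x\<in>X. \<not> even_elt (w x)}"
  have O: "{x. \<not> even_elt (w x)} = ?O" using supp even_0 by fastforce
  have OX: "?O \<subseteq> X - Y" using supp even_0 by fastforce
  have fin: "finite ?O" using finX by simp
  have "(\<Sum>x\<in>X. w x * cnj (w x)) / (\<delta> n * cnj (\<delta> n)) ^ Suc e = inner_on X (scaled (Suc e) w) (scaled (Suc e) w)"
    unfolding sum_divide_distrib inner_on_def by (intro sum.cong) (auto simp: scaled_def power_mult_distrib)
  then have s: "(\<Sum>x\<in>X. w x * cnj (w x)) = (\<delta> n * cnj (\<delta> n)) ^ Suc e" using norm \<delta>_nz by (simp add: field_simps)
  have pos: "card ?O > 0" using odd O fin by (simp add: card_gt_0_iff)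
  show ?thesis
  proof (cases "n = 2")
    case True
    have "4 dvd card ?O" by (rule int_odd_count[OF True finX w s])
    then have c4: "card ?O \<ge> 4" using pos by (auto dest: dvd_imp_le)
    then obtain B where B: "B \<subseteq> ?O" "card B = 4" by (meson obtain_subset_with_card_n)
    then obtain bs where bs: "distinct bs" "set bs = B"
      using finite_distinct_list finite_subset fin by metis
    then have "length bs = 4" using B distinct_card by fastforce
    then obtain a b c d where "bs = [a,b,c,d]" by (auto simp: length_Suc_conv eval_nat_numeral)
    with bs B OX have "{a,b,c,d} \<subseteq> X - Y" "distinct [a,b,c,d]" "{a,b,c,d} \<subseteq> ?O" by auto
    then show ?thesis by (intro reduce_quad[OF True w, of a b c d]) auto
  next
    case False
    have "even (card ?O)" by (rule odd_count[OF finX w s])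
    then have "card ?O \<ge> 2" using pos by (auto dest: dvd_imp_le)
    then obtain B where B: "B \<subseteq> ?O" "card B = 2" by (meson obtain_subset_with_card_n)
    then obtain y z where "B = {y,z}" "y \<noteq> z" by (auto simp: card_2_iff)
    then show ?thesis using B OX by (intro reduce_pair[OF False w, of y Y z]) auto
  qed
qed

text \<open>The entry at a level of \<open>Y\<close> is the inner product with a ket that
  \<open>P\<close> fixes, and \<open>P\<close> preserves inner products.\<close>

lemma reducers_support:
  assumes P: "P \<in> reducers Y" "Y \<subseteq> X" and adm: "admissible \<psi>" and supp: "\<And>x. x \<notin> X - Y \<Longrightarrow> \<psi> x = 0" and x: "x \<notin> X - Y"
  shows "P \<psi> x = 0"
proof (cases "x \<in> Y")
  case True
  then have "P \<psi> x = inner_on X (P \<psi>) (ket x)" using ip_ket[OF finX] P by auto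
  also have "\<dots> = inner_on X (P \<psi>) (P (ket x))" using P True by (simp add: reducers_def)
  also have "\<dots> = inner_on X \<psi> (ket x)" using P by (simp add: reducers_def)
  also have "\<dots> = 0" using True P supp[of x] ip_ket[OF finX] by auto
  finally show ?thesis .
next
  case False
  have "admissible (P \<psi>)" using P adm by (simp add: reducers_def)
  then show ?thesis using False x by (auto simp: admissible_def)
qed

text \<open>\<delta> divides 2 and 1/2 is in the ring, so \<open>1 / \<delta> n\<close> is in it
  too.\<close>

lemma scaled_admissible:
  assumes "\<And>x. w x \<in> Zzeta n" "\<And>x. x \<notin> X \<Longrightarrow> w x = 0"
  shows "admissible (scaled e w)"
proof -
  obtain r where r: "r \<in> Zzeta n" "2 = \<delta> n * r" using even_2 by (auto simp: even_elt_def)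
  have "r * (1/2) \<in> Zhalf_zeta n" using r by (intro Zhalf_zeta.intros Zzeta_Zhalf)
  moreover have "r * (1/2) = 1 / \<delta> n" using r(2) \<delta>_nz by (simp add: nonzero_eq_divide_eq mult.commute)
  ultimately have "1 / \<delta> n \<in> Zhalf_zeta n" by (simp only:)
  then have "w x * (1 / \<delta> n) ^ e \<in> Zhalf_zeta n" for x
    by (intro Zhalf_zeta.mult Zhalf_pow Zzeta_Zhalf[OF assms(1)])
  then show ?thesis using assms(2) by (simp add: admissible_def scaled_def power_one_over)
qed

text \<open>Outer induction on the exponent of the denominator. At exponent 0 the column is a root
  of unity times a basis vector, which one phase and one swap bring to \<open>ket t\<close>.\<close>

lemma reduce_column:
  assumes "Y \<subseteq> X" "t \<in> X - Y" "\<And>x. w x \<in> Zzeta n" "\<And>x. x \<notin> X - Y \<Longrightarrow> w x = 0"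
    and "inner_on X (scaled e w) (scaled e w) = 1"
  shows "\<exists>P\<in>reducers Y. P (scaled e w) = ket t"
  using assms(3-)
proof (induction e arbitrary: w)
  case 0
  have n': "n = 2 ^ Suc (if n = 2 then 0 else if n = 4 then 1 else 2)" using n by auto
  have "(\<Sum>x\<in>X. w x * cnj (w x)) = 1" using 0 by (simp add: inner_on_def scaled_def)
  then have "\<exists>x\<in>X. (\<exists>i. w x = zeta n ^ i) \<and> (\<forall>y\<in>X - {x}. w y = 0)"
    using Zzeta_norm_1[OF finX, of w] 0(1) n' by metis
  then obtain x i where x: "x \<in> X" "w x = zeta n ^ i" "\<And>y. y \<in> X - {x} \<Longrightarrow> w y = 0" by blast
  have xY: "x \<in> X - Y" using 0(2)[of x] x(2) by auto
  have w: "w = (\<lambda>y. if y = x then zeta n ^ i else 0)"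
  proof
    fix y show "w y = (if y = x then zeta n ^ i else 0)" using x 0(2)[of y] by (cases "y \<in> X") auto
  qed
  obtain j where j: "zeta n ^ j * zeta n ^ i = 1" using zeta_pow_inverse by blast
  have "(\<lambda>\<psi>. level_swap t x (level_phase (zeta n ^ j) x \<psi>)) \<in> reducers Y"
    by (intro reducers_comp[OF tr_reducers lev_reducers]) (use xY assms in auto)
  moreover have "level_swap t x (level_phase (zeta n ^ j) x (scaled 0 w)) = ket t"
    using j unfolding w by (auto simp: level_swap_def level_phase_def scaled_def ket_def transpose_def fun_eq_iff)
  ultimately show ?case by (intro bexI[of _ "\<lambda>\<psi>. level_swap t x (level_phase (zeta n ^ j) x \<psi>)"])
next
  case (Suc e)
  show ?case using Suc.prems
  \<comment> \<open>Inner induction on the number of odd numerators; when none is left, a factor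
    \<delta> cancels and the exponent drops.\<close>
  proof (induction "card {x. \<not> even_elt (w x)}" arbitrary: w rule: less_induct)
    case less
    have fin: "finite {x. \<not> even_elt (w x)}"
    proof (rule finite_subset[OF _ finX])
      show "{x. \<not> even_elt (w x)} \<subseteq> X" using less.prems(2) even_0 by fastforce
    qed
    show ?case
    proof (cases "{x. \<not> even_elt (w x)} = {}")
      case True
      then have "\<forall>x. \<exists>r. r \<in> Zzeta n \<and> w x = \<delta> n * r" by (auto simp: even_elt_def)
      from choice[OF this] obtain v where v: "\<And>x. v x \<in> Zzeta n" "\<And>x. w x = \<delta> n * v x" by blast
      have eq: "scaled (Suc e) w = scaled e v" using \<delta>_nz v by (auto simp: scaled_def)
      have "x \<notin> X - Y \<Longrightarrow> v x = 0" for x using less.prems(2)[of x] v \<delta>_nz by auto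
      then show ?thesis unfolding eq using Suc.IH[of v] v less.prems(3) eq by auto
    next
      case False
      have ad: "admissible (scaled (Suc e) w)" using less.prems by (intro scaled_admissible) auto
      from reduce_odd[OF less.prems False] obtain P w' where
        P: "P \<in> reducers Y" "\<And>x. w' x \<in> Zzeta n" "P (scaled (Suc e) w) = scaled (Suc e) w'"
        and less': "{x. \<not> even_elt (w' x)} \<subset> {x. \<not> even_elt (w x)}" by blast
      have "scaled (Suc e) w' x = 0" if "x \<notin> X - Y" for x
        unfolding P(3)[symmetric] by (rule reducers_support[OF P(1) assms(1) ad _ that]) (use less.prems in \<open>auto simp: scaled_def\<close>)
      then have "x \<notin> X - Y \<Longrightarrow> w' x = 0" for x using \<delta>_nz by (auto simp: scaled_def)
      moreover have "inner_on X (scaled (Suc e) w') (scaled (Suc e) w') = 1"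
        unfolding P(3)[symmetric] using P(1) less.prems(3) by (simp add: reducers_def)
      ultimately have "\<exists>Q\<in>reducers Y. Q (scaled (Suc e) w') = ket t"
        using less.hyps[OF psubset_card_mono[OF fin less'] P(2)] by blast
      then obtain Q where "Q \<in> reducers Y" "Q (scaled (Suc e) w') = ket t" by blast
      then show ?thesis using reducers_comp[OF _ P(1), of Q] P(3) by (metis (no_types, lifting))
    qed
  qed
qed

lemma admissible_scaled:
  assumes "admissible \<psi>"
  shows "\<exists>e w. (\<forall>x. w x \<in> Zzeta n) \<and> \<psi> = scaled e w"
proof -
  have "\<forall>x. \<exists>re. fst re \<in> Zzeta n \<and> \<psi> x = fst re / \<delta> n ^ snd re"
    using assms Zhalf_over_\<delta> by (fastforce simp: admissible_def)
  from choice[OF this] obtain f where f: "\<And>x. fst (f x) \<in> Zzeta n" "\<And>x. \<psi> x = fst (f x) / \<delta> n ^ snd (f x)" by blast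
  \<comment> \<open>Any common bound of the exponents serves; the sum is one even if
    \<open>X\<close> is empty.\<close>
  define E where "E = (\<Sum>x\<in>X. snd (f x))"
  define w where "w = (\<lambda>x. if x \<in> X then fst (f x) * \<delta> n ^ (E - snd (f x)) else 0)"
  have "w x \<in> Zzeta n" for x unfolding w_def by (auto intro!: Zzeta_intros f)
  moreover have "\<psi> x = scaled E w x" for x
  proof (cases "x \<in> X")
    case True
    then have "snd (f x) \<le> E" unfolding E_def using finX by (intro member_le_sum) auto
    then have "\<delta> n ^ E = \<delta> n ^ (E - snd (f x)) * \<delta> n ^ snd (f x)" by (simp flip: power_add)
    then show ?thesis using True f(2)[of x] \<delta>_nz by (simp add: scaled_def w_def)
  next
    case False
    then show ?thesis using assms by (simp add: admissible_def scaled_def w_def)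
  qed
  ultimately show ?thesis by blast
qed

text \<open>The columns are reduced one after another by a single growing product \<open>P\<close>
  that sends each \<open>u y\<close> to \<open>ket y\<close>; the inverse of \<open>P\<close> is the
  operator sought.\<close>

lemma synthesize:
  assumes u: "\<And>y. y \<in> X \<Longrightarrow> admissible (u y)"
    and on: "\<And>y z. y \<in> X \<Longrightarrow> z \<in> X \<Longrightarrow> inner_on X (u y) (u z) = (if y = z then 1 else 0)"
  shows "\<exists>Q\<in>S. \<forall>y\<in>X. Q (ket y) = u y"
proof -
  have "\<exists>P\<in>reducers {}. \<forall>y\<in>Y. P (u y) = ket y" if "finite Y" "Y \<subseteq> X" for Y
    using that
  proof (induction Y rule: finite_induct)
    case empty show ?case using reducers_id by blast
  next
    case (insert t Y)
    then obtain P where P: "P \<in> reducers {}" "\<And>y. y \<in> Y \<Longrightarrow> P (u y) = ket y" by blast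
    have t: "t \<in> X - Y" using insert by auto
    have ad: "admissible (P (u t))" using P u t by (auto simp: reducers_def)
    have norm: "inner_on X (P (u t)) (P (u t)) = 1" using P on t by (auto simp: reducers_def)
    \<comment> \<open>At a finished level the entry of the new column is its inner product with that
      earlier column, so orthogonality clears it.\<close>
    have supp: "P (u t) x = 0" if "x \<notin> X - Y" for x
    proof (cases "x \<in> Y")
      case True
      then have "x \<in> X" "x \<noteq> t" using insert by auto
      then have "P (u t) x = inner_on X (P (u t)) (P (u x))" using P(2)[OF True] ip_ket[OF finX] by simp
      also have "\<dots> = inner_on X (u t) (u x)" using P by (simp add: reducers_def)
      also have "\<dots> = 0" using on t \<open>x \<in> X\<close> \<open>x \<noteq> t\<close> by auto
      finally show ?thesis .
    qed (use ad that in \<open>auto simp: admissible_def\<close>)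
    obtain e w where w: "\<And>x. w x \<in> Zzeta n" "P (u t) = scaled e w" using admissible_scaled[OF ad] by blast
    have wz: "w x = 0" if "x \<notin> X - Y" for x using supp[OF that] \<delta>_nz unfolding w(2) by (simp add: scaled_def)
    have "\<exists>Q\<in>reducers Y. Q (scaled e w) = ket t"
      by (rule reduce_column[OF _ t w(1) wz]) (use insert.prems norm in \<open>auto simp: w(2)\<close>)
    then obtain Q where Q: "Q \<in> reducers Y" "Q (P (u t)) = ket t" unfolding w(2) by blast
    have "Q \<in> reducers {}" using Q by (simp add: reducers_def)
    then have "(\<lambda>\<psi>. Q (P \<psi>)) \<in> reducers {}" by (rule reducers_comp[OF _ P(1)])
    moreover have "\<forall>y\<in>insert t Y. Q (P (u y)) = ket y" using Q P(2) by (auto simp: reducers_def)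
    ultimately show ?case by (intro bexI[of _ "\<lambda>\<psi>. Q (P \<psi>)"])
  qed
  from this[OF finX order_refl] obtain P where P: "P \<in> reducers {}" "\<forall>y\<in>X. P (u y) = ket y" by blast
  then obtain Q where Q: "Q \<in> S" "\<forall>\<psi>. Q (P \<psi>) = \<psi>" unfolding reducers_def by blast
  have "Q (ket y) = u y" if "y \<in> X" for y
  proof -
    have "Q (P (u y)) = u y" using Q by blast
    then show ?thesis using P that by simp
  qed
  then show ?thesis using Q by blast
qed

end

section \<open>Circuits as operators on amplitude functions\<close>

type_synonym bits = "nat \<Rightarrow> bool"

text \<open>As assignments are \<open>False\<close> from \<open>m\<close> on, a state of
  \<open>m\<close> qubits is also a state of any larger register, with the additional qubits in
  0.\<close>

definition states :: "nat \<Rightarrow> bits set" where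
  "states m = {x. \<forall>q\<ge>m. \<not> x q}"

definition bits :: "nat \<Rightarrow> nat \<Rightarrow> bits" where
  "bits N i = (\<lambda>q. q < N \<and> odd (i div 2 ^ (N - 1 - q)))"

lemma finite_card_states: "finite (states m)" "card (states m) = 2 ^ m"
proof -
  have b: "bij_betw (\<lambda>x. {q. x q}) (states m) (Pow {..<m})"
    by (rule bij_betwI[of _ _ _ "\<lambda>A q. q \<in> A"]) (auto simp: states_def not_le)
  then show "finite (states m)" using bij_betw_finite by blast
  show "card (states m) = 2 ^ m" using bij_betw_same_card[OF b] by (simp add: card_Pow)
qed

lemma bij_bits: "bij_betw (bits N) {..<2 ^ N} (states N)"
proof -
  have inj: "inj_on (bits N) {..<2 ^ N}"
  proof (rule inj_onI)
    fix i j :: nat assume ij: "i \<in> {..<2 ^ N}" "j \<in> {..<2 ^ N}" and eq: "bits N i = bits N j"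
    have "bit i p = bit j p" for p
    proof (cases "p < N")
      case True
      then have "bits N i (N - 1 - p) = bits N j (N - 1 - p)" "N - 1 - p < N" "N - 1 - (N - 1 - p) = p"
        using eq by auto
      then show ?thesis by (simp add: bits_def bit_iff_odd)
    next
      case False
      then have "(2::nat) ^ N \<le> 2 ^ p" by simp
      then have "i < 2 ^ p" "j < 2 ^ p" using ij unfolding lessThan_iff by linarith+
      then show ?thesis by (simp add: bit_iff_odd)
    qed
    then show "i = j" by (simp add: bit_eq_iff)
  qed
  have "bits N ` {..<2 ^ N} = states N"
  proof (rule card_subset_eq)
    show "card (bits N ` {..<2 ^ N}) = card (states N)" using card_image[OF inj] finite_card_states by simp
  qed (use finite_card_states in \<open>auto\<close>, auto simp: bits_def states_def)
  with inj show ?thesis by (simp add: bij_betw_def)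
qed

lemma bits_in_states [simp]: "bits N i \<in> states N"
  by (auto simp: bits_def states_def)

lemma bits_eq_iff: "i < 2 ^ N \<Longrightarrow> j < 2 ^ N \<Longrightarrow> bits N i = bits N j \<longleftrightarrow> i = j"
  using bij_bits[of N] by (auto simp: bij_betw_def inj_on_def)

lemma states_bits: "x \<in> states N \<Longrightarrow> \<exists>i<2 ^ N. x = bits N i"
  using bij_bits[of N] by (auto simp: bij_betw_def image_iff)

lemma sum_bits: "(\<Sum>c<2 ^ N. f (bits N c)) = (\<Sum>x\<in>states N. f x)"
  using sum.reindex_bij_betw[OF bij_bits[of N], of f] by simp

text \<open>Only the values of \<open>P \<psi>\<close> on \<open>states N\<close> are constrained, so many operators are realized by the same matrix.\<close>
definition realizes :: "nat \<Rightarrow> complex mat \<Rightarrow> bits op \<Rightarrow> bool" where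
  "realizes N M P \<longleftrightarrow> (\<forall>\<psi>. \<forall>r<2 ^ N. (\<Sum>c<2 ^ N. M $$ (r, c) * \<psi> (bits N c)) = P \<psi> (bits N r))"

definition ops :: "nat \<Rightarrow> complex mat set \<Rightarrow> bits op set" where
  "ops N \<G> = {P. \<exists>M\<in>circuits N \<G>. realizes N M P}"

lemma realizesD: "realizes N M P \<Longrightarrow> r < 2 ^ N \<Longrightarrow> (\<Sum>c<2 ^ N. M $$ (r, c) * \<psi> (bits N c)) = P \<psi> (bits N r)"
  unfolding realizes_def by blast

lemma opsI: "M \<in> circuits N \<G> \<Longrightarrow> realizes N M P \<Longrightarrow> P \<in> ops N \<G>"
  unfolding ops_def by blast

lemma opsE:
  assumes "P \<in> ops N \<G>" obtains M where "M \<in> circuits N \<G>" "realizes N M P"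
  using assms unfolding ops_def by blast

lemma embed_carrier [simp]: "embed_gate N G qs \<in> carrier_mat (2 ^ N) (2 ^ N)"
  by (simp add: embed_gate_def)

lemma circuits_carrier: "M \<in> circuits N \<G> \<Longrightarrow> M \<in> carrier_mat (2 ^ N) (2 ^ N)"
  by (induction rule: circuits.induct) (simp, rule mult_carrier_mat[OF embed_carrier])

lemma circuits_mult:
  assumes "A \<in> circuits N \<G>" "B \<in> circuits N \<G>" shows "A * B \<in> circuits N \<G>"
  using assms
proof (induction rule: circuits.induct)
  case empty
  then show ?case using circuits_carrier by (metis left_mult_one_mat)
next
  case (step C G qs)
  have "embed_gate N G qs * C * B = embed_gate N G qs * (C * B)"
    by (rule assoc_mult_mat[OF embed_carrier circuits_carrier circuits_carrier]) (use step in auto)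
  then show ?case using step circuits.step[of "C * B"] by simp
qed

lemma realizes_mult:
  assumes A: "A \<in> carrier_mat (2 ^ N) (2 ^ N)" "realizes N A P" and B: "B \<in> carrier_mat (2 ^ N) (2 ^ N)" "realizes N B Q"
  shows "realizes N (A * B) (\<lambda>\<psi>. P (Q \<psi>))"
  unfolding realizes_def
proof (intro allI impI)
  fix \<psi> and r :: nat assume r: "r < 2 ^ N"
  have "(A * B) $$ (r, c) = (\<Sum>d<2 ^ N. A $$ (r, d) * B $$ (d, c))" if "c < 2 ^ N" for c
    using A B r that by (simp add: scalar_prod_def atLeast0LessThan)
  then have "(\<Sum>c<2 ^ N. (A * B) $$ (r, c) * \<psi> (bits N c)) = (\<Sum>c<2 ^ N. \<Sum>d<2 ^ N. A $$ (r, d) * (B $$ (d, c) * \<psi> (bits N c)))"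
    by (simp add: sum_distrib_right mult.assoc)
  also have "\<dots> = (\<Sum>d<2 ^ N. A $$ (r, d) * (\<Sum>c<2 ^ N. B $$ (d, c) * \<psi> (bits N c)))"
    by (subst sum.swap) (simp add: sum_distrib_left)
  also have "\<dots> = (\<Sum>d<2 ^ N. A $$ (r, d) * Q \<psi> (bits N d))"
    using B(2) by (intro sum.cong) (auto simp: realizes_def)
  also have "\<dots> = P (Q \<psi>) (bits N r)" using A(2) r by (auto simp: realizes_def)
  finally show "(\<Sum>c<2 ^ N. (A * B) $$ (r, c) * \<psi> (bits N c)) = P (Q \<psi>) (bits N r)" .
qed

lemma ops_comp: "P \<in> ops N \<G> \<Longrightarrow> Q \<in> ops N \<G> \<Longrightarrow> (\<lambda>\<psi>. P (Q \<psi>)) \<in> ops N \<G>"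
proof -
  assume "P \<in> ops N \<G>" "Q \<in> ops N \<G>"
  then obtain A B where A: "A \<in> circuits N \<G>" "realizes N A P" and B: "B \<in> circuits N \<G>" "realizes N B Q"
    by (elim opsE)
  have "realizes N (A * B) (\<lambda>\<psi>. P (Q \<psi>))"
    by (rule realizes_mult[OF circuits_carrier[OF A(1)] A(2) circuits_carrier[OF B(1)] B(2)])
  then show ?thesis by (rule opsI[OF circuits_mult[OF A(1) B(1)]])
qed

lemma realizes_one: "realizes N (1\<^sub>m (2 ^ N)) (\<lambda>\<psi>. \<psi>)"
proof -
  have "(\<Sum>c<2 ^ N. (1\<^sub>m (2 ^ N)) $$ (r, c) * \<psi> (bits N c)) = \<psi> (bits N r)" if "r < 2 ^ N" for r and \<psi> :: "bits \<Rightarrow> complex"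
  proof -
    have "(\<Sum>c<2 ^ N. (1\<^sub>m (2 ^ N)) $$ (r, c) * \<psi> (bits N c)) = (\<Sum>c<2 ^ N. if c = r then \<psi> (bits N c) else 0)"
      using that by (intro sum.cong) auto
    then show ?thesis using that by simp
  qed
  then show ?thesis by (simp add: realizes_def)
qed

lemma ops_id: "(\<lambda>\<psi>. \<psi>) \<in> ops N \<G>"
  by (rule opsI[OF circuits.empty realizes_one])

lemma ops_linear:
  assumes "P \<in> ops N \<G>" "x \<in> states N"
  shows "P (\<lambda>y. a * \<psi> y + b * \<phi> y) x = a * P \<psi> x + b * P \<phi> x"
proof -
  obtain r where r: "r < 2 ^ N" "x = bits N r" using states_bits[OF assms(2)] by blast
  obtain M where M: "realizes N M P" using assms(1) by (rule opsE)
  have "(\<Sum>c<2 ^ N. M $$ (r, c) * (a * \<psi> (bits N c) + b * \<phi> (bits N c)))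
     = a * (\<Sum>c<2 ^ N. M $$ (r, c) * \<psi> (bits N c)) + b * (\<Sum>c<2 ^ N. M $$ (r, c) * \<phi> (bits N c))"
    by (simp add: sum_distrib_left sum.distrib algebra_simps)
  then show ?thesis
    using realizesD[OF M r(1), of \<psi>] realizesD[OF M r(1), of \<phi>] realizesD[OF M r(1), of "\<lambda>y. a * \<psi> y + b * \<phi> y"] r(2)
    by simp
qed

section \<open>Action of a gate on a few qubits\<close>

definition agree :: "bits \<Rightarrow> nat list \<Rightarrow> bits set" where
  "agree x qs = {y. \<forall>q. q \<notin> set qs \<longrightarrow> y q = x q}"

definition val :: "nat list \<Rightarrow> bits \<Rightarrow> nat" where
  "val qs x = (\<Sum>t<length qs. of_bool (x (qs ! t)) * 2 ^ (length qs - 1 - t))"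

text \<open>Free of the register size, and the sum over \<open>agree\<close> unfolds along
  \<open>qs\<close>, so concrete gates can be evaluated by simplification.\<close>

definition gate_op :: "complex mat \<Rightarrow> nat list \<Rightarrow> bits op" where
  "gate_op G qs \<psi> x = (\<Sum>y\<in>agree x qs. G $$ (val qs x, val qs y) * \<psi> y)"

lemma agree_Nil [simp]: "agree x [] = {x}" by (auto simp: agree_def)

lemma agree_Cons: "agree x (q # qs) = agree (x(q := False)) qs \<union> agree (x(q := True)) qs"
proof (intro Set.set_eqI iffI)
  fix y assume y: "y \<in> agree x (q # qs)"
  show "y \<in> agree (x(q := False)) qs \<union> agree (x(q := True)) qs"
    using y by (cases "y q") (auto simp: agree_def)
qed (auto simp: agree_def split: if_splits)

lemma finite_agree: "finite (agree x qs)"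
  by (induction qs arbitrary: x) (auto simp: agree_Cons)

lemma sum_agree_Cons:
  assumes "q \<notin> set qs"
  shows "sum f (agree x (q # qs)) = sum f (agree (x(q := False)) qs) + sum f (agree (x(q := True)) qs)"
proof -
  have "agree (x(q := False)) qs \<inter> agree (x(q := True)) qs = {}"
    using assms by (auto simp: agree_def)
  then show ?thesis unfolding agree_Cons by (intro sum.union_disjoint finite_agree)
qed

lemma realizes_gate:
  assumes "set qs \<subseteq> {..<N}"
  shows "realizes N (embed_gate N G qs) (gate_op G qs)"
  unfolding realizes_def
proof (intro allI impI)
  fix \<psi> and r :: nat assume r: "r < 2 ^ N"
  have qb: "qbit N i q = of_bool (bits N i q)" if "q < N" for i q
    using that by (simp add: qbit_def bits_def mod_2_eq_odd)
  have sub: "subidx N qs i = val qs (bits N i)" for i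
    unfolding subidx_def val_def
  proof (intro sum.cong refl)
    fix t assume "t \<in> {..<length qs}"
    then have "qs ! t \<in> set qs" by simp
    then have "qs ! t < N" using assms by blast
    then show "qbit N i (qs ! t) * 2 ^ (length qs - 1 - t) = of_bool (bits N i (qs ! t)) * 2 ^ (length qs - 1 - t)"
      by (simp only: qb)
  qed
  have ag: "(\<forall>q<N. q \<notin> set qs \<longrightarrow> qbit N r q = qbit N c q) \<longleftrightarrow> bits N c \<in> agree (bits N r) qs" for c
    using assms by (auto simp: agree_def qb) (auto simp: bits_def)
  have "(\<Sum>c<2 ^ N. embed_gate N G qs $$ (r, c) * \<psi> (bits N c))
     = (\<Sum>c<2 ^ N. if bits N c \<in> agree (bits N r) qs then G $$ (val qs (bits N r), val qs (bits N c)) * \<psi> (bits N c) else 0)"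
    using r by (intro sum.cong) (auto simp: embed_gate_def ag sub)
  also have "\<dots> = (\<Sum>y\<in>states N. if y \<in> agree (bits N r) qs then G $$ (val qs (bits N r), val qs y) * \<psi> y else 0)"
    by (rule sum_bits)
  also have "\<dots> = (\<Sum>y\<in>states N \<inter> agree (bits N r) qs. G $$ (val qs (bits N r), val qs y) * \<psi> y)"
    by (simp add: sum.inter_restrict finite_card_states)
  also have "states N \<inter> agree (bits N r) qs = agree (bits N r) qs"
    using assms by (auto simp: agree_def states_def bits_def) (metis lessThan_iff linorder_not_less subsetD)
  finally show "(\<Sum>c<2 ^ N. embed_gate N G qs $$ (r, c) * \<psi> (bits N c)) = gate_op G qs \<psi> (bits N r)"
    by (simp add: gate_op_def)
qed

lemma gate_in_ops:
  assumes "G \<in> \<G>" "G \<in> carrier_mat (2 ^ length qs) (2 ^ length qs)" "distinct qs" "set qs \<subseteq> {..<N}"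
    and "\<And>\<psi> x. gate_op G qs \<psi> x = P \<psi> x"
  shows "P \<in> ops N \<G>"
proof -
  have "embed_gate N G qs = embed_gate N G qs * 1\<^sub>m (2 ^ N)" by (simp add: right_mult_one_mat[OF embed_carrier])
  also have "\<dots> \<in> circuits N \<G>" using assms by (intro circuits.intros)
  finally have "gate_op G qs \<in> ops N \<G>" by (rule opsI[OF _ realizes_gate[OF assms(4)]])
  moreover have "gate_op G qs = P" using assms(5) by blast
  ultimately show ?thesis by simp
qed

text \<open>A pullback, so \<open>perm f (perm g \<psi>)\<close> is
  \<open>perm (g \<circ> f) \<psi>\<close>.\<close>

definition perm :: "(bits \<Rightarrow> bits) \<Rightarrow> bits op" where "perm g \<psi> = (\<lambda>x. \<psi> (g x))"
definition diag :: "(bits \<Rightarrow> complex) \<Rightarrow> bits op" where "diag f \<psi> = (\<lambda>x. f x * \<psi> x)"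

definition mcx :: "nat set \<Rightarrow> nat \<Rightarrow> bits op" where
  "mcx A t = perm (\<lambda>x. x(t := x t \<noteq> (\<forall>c\<in>A. x c)))"

definition phase :: "complex \<Rightarrow> nat set \<Rightarrow> bits op" where
  "phase c A = diag (\<lambda>x. if \<forall>q\<in>A. x q then c else 1)"

definition sgn_bit :: "bool \<Rightarrow> complex" where "sgn_bit b = (if b then -1 else 1)"

definition had :: "nat \<Rightarrow> bits op" where
  "had q \<psi> = (\<lambda>x. (1 + \<i>) / 2 * (\<psi> (x(q := False)) + sgn_bit (x q) * \<psi> (x(q := True))))"

definition hh :: "nat \<Rightarrow> nat \<Rightarrow> bits op" where
  "hh p q \<psi> = (\<lambda>x. 1 / 2 * (\<psi> (x(p := False, q := False)) + sgn_bit (x q) * \<psi> (x(p := False, q := True))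
     + sgn_bit (x p) * \<psi> (x(p := True, q := False)) + sgn_bit (x p) * sgn_bit (x q) * \<psi> (x(p := True, q := True))))"

lemma val_simps:
  "val [] x = 0" "val (q # qs) x = of_bool (x q) * 2 ^ length qs + val qs x"
proof -
  show "val [] x = 0" by (simp add: val_def)
  have "val (q # qs) x = (\<Sum>t<Suc (length qs). of_bool (x ((q # qs) ! t)) * 2 ^ (length qs - t))"
    by (simp add: val_def)
  also have "\<dots> = of_bool (x q) * 2 ^ length qs + (\<Sum>t<length qs. of_bool (x (qs ! t)) * 2 ^ (length qs - Suc t))"
    by (subst sum.lessThan_Suc_shift) simp
  finally show "val (q # qs) x = of_bool (x q) * 2 ^ length qs + val qs x" by (simp add: val_def)
qed

lemmas gate_op_simps = gate_op_def sum_agree_Cons val_simps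

lemma X_op: "Xgate \<in> \<G> \<Longrightarrow> q < N \<Longrightarrow> mcx {} q \<in> ops N \<G>"
  by (rule gate_in_ops[of Xgate _ "[q]"])
    (auto simp: gate_op_simps Xgate_def mcx_def perm_def)

lemma CX_op: "CXgate \<in> \<G> \<Longrightarrow> c < N \<Longrightarrow> t < N \<Longrightarrow> c \<noteq> t \<Longrightarrow> mcx {c} t \<in> ops N \<G>"
proof (rule gate_in_ops[of CXgate _ "[c,t]"])
  fix \<psi> and x :: bits assume "c \<noteq> t"
  then show "gate_op CXgate [c, t] \<psi> x = mcx {c} t \<psi> x"
    by (cases "x c"; cases "x t") (simp_all add: gate_op_simps CXgate_def mcx_def perm_def fun_upd_idem)
qed (auto simp: CXgate_def)

lemma CCX_op: "CCXgate \<in> \<G> \<Longrightarrow> a < N \<Longrightarrow> b < N \<Longrightarrow> t < N \<Longrightarrow> distinct [a,b,t] \<Longrightarrow> mcx {a,b} t \<in> ops N \<G>"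
proof (rule gate_in_ops[of CCXgate _ "[a,b,t]"])
  fix \<psi> and x :: bits assume "distinct [a,b,t]"
  then show "gate_op CCXgate [a, b, t] \<psi> x = mcx {a, b} t \<psi> x"
    by (cases "x a"; cases "x b"; cases "x t") (simp_all add: gate_op_simps CCXgate_def mcx_def perm_def fun_upd_idem)
qed (auto simp: CCXgate_def)

lemma S_op: "Sgate \<in> \<G> \<Longrightarrow> q < N \<Longrightarrow> phase \<i> {q} \<in> ops N \<G>"
  by (rule gate_in_ops[of Sgate _ "[q]"])
    (auto simp: gate_op_simps Sgate_def phase_def diag_def fun_upd_idem)

lemma T_op: "Tgate n \<in> \<G> \<Longrightarrow> q < N \<Longrightarrow> phase (zeta n) {q} \<in> ops N \<G>"
  by (rule gate_in_ops[of "Tgate n" _ "[q]"])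
    (auto simp: gate_op_simps Tgate_def phase_def diag_def fun_upd_idem)

lemma had_op: "H' \<in> \<G> \<Longrightarrow> q < N \<Longrightarrow> had q \<in> ops N \<G>"
  by (rule gate_in_ops[of H' _ "[q]"])
    (auto simp: gate_op_simps H'_def had_def sgn_bit_def field_simps)

lemma hh_op: "HHgate \<in> \<G> \<Longrightarrow> p < N \<Longrightarrow> q < N \<Longrightarrow> p \<noteq> q \<Longrightarrow> hh p q \<in> ops N \<G>"
  by (rule gate_in_ops[of HHgate _ "[p,q]"])
    (auto simp: gate_op_simps HHgate_def hh_def sgn_bit_def field_simps)

text \<open>The inverse of \<open>had q\<close>, since \<open>H'\<close> squares to
  \<open>\<i>\<close>.\<close>

definition hadi :: "nat \<Rightarrow> bits op" where "hadi q \<psi> = (\<lambda>x. - \<i> * had q \<psi> x)"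

definition flip :: "nat set \<Rightarrow> bits op" where
  "flip F = perm (\<lambda>x q. if q \<in> F then \<not> x q else x q)"

definition fan :: "nat \<Rightarrow> nat set \<Rightarrow> bits op" where
  "fan q D = perm (\<lambda>x p. if p \<in> D then x p \<noteq> x q else x p)"

text \<open>Keeps the conjunction of the controls opaque, so that a case distinction can treat it as
  one Boolean.\<close>

definition all_set :: "nat set \<Rightarrow> bits \<Rightarrow> bool" where
  "all_set A x \<longleftrightarrow> (\<forall>a\<in>A. x a)"

lemma all_set_upd: "b \<notin> A \<Longrightarrow> all_set A (x(b := v)) = all_set A x"
  by (auto simp: all_set_def)

lemma all_set_insert: "all_set (insert c A) x \<longleftrightarrow> x c \<and> all_set A x" "all_set {} x"
  by (auto simp: all_set_def)

lemma mcx_apply: "mcx A t \<psi> x = \<psi> (x(t := x t \<noteq> all_set A x))"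
  by (simp add: mcx_def perm_def all_set_def)

lemma phase_insert_apply: "phase z (insert c A) \<psi> x = (if x c \<and> all_set A x then z else 1) * \<psi> x"
  by (simp add: phase_def diag_def all_set_def)

locale op_monoid =
  fixes S :: "bits op set"
  assumes S_id: "(\<lambda>\<psi>. \<psi>) \<in> S"
    and S_comp: "P \<in> S \<Longrightarrow> Q \<in> S \<Longrightarrow> (\<lambda>\<psi>. P (Q \<psi>)) \<in> S"

section \<open>Multiply controlled gates with a borrowed qubit\<close>

locale toffoli_ops = op_monoid S for S +
  fixes N :: nat
  assumes S_X: "t < N \<Longrightarrow> mcx {} t \<in> S"
    and S_CX: "c < N \<Longrightarrow> t < N \<Longrightarrow> c \<noteq> t \<Longrightarrow> mcx {c} t \<in> S"
    and S_CCX: "a < N \<Longrightarrow> b < N \<Longrightarrow> t < N \<Longrightarrow> distinct [a,b,t] \<Longrightarrow> mcx {a,b} t \<in> S"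
begin

text \<open>Adding one control: with \<open>f\<close> the conjunction of the old controls, the target receives
  \<open>c (b \<oplus> f) \<oplus> c b = c f\<close> while the borrowed qubit \<open>b\<close> is restored.\<close>
lemma mcx_borrow:
  assumes "finite A" "A \<subseteq> {..<N}" "t < N" "b < N" "t \<notin> A" "b \<notin> A" "b \<noteq> t"
  shows "mcx A t \<in> S"
  using assms
proof (induction A arbitrary: t b rule: finite_induct)
  case empty then show ?case using S_X by simp
next
  case (insert c A)
  have 1: "mcx A b \<in> S" using insert.IH[of b t] insert.prems by auto
  have 2: "mcx {c,b} t \<in> S" using S_CCX[of c b t] insert.prems by auto
  have "mcx (insert c A) t = (\<lambda>\<psi>. mcx {c,b} t (mcx A b (mcx {c,b} t (mcx A b \<psi>))))"
  proof (intro ext)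
    fix \<psi> :: "bits \<Rightarrow> complex" and x
    show "mcx (insert c A) t \<psi> x = mcx {c,b} t (mcx A b (mcx {c,b} t (mcx A b \<psi>))) x"
      using insert.prems insert.hyps
      by (cases "all_set A x"; cases "x c"; cases "x b"; cases "x t")
        (simp_all add: mcx_apply all_set_insert all_set_upd fun_upd_idem fun_upd_twist[of t b])
  qed
  then show ?case using S_comp[OF 2 S_comp[OF 1 S_comp[OF 2 1]]] by simp
qed

end

section \<open>Levels of an m-qubit register\<close>

text \<open>Carries a level operator from convenient levels to arbitrary ones: \<open>R p\<close>
  will say that the operator at the levels moved by \<open>p\<close> is available, and
  \<open>step\<close> is conjugation by a level swap.\<close>

lemma extend_by_transpositions:
  assumes "finite A" "inj_on f A" "A \<subseteq> X" "f ` A \<subseteq> X" "R id"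
    and step: "\<And>p u v. R p \<Longrightarrow> u \<in> X \<Longrightarrow> v \<in> X \<Longrightarrow> R (transpose u v \<circ> p)"
  shows "\<exists>p. R p \<and> p ` X \<subseteq> X \<and> inj p \<and> (\<forall>a\<in>A. p a = f a)"
  using assms(1-4)
proof (induction A rule: finite_induct)
  case empty show ?case by (intro exI[of _ id] conjI, rule assms(5)) auto
next
  case (insert a A)
  then obtain p where p: "R p" "p ` X \<subseteq> X" "inj p" "\<And>a. a \<in> A \<Longrightarrow> p a = f a" by auto
  let ?q = "transpose (p a) (f a) \<circ> p"
  have mem: "p a \<in> X" "f a \<in> X" using p insert.prems by auto
  have "R ?q" by (rule step[OF p(1) mem])
  moreover have "?q ` X \<subseteq> X" using p(2) mem by (auto simp: transpose_def)
  moreover have "inj ?q" using p(3) by (simp add: inj_compose)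
  moreover have "?q a' = f a'" if "a' \<in> insert a A" for a'
  proof (cases "a' = a")
    case False
    then have "a' \<in> A" using that by simp
    moreover have "f a' \<noteq> f a" using False that insert.prems(1) by (auto simp: inj_on_def)
    moreover have "p a' \<noteq> p a" using False p(3) by (auto simp: inj_def)
    ultimately show ?thesis using p(4)[of a'] by (simp add: transpose_def)
  qed simp
  ultimately show ?case by blast
qed

lemma h2_conj: "level_had (transpose u v y) (transpose u v z) = (\<lambda>\<psi>. level_swap u v (level_had y z (level_swap u v \<psi>)))"
proof (intro ext)
  fix \<psi> x
  have e: "x = transpose u v w \<longleftrightarrow> transpose u v x = w" for w by (metis transpose_involutory)
  show "level_had (transpose u v y) (transpose u v z) \<psi> x = level_swap u v (level_had y z (level_swap u v \<psi>)) x"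
    by (simp add: level_had_def level_swap_def e)
qed

lemma h4_conj: "level_hh (transpose u v a) (transpose u v b) (transpose u v c) (transpose u v d)
   = (\<lambda>\<psi>. level_swap u v (level_hh a b c d (level_swap u v \<psi>)))"
proof (intro ext)
  fix \<psi> x
  have e: "x = transpose u v w \<longleftrightarrow> transpose u v x = w" for w by (metis transpose_involutory)
  show "level_hh (transpose u v a) (transpose u v b) (transpose u v c) (transpose u v d) \<psi> x = level_swap u v (level_hh a b c d (level_swap u v \<psi>)) x"
    by (simp add: level_hh_def level_swap_def e)
qed

text \<open>To be instantiated with \<open>lift m S\<close>. \<open>S_cong\<close> says that
  operators matter only through their values on the register.\<close>

locale register = op_monoid S for S +
  fixes m :: nat
  assumes S_cong: "P \<in> S \<Longrightarrow> (\<And>\<psi> x. x \<in> states m \<Longrightarrow> P \<psi> x = Q \<psi> x) \<Longrightarrow> Q \<in> S"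
    and S_mcx: "A \<subseteq> {..<m} \<Longrightarrow> t < m \<Longrightarrow> t \<notin> A \<Longrightarrow> mcx A t \<in> S"
begin

lemma flip_in: "F \<subseteq> {..<m} \<Longrightarrow> flip F \<in> S"
proof -
  assume F: "F \<subseteq> {..<m}"
  then have "finite F" by (rule finite_subset) simp
  then show ?thesis using F
  proof (induction F rule: finite_subset_induct')
    case empty
    have "flip {} = (\<lambda>\<psi>. \<psi>)" by (auto simp: flip_def perm_def)
    then show ?case using S_id by simp
  next
    case (insert q F)
    have "flip (insert q F) = (\<lambda>\<psi>. mcx {} q (flip F \<psi>))"
      using insert.hyps by (auto simp: flip_def mcx_def perm_def fun_eq_iff intro!: arg_cong[where f="_ :: bits \<Rightarrow> complex"])
    moreover have "mcx {} q \<in> S" using insert.hyps by (intro S_mcx) auto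
    ultimately show ?case using S_comp insert.IH by simp
  qed
qed

lemma fan_in: "q < m \<Longrightarrow> D \<subseteq> {..<m} - {q} \<Longrightarrow> fan q D \<in> S"
proof -
  assume q: "q < m" and D: "D \<subseteq> {..<m} - {q}"
  then have "finite D" by (auto intro: finite_subset)
  then show ?thesis using D
  proof (induction D rule: finite_subset_induct')
    case empty
    have "fan q {} = (\<lambda>\<psi>. \<psi>)" by (auto simp: fan_def perm_def)
    then show ?case using S_id by simp
  next
    case (insert p D)
    have "fan q (insert p D) = (\<lambda>\<psi>. mcx {q} p (fan q D \<psi>))"
      using insert.hyps by (auto simp: fan_def mcx_def perm_def fun_eq_iff intro!: arg_cong[where f="_ :: bits \<Rightarrow> complex"])
    moreover have "mcx {q} p \<in> S" using insert.hyps q by (intro S_mcx) auto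
    ultimately show ?case using S_comp insert.IH by simp
  qed
qed

text \<open>CNOTs controlled by a qubit \<open>q\<close> at which \<open>a\<close> and
  \<open>b\<close> differ make them differ at \<open>q\<close> only (\<open>h\<close>); NOTs then
  set all their other bits (\<open>f\<close>). An X on \<open>q\<close> controlled by all other
  qubits swaps exactly these two states (\<open>mc\<close>), and the preparation is undone.\<close>

lemma tr_in_aux:
  assumes ab: "a \<in> states m" "b \<in> states m" and q: "\<not> a q" "b q"
  shows "level_swap a b \<in> S"
proof -
  have qm: "q < m" using ab(2) q(2) by (auto simp: states_def not_le[symmetric])
  define D where "D = {p. p \<noteq> q \<and> a p \<noteq> b p}"
  define F where "F = {p. p < m \<and> p \<noteq> q \<and> \<not> a p}"
  define f where "f = (\<lambda>(x::bits) q. if q \<in> F then \<not> x q else x q)"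
  define h where "h = (\<lambda>(x::bits) p. if p \<in> D then x p \<noteq> x q else x p)"
  define mc where "mc = (\<lambda>x::bits. x(q := x q \<noteq> (\<forall>c\<in>{..<m} - {q}. x c)))"
  have Dm: "D \<subseteq> {..<m} - {q}" using ab by (auto simp: D_def states_def not_le[symmetric])
  have inv: "f (f x) = x" "h (h x) = x" for x by (auto simp: f_def h_def D_def fun_eq_iff)
  have st: "f (h x) \<in> states m" if "x \<in> states m" for x
    using that Dm by (auto simp: f_def h_def states_def F_def)
  have a0: "f (h a) = (\<lambda>p. p < m \<and> p \<noteq> q)"
    using ab q by (auto simp: f_def h_def F_def D_def fun_eq_iff states_def not_le[symmetric])
  have b0: "f (h b) = (\<lambda>p. p < m)"
    using ab q qm by (auto simp: f_def h_def F_def D_def fun_eq_iff states_def not_le[symmetric])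
  have mca: "mc (f (h a)) = f (h b)" and mcb: "mc (f (h b)) = f (h a)"
    unfolding a0 b0 using qm by (auto simp: mc_def fun_eq_iff)
  have "h (f (mc (f (h x)))) = transpose a b x" if x: "x \<in> states m" for x
  proof -
    consider "x = a" | "x = b" | "x \<noteq> a" "x \<noteq> b" by blast
    then show ?thesis
    proof cases
      case 1 then show ?thesis using mca inv by simp
    next
      case 2 then show ?thesis using mcb inv by simp
    next
      case 3
      let ?y = "f (h x)"
      \<comment> \<open>With all controls set only the bit at \<open>q\<close> is free, and its two
        values belong to \<open>a\<close> and \<open>b\<close>.\<close>
      have "\<not> (\<forall>c\<in>{..<m} - {q}. ?y c)"
      proof
        assume all: "\<forall>c\<in>{..<m} - {q}. ?y c"
        have "?y = f (h a) \<or> ?y = f (h b)"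
        proof (cases "?y q")
          case True
          have "?y p = (p < m)" for p using all True st[OF x] by (cases "p = q") (auto simp: states_def not_less)
          then show ?thesis unfolding b0 by blast
        next
          case False
          have "?y p = (p < m \<and> p \<noteq> q)" for p using all False st[OF x] by (cases "p = q") (auto simp: states_def not_less)
          then show ?thesis unfolding a0 by blast
        qed
        then show False using 3 inv by metis
      qed
      then have "mc ?y = ?y" by (auto simp: mc_def)
      then show ?thesis using 3 inv by simp
    qed
  qed
  then have eq: "perm h (perm f (perm mc (perm f (perm h \<psi>)))) x = level_swap a b \<psi> x" if "x \<in> states m" for \<psi> x
    using that by (simp add: perm_def level_swap_def)
  have mem: "perm f \<in> S" "perm h \<in> S" "perm mc \<in> S"
  proof -
    have "F \<subseteq> {..<m}" by (auto simp: F_def)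
    from flip_in[OF this] show "perm f \<in> S" by (simp only: flip_def f_def)
    from fan_in[OF qm Dm] show "perm h \<in> S" by (simp only: fan_def h_def)
    from S_mcx[of "{..<m} - {q}" q] qm show "perm mc \<in> S" by (simp only: mcx_def mc_def) blast
  qed
  show ?thesis
    by (rule S_cong[OF S_comp[OF mem(2) S_comp[OF mem(1) S_comp[OF mem(3) S_comp[OF mem(1) mem(2)]]]] eq])
qed

lemma tr_in: assumes "a \<in> states m" "b \<in> states m" shows "level_swap a b \<in> S"
proof (cases "a = b")
  case True
  then have "level_swap a b = (\<lambda>\<psi>. \<psi>)" by (auto simp: level_swap_def)
  then show ?thesis using S_id by simp
next
  case False
  then obtain q where "a q \<noteq> b q" by blast
  moreover have "level_swap a b = level_swap b a" by (simp add: level_swap_def[abs_def] transpose_commute)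
  ultimately show ?thesis using tr_in_aux[of a b q] tr_in_aux[of b a q] assms by auto
qed

text \<open>NOTs on the zero bits of \<open>y\<close> exchange \<open>y\<close> with the all-ones
  state.\<close>

lemma lev_in:
  assumes z: "phase z {..<m} \<in> S" and y: "y \<in> states m" shows "level_phase z y \<in> S"
proof -
  let ?F = "{p. p < m \<and> \<not> y p}"
  have fl: "flip ?F \<in> S" by (intro flip_in) auto
  have "flip ?F (phase z {..<m} (flip ?F \<psi>)) x = level_phase z y \<psi> x" if x: "x \<in> states m" for \<psi> x
  proof -
    have "flip ?F (phase z {..<m} (flip ?F \<psi>)) x = (if \<forall>q<m. x q = y q then z else 1) * \<psi> (\<lambda>q. if q \<in> ?F then \<not> \<not> x q else x q)"
      unfolding flip_def phase_def diag_def perm_def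
      by (intro arg_cong2[where f="(*)"] if_cong arg_cong[of _ _ \<psi>]) (auto simp: fun_eq_iff)
    also have "(\<lambda>q. if q \<in> ?F then \<not> \<not> x q else x q) = x" by auto
    also have "(\<forall>q<m. x q = y q) \<longleftrightarrow> x = y"
    proof
      assume h: "\<forall>q<m. x q = y q"
      show "x = y"
      proof
        fix q show "x q = y q" using h x y by (cases "q < m") (auto simp: states_def)
      qed
    qed simp
    finally show ?thesis by (simp add: level_phase_def)
  qed
  from S_cong[OF S_comp[OF fl S_comp[OF z fl]] this] show ?thesis .
qed

lemma had_hadi: "had q (hadi q \<psi>) = \<psi>"
proof
  fix x show "had q (hadi q \<psi>) x = \<psi> x"
    by (cases "x q") (simp_all add: had_def hadi_def sgn_bit_def field_simps fun_upd_idem)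
qed

text \<open>On two levels, \<open>H' = S (H' S H'\<inverse>) S\<close>, and the factor in the middle is a conjugate by a gate of a
  one-level phase.\<close>
lemma h2_in:
  assumes m: "m > 0" and had: "had 0 \<in> S" "hadi 0 \<in> S" and i: "phase \<i> {..<m} \<in> S"
    and yz: "y \<in> states m" "z \<in> states m" "y \<noteq> z"
  shows "level_had y z \<in> S"
proof -
  define a where "a = (\<lambda>_::nat. False)"
  define b where "b = a(0 := True)"
  have st: "a \<in> states m" "b \<in> states m" using m by (auto simp: a_def b_def states_def)
  have ba: "b \<noteq> a" by (auto simp: a_def b_def fun_eq_iff)
  have "level_had a b \<psi> x = level_phase \<i> b (had 0 (level_phase \<i> b (hadi 0 (level_phase \<i> b \<psi>)))) x" for \<psi> x
  proof -
    define \<phi> where "\<phi> = level_phase \<i> b \<psi>"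
    have b0: "b 0" "\<not> a 0" "b(0 := False) = a" "b(0 := True) = b" "a(0 := False) = a" "a(0 := True) = b"
      by (auto simp: a_def b_def)
    consider "x = a" | "x = b" | "x \<noteq> a" "x \<noteq> b" by blast
    then show ?thesis
    proof cases
      \<comment> \<open>\<open>had 0\<close> mixes \<open>x\<close> only with its partner at qubit
        0. Outside \<open>a\<close> and \<open>b\<close> neither of them carries a phase, so
        \<open>had 0\<close> and \<open>hadi 0\<close> cancel.\<close>
      case 3
      have "x(0 := False) \<noteq> b" using b0(1) by auto
      moreover have "x(0 := True) \<noteq> b"
      proof
        assume "x(0 := True) = b"
        then have "x = b(0 := x 0)" by (simp flip: \<open>x(0 := True) = b\<close>)
        then show False using 3 b0 by (cases "x 0") auto
      qed
      ultimately have "had 0 (level_phase \<i> b (hadi 0 \<phi>)) x = had 0 (hadi 0 \<phi>) x" by (simp add: had_def level_phase_def)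
      then show ?thesis using 3 had_hadi by (simp add: \<phi>_def level_phase_def level_had_def)
    qed (use ba b0 in \<open>simp_all add: level_had_def level_phase_def had_def hadi_def sgn_bit_def field_simps\<close>)
  qed
  then have "level_had a b = (\<lambda>\<psi>. level_phase \<i> b (had 0 (level_phase \<i> b (hadi 0 (level_phase \<i> b \<psi>)))))" by (intro ext)
  moreover have l: "level_phase \<i> b \<in> S" by (rule lev_in[OF i st(2)])
  note S_comp[OF l S_comp[OF had(1) S_comp[OF l S_comp[OF had(2) l]]]]
  ultimately have base: "level_had a b \<in> S" by (simp only:)
  have "\<exists>p. level_had (p a) (p b) \<in> S \<and> p ` states m \<subseteq> states m \<and> inj p \<and> (\<forall>x\<in>{a,b}. p x = (if x = a then y else z))"
  proof (rule extend_by_transpositions)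
    fix p u v assume h: "level_had (p a) (p b) \<in> S" "u \<in> states m" "v \<in> states m"
    show "level_had ((transpose u v \<circ> p) a) ((transpose u v \<circ> p) b) \<in> S"
      unfolding comp_def h2_conj by (rule S_comp[OF tr_in[OF h(2,3)] S_comp[OF h(1) tr_in[OF h(2,3)]]])
  qed (use base st yz ba in \<open>auto simp: inj_on_def\<close>)
  then show ?thesis using ba by auto
qed

text \<open>\<open>H \<otimes> H\<close> is the product of the swap gate and the reflection in \<open>(1, -1, -1, -1) / 2\<close>; the latter is
  conjugate to a one-level sign.\<close>
lemma h4_in:
  assumes m: "m > 1" and hh: "hh 0 1 \<in> S" and neg: "phase (-1) {..<m} \<in> S"
    and X: "{y0,y1,y2,y3} \<subseteq> states m" and dist: "distinct [y0,y1,y2,y3]"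
  shows "level_hh y0 y1 y2 y3 \<in> S"
proof -
  define a where "a = (\<lambda>_::nat. False)"
  define b where "b = a(1 := True)"
  define c where "c = a(0 := True)"
  define d where "d = a(0 := True, 1 := True)"
  have st: "{a,b,c,d} \<subseteq> states m" using m by (auto simp: a_def b_def c_def d_def states_def)
  have v: "\<not> a 0" "\<not> a 1" "\<not> b 0" "b 1" "c 0" "\<not> c 1" "d 0" "d 1" by (auto simp: a_def b_def c_def d_def)
  then have ds: "a \<noteq> b" "a \<noteq> c" "a \<noteq> d" "b \<noteq> c" "b \<noteq> d" "c \<noteq> d" by auto
  have upd: "y(0 := False, 1 := False) = a" "y(0 := False, 1 := True) = b" "y(0 := True, 1 := False) = c" "y(0 := True, 1 := True) = d"
    if "y \<in> {a,b,c,d}" for y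
    using that by (auto simp: a_def b_def c_def d_def fun_eq_iff)
  have "level_hh a b c d \<psi> x = level_swap b c (level_phase (-1) a (hh 0 1 (level_phase (-1) a (hh 0 1 (level_phase (-1) a \<psi>))))) x" for \<psi> x
  proof -
    define \<phi> where "\<phi> = level_phase (-1) a \<psi>"
    have hhhh: "hh 0 1 (hh 0 1 \<phi>) = \<phi>"
    proof
      fix x :: bits
      show "hh 0 1 (hh 0 1 \<phi>) x = \<phi> x"
        by (cases "x 0"; cases "x 1") (simp_all add: hh_def sgn_bit_def fun_upd_idem fun_upd_twist[of "Suc 0" 0] field_simps)
    qed
    have out: "hh 0 1 (level_phase (-1) a (hh 0 1 \<phi>)) x = \<phi> x" if "x \<notin> {a,b,c,d}" for x
    proof -
      have "x(0 := s, 1 := t) \<noteq> a" for s t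
      proof
        assume "x(0 := s, 1 := t) = a"
        then have "x(0 := s, 1 := t, 0 := x 0, 1 := x 1) = a(0 := x 0, 1 := x 1)" by simp
        then have x: "x = a(0 := x 0, 1 := x 1)" by (simp add: fun_upd_twist[of 1 0])
        have "a(0 := s, 1 := t) \<in> {a,b,c,d}" for s t using upd[of a] by (cases s; cases t) simp_all
        from this[of "x 0" "x 1"] have "x \<in> {a,b,c,d}" by (simp only: x[symmetric])
        then show False using that by simp
      qed
      then have "hh 0 1 (level_phase (-1) a (hh 0 1 \<phi>)) x = hh 0 1 (hh 0 1 \<phi>) x" by (simp add: hh_def level_phase_def)
      then show ?thesis using hhhh by simp
    qed
    \<comment> \<open>The sign at \<open>a\<close>, conjugated by \<open>hh 0 1\<close>, is the
      reflection in (1, 1, 1, 1) / 2 on these four states. The outer signs at \<open>a\<close> turn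
      this vector into (1, -1, -1, -1) / 2 up to sign.\<close>
    have inside: "hh 0 1 (level_phase (-1) a (hh 0 1 \<phi>)) y = \<phi> y - (\<phi> a + \<phi> b + \<phi> c + \<phi> d) / 2" if "y \<in> {a,b,c,d}" for y
    proof -
      have gen: "hh 0 1 \<phi> y = 1/2 * (\<phi> a + sgn_bit (y 1) * \<phi> b + sgn_bit (y 0) * \<phi> c + sgn_bit (y 0) * sgn_bit (y 1) * \<phi> d)"
        if "y \<in> {a,b,c,d}" for \<phi> y unfolding hh_def upd[OF that] ..
      have hv: "hh 0 1 \<phi> a = (\<phi> a + \<phi> b + \<phi> c + \<phi> d) / 2" "hh 0 1 \<phi> b = (\<phi> a - \<phi> b + \<phi> c - \<phi> d) / 2"
        "hh 0 1 \<phi> c = (\<phi> a + \<phi> b - \<phi> c - \<phi> d) / 2" "hh 0 1 \<phi> d = (\<phi> a - \<phi> b - \<phi> c + \<phi> d) / 2" for \<phi>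
        using gen[of a \<phi>] gen[of b \<phi>] gen[of c \<phi>] gen[of d \<phi>] v by (simp_all add: sgn_bit_def)
      from that ds show ?thesis
        by (elim insertE) (simp_all add: level_phase_def hv field_simps del: One_nat_def)
    qed
    define \<chi> where "\<chi> = hh 0 1 (level_phase (-1) a (hh 0 1 \<phi>))"
    have \<phi>: "\<phi> a = - \<psi> a" "\<And>y. y \<noteq> a \<Longrightarrow> \<phi> y = \<psi> y" by (simp_all add: \<phi>_def level_phase_def)
    have \<chi>: "\<chi> y = \<phi> y - (\<phi> a + \<phi> b + \<phi> c + \<phi> d) / 2" if "y \<in> {a,b,c,d}" for y
      unfolding \<chi>_def by (rule inside[OF that])
    have "level_hh a b c d \<psi> x = level_swap b c (level_phase (-1) a \<chi>) x"
    proof (cases "x \<in> {a,b,c,d}")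
      case True
      have \<chi>v: "\<chi> a = \<phi> a - (\<phi> a + \<phi> b + \<phi> c + \<phi> d) / 2" "\<chi> b = \<phi> b - (\<phi> a + \<phi> b + \<phi> c + \<phi> d) / 2"
        "\<chi> c = \<phi> c - (\<phi> a + \<phi> b + \<phi> c + \<phi> d) / 2" "\<chi> d = \<phi> d - (\<phi> a + \<phi> b + \<phi> c + \<phi> d) / 2"
        by (rule \<chi>, simp)+
      from True ds show ?thesis
        by (elim insertE) (simp_all add: level_hh_def level_swap_def level_phase_def transpose_def \<phi> \<chi>v field_simps)
    next
      case False
      then have "\<chi> x = \<psi> x" using out \<phi>(2) by (simp add: \<chi>_def)
      with False show ?thesis by (simp add: level_hh_def level_swap_def level_phase_def transpose_def)
    qed
    then show ?thesis by (simp only: \<chi>_def \<phi>_def)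
  qed
  then have "level_hh a b c d = (\<lambda>\<psi>. level_swap b c (level_phase (-1) a (hh 0 1 (level_phase (-1) a (hh 0 1 (level_phase (-1) a \<psi>))))))" by (intro ext)
  moreover have l: "level_phase (-1) a \<in> S" "level_swap b c \<in> S" using lev_in[OF neg] tr_in st by auto
  note S_comp[OF l(2) S_comp[OF l(1) S_comp[OF hh S_comp[OF l(1) S_comp[OF hh l(1)]]]]]
  ultimately have base: "level_hh a b c d \<in> S" by (simp only:)
  have "\<exists>p. level_hh (p a) (p b) (p c) (p d) \<in> S \<and> p ` states m \<subseteq> states m \<and> inj p
     \<and> (\<forall>x\<in>{a,b,c,d}. p x = (if x = a then y0 else if x = b then y1 else if x = c then y2 else y3))"
  proof (rule extend_by_transpositions)
    fix p u v assume h: "level_hh (p a) (p b) (p c) (p d) \<in> S" "u \<in> states m" "v \<in> states m"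
    show "level_hh ((transpose u v \<circ> p) a) ((transpose u v \<circ> p) b) ((transpose u v \<circ> p) c) ((transpose u v \<circ> p) d) \<in> S"
      unfolding comp_def h4_conj by (rule S_comp[OF tr_in[OF h(2,3)] S_comp[OF h(1) tr_in[OF h(2,3)]]])
  qed (use base st X ds dist in \<open>auto simp: inj_on_def\<close>)
  then show ?thesis using ds by auto
qed

end

section \<open>Clifford and Toffoli operators\<close>

lemma phase_mult: "phase a A (phase b A \<psi>) = phase (a * b) A \<psi>"
  by (auto simp: phase_def diag_def fun_eq_iff)

lemma hadi_eq: "hadi q \<psi> = (\<lambda>x. (1 - \<i>) / 2 * (\<psi> (x(q := False)) + sgn_bit (x q) * \<psi> (x(q := True))))"
  by (auto simp: hadi_def had_def fun_eq_iff field_simps)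

context op_monoid
begin

lemma phase_pow: "phase z A \<in> S \<Longrightarrow> phase (z ^ j) A \<in> S"
proof (induction j)
  case 0
  have "phase (z ^ 0) A = (\<lambda>\<psi>. \<psi>)" by (auto simp: phase_def diag_def)
  then show ?case using S_id by simp
next
  case (Suc j)
  have "phase (z ^ Suc j) A = (\<lambda>\<psi>. phase z A (phase (z ^ j) A \<psi>))" by (auto simp: phase_mult)
  then show ?case using S_comp[OF Suc.prems Suc.IH[OF Suc.prems]] by simp
qed

text \<open>\<open>had q\<close> squares to \<open>\<i>\<close> and so has order eight; its seventh
  power is the inverse.\<close>

lemma hadi_in: assumes "had q \<in> S" shows "hadi q \<in> S"
proof -
  have sq: "had q (had q \<psi>) = (\<lambda>x. \<i> * \<psi> x)" for \<psi>
  proof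
    fix x show "had q (had q \<psi>) x = \<i> * \<psi> x"
      by (cases "x q") (simp_all add: had_def sgn_bit_def field_simps fun_upd_idem)
  qed
  have "hadi q = (\<lambda>\<psi>. had q (had q (had q (had q (had q (had q (had q \<psi>)))))))"
    unfolding sq by (auto simp: hadi_def had_def fun_eq_iff field_simps)
  then show ?thesis using S_comp[OF assms S_comp[OF assms S_comp[OF assms S_comp[OF assms S_comp[OF assms S_comp[OF assms assms]]]]]] by simp
qed

text \<open>\<open>H'\<close> conjugates X into Z, and where the controls fail it meets its
  inverse.\<close>

lemma conj_mcx_had:
  assumes "had c \<in> S" "mcx A c \<in> S" "c \<notin> A"
  shows "phase (-1) (insert c A) \<in> S"
proof -
  have "phase (-1) (insert c A) = (\<lambda>\<psi>. had c (mcx A c (hadi c \<psi>)))"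
  proof (intro ext)
    fix \<psi> :: "bits \<Rightarrow> complex" and x
    show "phase (-1) (insert c A) \<psi> x = had c (mcx A c (hadi c \<psi>)) x"
      using assms(3) by (cases "all_set A x"; cases "x c")
        (simp_all add: phase_insert_apply had_def hadi_eq mcx_apply sgn_bit_def field_simps all_set_upd fun_upd_idem)
  qed
  then show ?thesis using S_comp[OF assms(1) S_comp[OF assms(2) hadi_in[OF assms(1)]]] by simp
qed

lemma conj_phase_had:
  assumes "had c \<in> S" "phase (-1) (insert c A) \<in> S" "c \<notin> A"
  shows "mcx A c \<in> S"
proof -
  have "mcx A c = (\<lambda>\<psi>. had c (phase (-1) (insert c A) (hadi c \<psi>)))"
  proof (intro ext)
    fix \<psi> :: "bits \<Rightarrow> complex" and x
    show "mcx A c \<psi> x = had c (phase (-1) (insert c A) (hadi c \<psi>)) x"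
      using assms(3) by (cases "all_set A x"; cases "x c")
        (simp_all add: phase_insert_apply had_def hadi_eq mcx_apply sgn_bit_def field_simps all_set_upd fun_upd_idem)
  qed
  then show ?thesis using S_comp[OF assms(1) S_comp[OF assms(2) hadi_in[OF assms(1)]]] by simp
qed

end

locale clifford_toffoli = toffoli_ops S N for S N +
  assumes S_had: "q < N \<Longrightarrow> had q \<in> S"
    and S_S: "q < N \<Longrightarrow> phase \<i> {q} \<in> S"
begin

text \<open>\<open>\<i>\<close> to the power \<open>(r \<oplus> p q) - r\<close> is \<open>\<i>\<close> to the power \<open>p q\<close>, up to the sign \<open>(-1)^(p q r)\<close>.\<close>
lemma cs_in:
  assumes "p < N" "q < N" "r < N" "distinct [p,q,r]"
  shows "phase \<i> {p,q} \<in> S"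
proof -
  have 1: "mcx {p,q} r \<in> S" using S_CCX assms by simp
  have 2: "phase (-1) {r,p,q} \<in> S" using conj_mcx_had[OF S_had 1] assms by simp
  have 3: "phase \<i> {r} \<in> S" "phase (\<i> ^ 3) {r} \<in> S" using S_S phase_pow assms by simp_all
  have i3: "\<i> ^ 3 = - \<i>" by (simp add: power3_eq_cube)
  have "phase \<i> {p,q} = (\<lambda>\<psi>. mcx {p,q} r (phase \<i> {r} (mcx {p,q} r (phase (\<i> ^ 3) {r} (phase (-1) {r,p,q} \<psi>)))))"
  proof (intro ext)
    fix \<psi> :: "bits \<Rightarrow> complex" and x
    show "phase \<i> {p,q} \<psi> x = mcx {p,q} r (phase \<i> {r} (mcx {p,q} r (phase (\<i> ^ 3) {r} (phase (-1) {r,p,q} \<psi>)))) x"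
      unfolding i3 using assms(4) by (cases "x p"; cases "x q"; cases "x r")
        (simp_all add: phase_def diag_def mcx_def perm_def fun_upd_idem)
  qed
  then show ?thesis using S_comp[OF 1 S_comp[OF 3(1) S_comp[OF 1 S_comp[OF 3(2) 2]]]] by simp
qed

end

section \<open>A clean ancilla\<close>

definition pad :: "nat \<Rightarrow> bits op" where
  "pad m \<psi> = (\<lambda>x. if x \<in> states m then \<psi> x else 0)"

text \<open>\<open>P\<close> acts on the larger register, returns a clean ancilla clean, and
  meanwhile performs \<open>Q\<close> on the first \<open>m\<close> qubits. Nothing is asked of
  \<open>P\<close> when the ancilla is not clean.\<close>

definition lift :: "nat \<Rightarrow> bits op set \<Rightarrow> bits op set" where
  "lift m S = {Q. \<exists>P\<in>S. \<forall>\<psi>. P (pad m \<psi>) = pad m (Q \<psi>)}"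

lemma liftI: "P \<in> S \<Longrightarrow> (\<And>\<psi>. P (pad m \<psi>) = pad m (Q \<psi>)) \<Longrightarrow> Q \<in> lift m S"
  unfolding lift_def by blast

lemma liftE:
  assumes "Q \<in> lift m S" obtains P where "P \<in> S" "\<And>\<psi>. P (pad m \<psi>) = pad m (Q \<psi>)"
  using assms unfolding lift_def by blast

lemma states_upd [simp]: "q < m \<Longrightarrow> x(q := b) \<in> states m \<longleftrightarrow> x \<in> states m"
  by (auto simp: states_def)

context toffoli_ops
begin

text \<open>Qubit \<open>m\<close> is the borrowed qubit of \<open>mcx_borrow\<close>; as it is
  restored, a clean ancilla stays clean.\<close>

lemma register_lift:
  assumes N: "N = Suc m" shows "register (lift m S) m"
proof
  show "(\<lambda>\<psi>. \<psi>) \<in> lift m S" by (rule liftI[OF S_id]) simp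
  fix P Q assume P: "P \<in> lift m S"
  { fix \<psi>'
    assume Q: "Q \<in> lift m S"
    obtain P' where P': "P' \<in> S" "\<And>\<psi>. P' (pad m \<psi>) = pad m (P \<psi>)" using P by (rule liftE) auto
    obtain Q' where Q': "Q' \<in> S" "\<And>\<psi>. Q' (pad m \<psi>) = pad m (Q \<psi>)" using Q by (rule liftE) auto
    show "(\<lambda>\<psi>. P (Q \<psi>)) \<in> lift m S"
      by (rule liftI[OF S_comp[OF P'(1) Q'(1)]]) (simp add: P' Q') }
  { assume eq: "\<And>\<psi> x. x \<in> states m \<Longrightarrow> P \<psi> x = Q \<psi> x"
    obtain P' where P': "P' \<in> S" "\<And>\<psi>. P' (pad m \<psi>) = pad m (P \<psi>)" using P by (rule liftE) auto
    show "Q \<in> lift m S"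
    proof (rule liftI[OF P'(1)])
      fix \<psi> show "P' (pad m \<psi>) = pad m (Q \<psi>)" unfolding P'(2) using eq by (auto simp: pad_def)
    qed }
next
  fix A t assume A: "A \<subseteq> {..<m}" "t < m" "t \<notin> A"
  have "mcx A t \<in> S"
    by (rule mcx_borrow[of A t m]) (use A N in \<open>auto intro: finite_subset\<close>)
  then show "mcx A t \<in> lift m S"
    by (rule liftI) (use A in \<open>auto simp: mcx_def perm_def pad_def\<close>)
qed

end

lemma lift_had: "had q \<in> S \<Longrightarrow> q < m \<Longrightarrow> had q \<in> lift m S"
  by (erule liftI) (auto simp: had_def pad_def)

lemma lift_hadi: "hadi q \<in> S \<Longrightarrow> q < m \<Longrightarrow> hadi q \<in> lift m S"
  by (erule liftI) (auto simp: hadi_eq pad_def)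

lemma lift_hh: "hh p q \<in> S \<Longrightarrow> p < m \<Longrightarrow> q < m \<Longrightarrow> hh p q \<in> lift m S"
  by (erule liftI) (auto simp: hh_def pad_def)

lemma lift_phase: "phase z A \<in> S \<Longrightarrow> phase z A \<in> lift m S"
  by (erule liftI) (auto simp: phase_def diag_def pad_def)

lemma (in toffoli_ops) neg_phase_hh:
  assumes N: "N = Suc m" and m: "m \<ge> 1" and hh: "hh (m - 1) m \<in> S"
  shows "phase (-1) {..<m} \<in> lift m S"
proof -
  obtain l where ml: "m = Suc l" using m by (cases m) auto
  have 1: "mcx {..<l} l \<in> S" by (rule mcx_borrow[of _ _ m]) (use N ml in auto)
  have hh': "hh l m \<in> S" using hh ml by simp
  have "phase (-1) {..<m} = (\<lambda>\<psi>. hh l m (mcx {..<l} l (hh l m \<psi>)))"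
  proof (intro ext)
    fix \<psi> :: "bits \<Rightarrow> complex" and x
    have lm: "l \<noteq> m" "m \<notin> {..<l}" "l \<notin> {..<l}" using ml by auto
    have ins: "{..<m} = insert l {..<l}" using ml by auto
    define A where "A = {..<l}"
    show "phase (-1) {..<m} \<psi> x = hh l m (mcx {..<l} l (hh l m \<psi>)) x"
      unfolding ins using lm unfolding A_def[symmetric] by (cases "all_set A x"; cases "x l"; cases "x m")
        (simp_all add: phase_insert_apply hh_def mcx_apply sgn_bit_def field_simps fun_upd_twist[of m l] all_set_upd fun_upd_idem)
  qed
  then have "phase (-1) {..<m} \<in> S" using S_comp[OF hh' S_comp[OF 1 hh']] by simp
  then show ?thesis by (rule lift_phase)
qed

context clifford_toffoli
begin

text \<open>A multiply controlled \<open>X\<close> on all \<open>m + 1\<close> qubits has determinant -1 and is out of reach for large \<open>m\<close>, but the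
  commutator \<open>W\<close> of a controlled \<open>Z\<close> and a controlled square root of \<open>X\<close> is the multiply controlled
  \<open>\<i> X\<close>. Conjugation of the phase of the ancilla by \<open>W\<close> (whose inverse is \<open>W\<^sup>3\<close> when all controls are set)
  gives the multiply controlled phase on a clean ancilla.\<close>
lemma full_phase:
  assumes N: "N = Suc m" and m: "m \<ge> 1" and z: "\<And>q. q < N \<Longrightarrow> phase z {q} \<in> S"
  shows "phase z {..<m} \<in> lift m S"
proof (cases "m = 1")
  case True
  then have "{..<m} = {0}" by auto
  then show ?thesis using lift_phase[OF z[of 0]] N by simp
next
  case False
  define l where "l = m - 1"
  define A where "A = {..<m - 1}"
  have lm: "l \<noteq> m" "m \<notin> A" "l \<notin> A" "l < m" "finite A" using m by (auto simp: l_def A_def)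
  have AN: "A \<subseteq> {..<N}" using N by (auto simp: A_def)
  have "mcx A m \<in> S" by (rule mcx_borrow[of _ _ l]) (use N lm AN in auto)
  then have cz: "phase (-1) (insert m A) \<in> S" using conj_mcx_had S_had N lm by simp
  \<comment> \<open>As \<open>m\<close> is at least 2 here, qubit 0 differs from \<open>l\<close>
    and \<open>m\<close> and can serve as the third qubit.\<close>
  have cs: "phase \<i> {l,m} \<in> S" by (rule cs_in[of _ _ 0]) (use N m False in \<open>auto simp: l_def\<close>)
  have cs3: "phase (\<i> ^ 3) {l,m} \<in> S" by (rule phase_pow[OF cs])
  have hd: "had m \<in> S" "hadi m \<in> S" using S_had[of m] hadi_in N by auto
  have i3: "\<i> ^ 3 = - \<i>" by (simp add: power3_eq_cube)
  \<comment> \<open>\<open>H'\<close> conjugates S into a square root of X: here with control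
    \<open>l\<close> and the ancilla as target.\<close>
  define cv where "cv = (\<lambda>\<psi>. had m (phase \<i> {l,m} (hadi m \<psi>)))"
  define cvi where "cvi = (\<lambda>\<psi>. had m (phase (\<i> ^ 3) {l,m} (hadi m \<psi>)))"
  define W where "W = (\<lambda>\<psi>. phase (-1) (insert m A) (cv (phase (-1) (insert m A) (cvi \<psi>))))"
  have cvS: "cv \<in> S" unfolding cv_def by (rule S_comp[OF hd(1) S_comp[OF cs hd(2)]])
  have cviS: "cvi \<in> S" unfolding cvi_def by (rule S_comp[OF hd(1) S_comp[OF cs3 hd(2)]])
  have WS: "W \<in> S" unfolding W_def by (rule S_comp[OF cz S_comp[OF cvS S_comp[OF cz cviS]]])
  have cv: "cv \<psi> x = (if x l then (1 + \<i>) / 2 * \<psi> x + (1 - \<i>) / 2 * \<psi> (x(m := \<not> x m)) else \<psi> x)" for \<psi> x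
    using lm(1) by (cases "x l"; cases "x m")
      (simp_all add: cv_def phase_def diag_def had_def hadi_eq sgn_bit_def field_simps fun_upd_idem)
  have cvi: "cvi \<psi> x = (if x l then (1 - \<i>) / 2 * \<psi> x + (1 + \<i>) / 2 * \<psi> (x(m := \<not> x m)) else \<psi> x)" for \<psi> x
    unfolding cvi_def i3 using lm(1) by (cases "x l"; cases "x m")
      (simp_all add: phase_def diag_def had_def hadi_eq sgn_bit_def field_simps fun_upd_idem)
  define K where "K = all_set A"
  have K: "K (x(m := b)) \<longleftrightarrow> K x" for x b unfolding K_def by (rule all_set_upd[OF lm(2)])
  have cz': "phase (-1) (insert m A) \<psi> x = (if x m \<and> K x then - \<psi> x else \<psi> x)" for \<psi> x
    by (simp add: phase_insert_apply K_def)
  have all: "(\<forall>q\<in>{..<m}. x q) \<longleftrightarrow> x l \<and> K x" for x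
  proof -
    have "{..<m} = insert l A" using m by (auto simp: l_def A_def)
    then show ?thesis by (simp add: K_def all_set_def)
  qed
  have W: "W \<psi> x = (if x l \<and> K x then \<i> * \<psi> (x(m := \<not> x m)) else \<psi> x)" for \<psi> x
    unfolding W_def cz' cv cvi using lm(1)
    by (cases "x l"; cases "x m"; cases "K x") (simp_all add: K field_simps fun_upd_idem)
  \<comment> \<open>If all controls are set, \<open>W\<close> raises the ancilla to 1, the phase
    takes effect and the remaining factors lower it. Otherwise \<open>W\<close> is the identity and
    the phase meets an ancilla in 0; here cleanness is essential.\<close>
  have "(\<lambda>\<psi>. W (W (W (phase z {m} (W \<psi>))))) \<in> S"
    by (rule S_comp[OF WS S_comp[OF WS S_comp[OF WS S_comp[OF z WS]]]]) (simp add: N)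
  then show ?thesis
  proof (rule liftI)
    fix \<psi>
    show "W (W (W (phase z {m} (W (pad m \<psi>))))) = pad m (phase z {..<m} \<psi>)"
    proof
      fix x
      have zm: "phase z {m} \<phi> x = (if x m then z else 1) * \<phi> x" for \<phi> x by (simp add: phase_def diag_def)
      have za: "phase z {..<m} \<phi> x = (if x l \<and> K x then z else 1) * \<phi> x" for \<phi> x
        unfolding phase_def diag_def all ..
      have iz: "\<i> * (z * (\<i> * y)) = - (z * y)" for y
      proof -
        have "\<i> * (z * (\<i> * y)) = (\<i> * \<i>) * (z * y)" by (simp only: mult_ac)
        then show ?thesis by simp
      qed
      have nm: "x \<in> states m \<Longrightarrow> \<not> x m" by (simp add: states_def)
      show "W (W (W (phase z {m} (W (pad m \<psi>))))) x = pad m (phase z {..<m} \<psi>) x"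
        unfolding W zm using lm(1) nm
        by (cases "x l \<and> K x"; cases "x m") (auto simp: K pad_def za iz fun_upd_idem)
    qed
  qed
qed

end

section \<open>Clifford+T\<close>

text \<open>For n = 8 neither X nor the Toffoli gate is given; both are recovered from
  \<open>H'\<close>, CX and T.\<close>

locale clifford_T = op_monoid S for S +
  fixes N :: nat and w :: complex
  assumes S_had: "q < N \<Longrightarrow> had q \<in> S"
    and S_CX: "c < N \<Longrightarrow> t < N \<Longrightarrow> c \<noteq> t \<Longrightarrow> mcx {c} t \<in> S"
    and S_T: "q < N \<Longrightarrow> phase w {q} \<in> S"
    and w: "w ^ 2 = \<i>"
begin

text \<open>One CX writes the parity into \<open>b\<close>, the phase is applied there, and a second
  CX restores \<open>b\<close>.\<close>

lemma parity2: "a < N \<Longrightarrow> b < N \<Longrightarrow> a \<noteq> b \<Longrightarrow> diag (\<lambda>x. if x a \<noteq> x b then w ^ j else 1) \<in> S"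
proof -
  assume ab: "a < N" "b < N" "a \<noteq> b"
  have "diag (\<lambda>x. if x a \<noteq> x b then w ^ j else 1) = (\<lambda>\<psi>. mcx {a} b (phase (w ^ j) {b} (mcx {a} b \<psi>)))"
  proof (intro ext)
    fix \<psi> :: "bits \<Rightarrow> complex" and x
    show "diag (\<lambda>x. if x a \<noteq> x b then w ^ j else 1) \<psi> x = mcx {a} b (phase (w ^ j) {b} (mcx {a} b \<psi>)) x"
      using ab(3) by (cases "x a"; cases "x b") (simp_all add: diag_def mcx_def perm_def phase_def fun_upd_idem)
  qed
  then show ?thesis using S_comp[OF S_CX S_comp[OF phase_pow[OF S_T] S_CX]] ab by simp
qed

lemma parity3:
  assumes "a < N" "b < N" "c < N" "distinct [a,b,c]"
  shows "diag (\<lambda>x. if (x a \<noteq> x b) \<noteq> x c then w ^ j else 1) \<in> S"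
proof -
  let ?D = "diag (\<lambda>x. if x b \<noteq> x c then w ^ j else 1)"
  have "diag (\<lambda>x. if (x a \<noteq> x b) \<noteq> x c then w ^ j else 1) = (\<lambda>\<psi>. mcx {a} b (?D (mcx {a} b \<psi>)))"
  proof (intro ext)
    fix \<psi> :: "bits \<Rightarrow> complex" and x
    show "diag (\<lambda>x. if (x a \<noteq> x b) \<noteq> x c then w ^ j else 1) \<psi> x = mcx {a} b (?D (mcx {a} b \<psi>)) x"
      using assms(4) by (cases "x a"; cases "x b"; cases "x c") (simp_all add: diag_def mcx_def perm_def fun_upd_idem)
  qed
  then show ?thesis using S_comp[OF S_CX S_comp[OF parity2 S_CX]] assms by simp
qed

text \<open>\<open>4 a b c = a + b + c - (a \<oplus> b) - (a \<oplus> c) - (b \<oplus> c) + (a \<oplus> b \<oplus> c)\<close>, and \<open>w^7\<close> is the inverse of \<open>w\<close>.\<close>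
lemma ccz_in:
  assumes "a < N" "b < N" "c < N" "distinct [a,b,c]"
  shows "phase (-1) {c,a,b} \<in> S"
proof -
  let ?D = "\<lambda>a b. diag (\<lambda>x. if x a \<noteq> x b then w ^ 7 else 1)"
  let ?E = "diag (\<lambda>x. if (x a \<noteq> x b) \<noteq> x c then w ^ 1 else 1)"
  have w4: "w ^ 4 = -1" using w by (metis i_squared numeral_Bit0 power2_eq_square power_add)
  have w8: "w ^ 8 = 1"
  proof -
    have "w ^ 8 = w ^ 4 * w ^ 4" by (simp flip: power_add)
    then show ?thesis using w4 by simp
  qed
  have "w ^ 16 = w ^ 8 * w ^ 8" by (simp flip: power_add)
  then have w16: "w ^ 16 = 1" using w8 by simp
  have "phase (-1) {c,a,b} = (\<lambda>\<psi>. phase w {a} (phase w {b} (phase w {c} (?D a b (?D a c (?D b c (?E \<psi>)))))))"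
  proof (intro ext)
    fix \<psi> :: "bits \<Rightarrow> complex" and x
    have m1: "w * (w * (w * (w * y))) = - y" for y
      using w4 by (metis mult.assoc mult_minus1 power4_eq_xxxx)
    have m2: "w * (w * (w ^ 7 * (w ^ 7 * y))) = y" for y
    proof -
      have "w * (w * (w ^ 7 * (w ^ 7 * y))) = w ^ 16 * y" by (simp add: eval_nat_numeral algebra_simps)
      then show ?thesis using w16 by simp
    qed
    have m4: "w * (w * w ^ 14) = 1" "w * (w ^ 14 * w) = 1" using w16 by (simp_all add: eval_nat_numeral algebra_simps)
    have m3: "w * (w ^ 7 * (w ^ 7 * (w * y))) = y" for y using m2[of y] by (simp add: algebra_simps)
    show "phase (-1) {c,a,b} \<psi> x = phase w {a} (phase w {b} (phase w {c} (?D a b (?D a c (?D b c (?E \<psi>)))))) x"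
      by (cases "x a"; cases "x b"; cases "x c") (simp_all add: phase_def diag_def m1 m2 m3 m4)
  qed
  then show ?thesis
    using S_comp[OF S_T[of a] S_comp[OF S_T[of b] S_comp[OF S_T[of c] S_comp[OF parity2[of a b 7] S_comp[OF parity2[of a c 7]
      S_comp[OF parity2[of b c 7] parity3[of a b c 1]]]]]]] assms by simp
qed

lemma clifford_toffoli: "clifford_toffoli S N"
proof
  fix q assume q: "q < N"
  show had: "had q \<in> S" by (rule S_had[OF q])
  show "phase \<i> {q} \<in> S" using phase_pow[OF S_T[OF q], of 2] w by simp
  have "w ^ 4 = -1" using w by (metis i_squared numeral_Bit0 power2_eq_square power_add)
  then have "phase (-1) {q} \<in> S" using phase_pow[OF S_T[OF q], of 4] by simp
  then show "mcx {} q \<in> S" using conj_phase_had[OF had, of "{}"] by simp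
next
  fix a b t assume h: "a < N" "b < N" "t < N" "distinct [a,b,t]"
  then show "mcx {a,b} t \<in> S" using conj_phase_had[OF S_had ccz_in[OF h]] by auto
qed (rule S_CX)

end

section \<open>Representing unitary families\<close>

text \<open>\<open>u y x\<close> is the entry in column \<open>y\<close> and row \<open>x\<close>.\<close>
definition unitary_family :: "nat \<Rightarrow> nat \<Rightarrow> (bits \<Rightarrow> bits \<Rightarrow> complex) \<Rightarrow> bool" where
  "unitary_family n m u \<longleftrightarrow>
     (\<forall>y\<in>states m. (\<forall>x. x \<notin> states m \<longrightarrow> u y x = 0) \<and> (\<forall>x. u y x \<in> Zhalf_zeta n)) \<and>
     (\<forall>y\<in>states m. \<forall>z\<in>states m. inner_on (states m) (u y) (u z) = (if y = z then 1 else 0))"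

definition represents_family :: "complex mat set \<Rightarrow> nat \<Rightarrow> nat \<Rightarrow> (bits \<Rightarrow> bits \<Rightarrow> complex) \<Rightarrow> bool" where
  "represents_family \<G> m a u \<longleftrightarrow> (\<exists>P\<in>ops (m + a) \<G>. \<forall>y\<in>states m. \<forall>x\<in>states (m + a). P (ket y) x = u y x)"

lemma synthesis_represents:
  assumes "synthesis n (states m) (lift m (ops (Suc m) \<G>))" and u: "unitary_family n m u"
  shows "represents_family \<G> m 1 u"
proof -
  interpret synthesis n "states m" "lift m (ops (Suc m) \<G>)" by fact
  have "\<exists>Q\<in>lift m (ops (Suc m) \<G>). \<forall>y\<in>states m. Q (ket y) = u y"
    using u by (intro synthesize) (auto simp: unitary_family_def admissible_def)
  then obtain Q where Q: "Q \<in> lift m (ops (Suc m) \<G>)" "\<And>y. y \<in> states m \<Longrightarrow> Q (ket y) = u y" by blast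
  obtain P where P: "P \<in> ops (Suc m) \<G>" "\<And>\<psi>. P (pad m \<psi>) = pad m (Q \<psi>)" using Q(1) by (rule liftE) auto
  have "P (ket y) = u y" if "y \<in> states m" for y
  proof -
    have "pad m (ket y) = ket y" using that by (auto simp: pad_def ket_def)
    then have "P (ket y) = pad m (u y)" using P(2)[of "ket y"] Q(2)[OF that] by simp
    also have "\<dots> = u y" using u that by (auto simp: pad_def unitary_family_def)
    finally show ?thesis .
  qed
  then show ?thesis unfolding represents_family_def by (intro bexI[of _ P]) (use P in auto)
qed

lemma synthesis_2:
  assumes m: "m \<ge> 1" and \<G>: "\<G> = gate_set 2"
  shows "synthesis 2 (states m) (lift m (ops (Suc m) \<G>))"
proof -
  have g: "Xgate \<in> \<G>" "CXgate \<in> \<G>" "CCXgate \<in> \<G>" "HHgate \<in> \<G>" by (simp_all add: \<G> gate_set_def)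
  interpret toffoli_ops "ops (Suc m) \<G>" "Suc m"
    by unfold_locales (auto intro: ops_id ops_comp X_op[OF g(1)] CX_op[OF g(2)] CCX_op[OF g(3)])
  interpret R: register "lift m (ops (Suc m) \<G>)" m by (rule register_lift) simp
  have neg: "phase (-1) {..<m} \<in> lift m (ops (Suc m) \<G>)"
    by (rule neg_phase_hh) (use m hh_op[OF g(4)] in auto)
  show ?thesis
  proof
    show "(\<lambda>\<psi>. \<psi>) \<in> lift m (ops (Suc m) \<G>)" by (rule R.S_id)
    show "P \<in> lift m (ops (Suc m) \<G>) \<Longrightarrow> Q \<in> lift m (ops (Suc m) \<G>) \<Longrightarrow> (\<lambda>\<psi>. P (Q \<psi>)) \<in> lift m (ops (Suc m) \<G>)" for P Q
      by (rule R.S_comp)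
    show "(2::nat) \<in> {2,4,8}" "finite (states m)" by (simp_all add: finite_card_states)
    show "y \<in> states m \<Longrightarrow> level_phase (zeta 2) y \<in> lift m (ops (Suc m) \<G>)" for y
      unfolding zeta_2 by (rule R.lev_in[OF neg])
    fix a b c d :: bits assume X: "{a,b,c,d} \<subseteq> states m" and d: "distinct [a,b,c,d]"
    \<comment> \<open>Four distinct levels force a second qubit, which \<open>hh 0 1\<close>
      requires; for \<open>m = 1\<close> the demand is vacuous.\<close>
    have "card {a,b,c,d} \<le> card (states m)" using X by (intro card_mono finite_card_states)
    moreover have "card {a,b,c,d} = 4" using d by auto
    ultimately have "(4::nat) \<le> 2 ^ m" by (simp add: finite_card_states)
    then have m1: "m > 1" using m by (cases "m = 1") auto
    have "hh 0 1 \<in> lift m (ops (Suc m) \<G>)" using m1 by (intro lift_hh hh_op[OF g(4)]) auto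
    then show "level_hh a b c d \<in> lift m (ops (Suc m) \<G>)" using R.h4_in[OF m1 _ neg X d] by simp
  qed (auto intro: R.tr_in)
qed

lemma synthesis_clifford:
  assumes m: "m \<ge> 1" and n: "n \<in> {4,8}" and c: "clifford_toffoli (ops (Suc m) \<G>) (Suc m)"
    and z: "\<And>q. q < Suc m \<Longrightarrow> phase (zeta n) {q} \<in> ops (Suc m) \<G>"
  shows "synthesis n (states m) (lift m (ops (Suc m) \<G>))"
proof -
  interpret clifford_toffoli "ops (Suc m) \<G>" "Suc m" by fact
  interpret R: register "lift m (ops (Suc m) \<G>)" m by (rule register_lift) simp
  have full: "phase (zeta n) {..<m} \<in> lift m (ops (Suc m) \<G>)" "phase \<i> {..<m} \<in> lift m (ops (Suc m) \<G>)"
    using full_phase[OF refl m] z S_S by auto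
  have had: "had 0 \<in> lift m (ops (Suc m) \<G>)" "hadi 0 \<in> lift m (ops (Suc m) \<G>)"
    using m S_had[of 0] by (auto intro!: lift_had lift_hadi hadi_in)
  show ?thesis
  proof
    show "(\<lambda>\<psi>. \<psi>) \<in> lift m (ops (Suc m) \<G>)" by (rule R.S_id)
    show "P \<in> lift m (ops (Suc m) \<G>) \<Longrightarrow> Q \<in> lift m (ops (Suc m) \<G>) \<Longrightarrow> (\<lambda>\<psi>. P (Q \<psi>)) \<in> lift m (ops (Suc m) \<G>)" for P Q
      by (rule R.S_comp)
    show "n \<in> {2,4,8}" "finite (states m)" using n by (auto simp: finite_card_states)
    show "y \<in> states m \<Longrightarrow> level_phase (zeta n) y \<in> lift m (ops (Suc m) \<G>)" for y
      by (rule R.lev_in[OF full(1)])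
    show "y \<in> states m \<Longrightarrow> z \<in> states m \<Longrightarrow> y \<noteq> z \<Longrightarrow> level_had y z \<in> lift m (ops (Suc m) \<G>)" for y z
      by (rule R.h2_in[OF _ had full(2)]) (use m in auto)
  qed (use n in \<open>auto intro: R.tr_in\<close>)
qed

lemma represents_base:
  assumes m: "m \<ge> 1" and n: "n \<in> {2,4,8}" and u: "unitary_family n m u"
  shows "represents_family (gate_set n) m 1 u"
proof -
  consider "n = 2" | "n = 4" | "n = 8" using n by auto
  then show ?thesis
  proof cases
    case 1
    then show ?thesis using synthesis_represents[OF synthesis_2[OF m refl]] u by simp
  next
    case 2
    have g: "Xgate \<in> gate_set 4" "CXgate \<in> gate_set 4" "CCXgate \<in> gate_set 4" "Sgate \<in> gate_set 4" "H' \<in> gate_set 4"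
      by (simp_all add: gate_set_def)
    have c: "clifford_toffoli (ops (Suc m) (gate_set 4)) (Suc m)"
      by unfold_locales (auto intro: ops_id ops_comp X_op[OF g(1)] CX_op[OF g(2)] CCX_op[OF g(3)] S_op[OF g(4)] had_op[OF g(5)])
    have "synthesis 4 (states m) (lift m (ops (Suc m) (gate_set 4)))"
      by (rule synthesis_clifford[OF m _ c]) (auto simp: zeta_4 intro: S_op[OF g(4)])
    then show ?thesis using synthesis_represents u 2 by blast
  next
    case 3
    have g: "H' \<in> gate_set 8" "CXgate \<in> gate_set 8" "Tgate 8 \<in> gate_set 8" by (simp_all add: gate_set_def)
    have "clifford_T (ops (Suc m) (gate_set 8)) (Suc m) (zeta 8)"
      by unfold_locales (auto intro: ops_id ops_comp CX_op[OF g(2)] T_op[OF g(3)] had_op[OF g(1)] simp: power2_eq_square zeta_8_sq)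
    then have c: "clifford_toffoli (ops (Suc m) (gate_set 8)) (Suc m)" by (rule clifford_T.clifford_toffoli)
    have "synthesis 8 (states m) (lift m (ops (Suc m) (gate_set 8)))"
      by (rule synthesis_clifford[OF m _ c]) (auto intro: T_op[OF g(3)])
    then show ?thesis using synthesis_represents u 3 by blast
  qed
qed

section \<open>Catalytic embedding\<close>

lemma circuits_simulate:
  assumes G: "\<And>G qs. G \<in> \<G> \<Longrightarrow> G \<in> carrier_mat (2 ^ length qs) (2 ^ length qs) \<Longrightarrow> distinct qs \<Longrightarrow> set qs \<subseteq> {..<N}
       \<Longrightarrow> gate_op G qs \<in> ops N \<G>'"
    and M: "M \<in> circuits N \<G>"
  shows "\<exists>P\<in>ops N \<G>'. realizes N M P"
  using M
proof (induction rule: circuits.induct)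
  case empty
  show ?case by (rule bexI[of _ "\<lambda>\<psi>. \<psi>"]) (rule realizes_one ops_id)+
next
  case (step C G qs)
  then obtain P where P: "P \<in> ops N \<G>'" "realizes N C P" by blast
  have "realizes N (embed_gate N G qs * C) (\<lambda>\<psi>. gate_op G qs (P \<psi>))"
    by (rule realizes_mult[OF embed_carrier realizes_gate circuits_carrier P(2)]) (use step in auto)
  moreover have "(\<lambda>\<psi>. gate_op G qs (P \<psi>)) \<in> ops N \<G>'"
    by (rule ops_comp[OF G P(1)]) (use step in auto)
  ultimately show ?case by (rule bexI[of _ "\<lambda>\<psi>. gate_op G qs (P \<psi>)"])
qed

lemma gate_op_Tgate: "gate_op (Tgate n) [q] = phase (zeta n) {q}"
  by (auto simp: gate_op_simps Tgate_def phase_def diag_def fun_upd_idem fun_eq_iff)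

text \<open>From n = 8 on the gate sets differ only in T, and \<open>Tgate n\<close> is the square
  of \<open>Tgate (2 * n)\<close>. Below 8 they have a different shape.\<close>

lemma represents_double:
  assumes n: "n \<ge> 8" and rep: "represents_family (gate_set n) m a u"
  shows "represents_family (gate_set (2 * n)) m a u"
proof -
  let ?G = "gate_set n" and ?G' = "gate_set (2 * n)" and ?N = "m + a"
  have sim: "gate_op G qs \<in> ops ?N ?G'"
    if h: "G \<in> ?G" "G \<in> carrier_mat (2 ^ length qs) (2 ^ length qs)" "distinct qs" "set qs \<subseteq> {..<?N}" for G qs
  proof (cases "G = Tgate n")
    case True
    have "dim_row G = 2 ^ length qs" using h(2) by (rule carrier_matD)
    moreover have "dim_row G = 2" by (simp add: True Tgate_def)
    ultimately have "(2::nat) ^ length qs = 2 ^ 1" by (simp only: power_one_right)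
    then have "length qs = 1" using power_inject_exp[of "2::nat" "length qs" 1] by simp
    then obtain q where q: "qs = [q]" by (auto simp: length_Suc_conv)
    have "phase (zeta (2 * n)) {q} \<in> ops ?N ?G'" by (rule T_op) (use h q n in \<open>auto simp: gate_set_def\<close>)
    from ops_comp[OF this this] show ?thesis unfolding True q gate_op_Tgate phase_mult zeta_sq .
  next
    case False
    then have "G \<in> ?G'" using h(1) n by (auto simp: gate_set_def)
    then show ?thesis by (rule gate_in_ops[OF _ h(2-4)]) simp
  qed
  obtain P where P: "P \<in> ops ?N ?G" "\<forall>y\<in>states m. \<forall>x\<in>states ?N. P (ket y) x = u y x"
    using rep unfolding represents_family_def by blast
  obtain M where M: "M \<in> circuits ?N ?G" "realizes ?N M P" using P(1) by (rule opsE)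
  obtain P' where P': "P' \<in> ops ?N ?G'" "realizes ?N M P'" using circuits_simulate[OF sim M(1)] by blast
  have "P' \<psi> x = P \<psi> x" if "x \<in> states ?N" for \<psi> x
  proof -
    obtain r where "r < 2 ^ ?N" "x = bits ?N r" using states_bits[OF \<open>x \<in> states ?N\<close>] by blast
    then show ?thesis using realizesD[OF M(2), of r \<psi>] realizesD[OF P'(2), of r \<psi>] by simp
  qed
  then show ?thesis using P P' unfolding represents_family_def by (intro bexI[of _ P']) auto
qed

lemma sum_states_Suc:
  "(\<Sum>x\<in>states (Suc m). f x) = (\<Sum>x\<in>states m. f x + f (x(m := True)))"
proof -
  have eq: "states (Suc m) = states m \<union> (\<lambda>x. x(m := True)) ` states m"
  proof (intro Set.set_eqI iffI)
    fix x assume x: "x \<in> states (Suc m)"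
    show "x \<in> states m \<union> (\<lambda>x. x(m := True)) ` states m"
    proof (cases "x m")
      case True
      then have "x = (x(m := False))(m := True)" by (simp add: fun_upd_idem)
      moreover have "x(m := False) \<in> states m" using x by (auto simp: states_def)
      ultimately show ?thesis by blast
    next
      case False
      then have "\<not> x q" if "q \<ge> m" for q using x that by (cases "q = m") (auto simp: states_def)
      then show ?thesis by (auto simp: states_def)
    qed
  qed (auto simp: states_def)
  have inj: "inj_on (\<lambda>x. x(m := True)) (states m)"
  proof (rule inj_onI)
    fix x y :: bits assume h: "x \<in> states m" "y \<in> states m" "x(m := True) = y(m := True)"
    have "x = (x(m := True))(m := False)" "y = (y(m := True))(m := False)"
      using h(1,2) by (simp_all add: states_def fun_upd_idem)
    then show "x = y" using h(3) by simp
  qed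
  have "states m \<inter> (\<lambda>x. x(m := True)) ` states m = {}" by (auto simp: states_def)
  then show ?thesis unfolding eq
    by (subst sum.union_disjoint) (auto simp: finite_card_states sum.reindex[OF inj] sum.distrib)
qed

text \<open>The family \<open>A + B \<zeta>\<close>, with \<open>\<zeta>\<^sup>2 = w\<close>, becomes \<open>A \<otimes> I + B \<otimes> M\<close>, where \<open>M\<close> has the rows \<open>(0, w)\<close>, \<open>(1, 0)\<close>
  and acts on qubit \<open>m\<close>.\<close>
definition cat_embed :: "complex \<Rightarrow> nat \<Rightarrow> (bits \<Rightarrow> bits \<Rightarrow> complex) \<Rightarrow> (bits \<Rightarrow> bits \<Rightarrow> complex) \<Rightarrow> bits \<Rightarrow> bits \<Rightarrow> complex" where
  "cat_embed w m A B y x = (let y' = y(m := False); x' = x(m := False) in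
     if y m then (if x m then A y' x' else w * B y' x') else (if x m then B y' x' else A y' x'))"

text \<open>Orthonormality of \<open>u\<close> reads
  \<open>P y z + Q y z * ?z = (if y = z then 1 else 0)\<close> with \<open>P\<close> and
  \<open>Q\<close> over the smaller ring, so by independence \<open>Q\<close> vanishes and
  \<open>P\<close> is the identity. Embedded columns with equal bit \<open>m\<close> have inner
  product \<open>P\<close>, those with different bits have \<open>Q\<close> up to a root of
  unity.\<close>

lemma cat_embed_unitary:
  assumes k: "k \<ge> 2" and u: "unitary_family (2 ^ Suc k) m u"
    and AB: "\<And>y x. A y x \<in> Zhalf_zeta (2 ^ k)" "\<And>y x. B y x \<in> Zhalf_zeta (2 ^ k)"
      "\<And>y x. y \<in> states m \<Longrightarrow> u y x = A y x + B y x * zeta (2 ^ Suc k)"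
  shows "unitary_family (2 ^ k) (Suc m) (cat_embed (zeta (2 ^ k)) m A B)"
proof -
  let ?z = "zeta (2 ^ Suc k)" and ?w = "zeta (2 ^ k)" and ?v = "cat_embed (zeta (2 ^ k)) m A B"
  have zero: "A y x = 0 \<and> B y x = 0" if "y \<in> states m" "x \<notin> states m" for y x
  proof -
    have "A y x + B y x * ?z = 0" using AB(3)[OF that(1), of x] u that by (simp add: unitary_family_def)
    then show ?thesis using zeta_independent[OF k AB(1,2)] by blast
  qed
  define P where "P y z = (\<Sum>x\<in>states m. A y x * cnj (A z x) + B y x * cnj (B z x))" for y z
  define Q where "Q y z = (\<Sum>x\<in>states m. B y x * cnj (A z x) + A y x * cnj (B z x) * cnj ?w)" for y z
  have zc: "cnj ?z = cnj ?w * ?z"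
  proof -
    have "cnj ?w = cnj (?z * ?z)" by (simp only: zeta_Suc_sq)
    then have "cnj ?w * ?z = cnj ?z * (?z * cnj ?z)" by (simp only: complex_cnj_mult mult_ac)
    then show ?thesis by (simp only: zeta_cnj mult_1_right)
  qed
  have PQ: "P y z = (if y = z then 1 else 0) \<and> Q y z = 0" if yz: "y \<in> states m" "z \<in> states m" for y z
  proof -
    have "u y x * cnj (u z x) = (A y x * cnj (A z x) + B y x * cnj (B z x))
        + (B y x * cnj (A z x) + A y x * cnj (B z x) * cnj ?w) * ?z" for x
    proof -
      have "u y x * cnj (u z x) = (A y x * cnj (A z x) + B y x * cnj (B z x) * (?z * cnj ?z))
          + (B y x * cnj (A z x) * ?z + A y x * cnj (B z x) * cnj ?z)"
        unfolding AB(3)[OF yz(1)] AB(3)[OF yz(2)] by (simp add: algebra_simps)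
      then show ?thesis unfolding zeta_cnj unfolding zc by (simp add: algebra_simps)
    qed
    then have "inner_on (states m) (u y) (u z) = (\<Sum>x\<in>states m. (A y x * cnj (A z x) + B y x * cnj (B z x))
        + (B y x * cnj (A z x) + A y x * cnj (B z x) * cnj ?w) * ?z)" by (simp only: inner_on_def)
    also have "\<dots> = P y z + Q y z * ?z" unfolding P_def Q_def by (subst sum.distrib) (simp only: sum_distrib_right)
    finally have e: "P y z + Q y z * ?z = (if y = z then 1 else 0)" using u yz by (simp add: unitary_family_def)
    let ?d = "if y = z then 1 else 0 :: complex"
    have "(P y z - ?d) + Q y z * ?z = 0" unfolding e[symmetric] by simp
    moreover have "P y z - ?d \<in> Zhalf_zeta (2 ^ k)" "Q y z \<in> Zhalf_zeta (2 ^ k)"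
      unfolding P_def Q_def
      by (intro Zhalf_diff Zhalf_sum Zhalf_zeta.add Zhalf_zeta.mult Zhalf_cnj AB Zhalf_zeta.root; simp add: Zhalf_zeta.one Zhalf_0)+
    ultimately have "P y z - ?d = 0" "Q y z = 0" using zeta_independent[OF k] by blast+
    then show ?thesis by (simp only: right_minus_eq)
  qed
  have st: "y(m := False) \<in> states m" if "y \<in> states (Suc m)" for y
    using that by (auto simp: states_def)
  have upd: "x(m := False) = x" if "x \<in> states m" for x using that by (simp add: states_def fun_upd_idem)
  have w1: "?w * cnj ?w = 1" by (rule zeta_cnj)
  show ?thesis
    unfolding unitary_family_def
  proof (intro conjI ballI allI impI)
    fix y x assume y: "y \<in> states (Suc m)"
    show "?v y x \<in> Zhalf_zeta (2 ^ k)"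
      by (auto simp: cat_embed_def Let_def intro!: AB Zhalf_zeta.mult Zhalf_zeta.root)
    assume "x \<notin> states (Suc m)"
    then obtain q where q: "q \<ge> Suc m" "x q" by (auto simp: states_def)
    then have "(x(m := False)) q" "q \<ge> m" by auto
    then have "x(m := False) \<notin> states m" unfolding states_def by blast
    then show "?v y x = 0" using zero[OF st[OF y]] by (auto simp: cat_embed_def Let_def)
  next
    fix y z assume yz: "y \<in> states (Suc m)" "z \<in> states (Suc m)"
    let ?y = "y(m := False)" and ?z' = "z(m := False)"
    have "inner_on (states (Suc m)) (?v y) (?v z) = (\<Sum>x\<in>states m. ?v y x * cnj (?v z x) + ?v y (x(m := True)) * cnj (?v z (x(m := True))))"
      by (simp add: inner_on_def sum_states_Suc)
    also have "\<dots> = (if y m = z m then P ?y ?z' else if y m then ?w * Q ?y ?z' else Q ?y ?z')"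
    proof -
      have "?v y x * cnj (?v z x) + ?v y (x(m := True)) * cnj (?v z (x(m := True))) =
         (if y m = z m then A ?y x * cnj (A ?z' x) + B ?y x * cnj (B ?z' x)
          else (if y m then ?w else 1) * (B ?y x * cnj (A ?z' x) + A ?y x * cnj (B ?z' x) * cnj ?w))"
        if x: "x \<in> states m" for x
      proof -
        have xm: "\<not> x m" using x by (simp add: states_def)
        have c1: "?w * B ?y x * cnj (?w * B ?z' x) = B ?y x * cnj (B ?z' x)"
        proof -
          have "?w * B ?y x * cnj (?w * B ?z' x) = (?w * cnj ?w) * (B ?y x * cnj (B ?z' x))" by (simp add: mult_ac)
          then show ?thesis unfolding w1 by simp
        qed
        have c2: "?w * (A ?y x * cnj (B ?z' x) * cnj ?w) = A ?y x * cnj (B ?z' x)"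
        proof -
          have "?w * (A ?y x * cnj (B ?z' x) * cnj ?w) = (?w * cnj ?w) * (A ?y x * cnj (B ?z' x))" by (simp add: mult_ac)
          then show ?thesis unfolding w1 by simp
        qed
        show ?thesis
          using xm upd[OF x] c1 c2 by (cases "y m"; cases "z m") (simp_all add: cat_embed_def Let_def algebra_simps)
      qed
      then show ?thesis by (cases "y m = z m"; cases "y m") (simp_all add: P_def Q_def sum_distrib_left[symmetric])
    qed
    also have "\<dots> = (if y = z then 1 else 0)"
    proof -
      have "y = ?y(m := y m)" "z = ?z'(m := z m)" by simp_all
      then have "y = z \<longleftrightarrow> y m = z m \<and> ?y = ?z'" by metis
      then show ?thesis using PQ[OF st[OF yz(1)] st[OF yz(2)]] by auto
    qed
    finally show "inner_on (states (Suc m)) (?v y) (?v z) = (if y = z then 1 else 0)" .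
  qed
qed

text \<open>Qubit \<open>m\<close> is a data qubit for the embedded family and the first ancilla for
  \<open>u\<close>, so \<open>Suc m + a\<close> and \<open>m + Suc a\<close> are the same
  register.\<close>

lemma represents_catalytic:
  assumes k: "k \<ge> 3" and u: "unitary_family (2 ^ Suc k) m u"
    and IH: "\<And>v. unitary_family (2 ^ k) (Suc m) v \<Longrightarrow> represents_family (gate_set (2 ^ k)) (Suc m) a v"
  shows "represents_family (gate_set (2 ^ Suc k)) m (Suc a) u"
proof -
  let ?z = "zeta (2 ^ Suc k)" and ?w = "zeta (2 ^ k)" and ?G = "gate_set (2 ^ Suc k)" and ?N = "m + Suc a"
  have k8: "(8::nat) \<le> 2 ^ k" using power_increasing[OF k, of "2::nat"] by simp
  have "\<forall>y x. \<exists>ab. fst ab \<in> Zhalf_zeta (2 ^ k) \<and> snd ab \<in> Zhalf_zeta (2 ^ k) \<and> (y \<in> states m \<longrightarrow> u y x = fst ab + snd ab * ?z)"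
  proof (intro allI)
    fix y x
    show "\<exists>ab. fst ab \<in> Zhalf_zeta (2 ^ k) \<and> snd ab \<in> Zhalf_zeta (2 ^ k) \<and> (y \<in> states m \<longrightarrow> u y x = fst ab + snd ab * ?z)"
    proof (cases "y \<in> states m")
      case True
      then have "u y x \<in> Zhalf_zeta (2 ^ Suc k)" using u by (simp add: unitary_family_def)
      from Zhalf_Suc_decomp[OF this] show ?thesis by fastforce
    next
      case False then show ?thesis by (intro exI[of _ "(0,0)"]) (simp add: Zhalf_0)
    qed
  qed
  then obtain f where f: "\<And>y x. fst (f y x) \<in> Zhalf_zeta (2 ^ k)" "\<And>y x. snd (f y x) \<in> Zhalf_zeta (2 ^ k)"
    "\<And>y x. y \<in> states m \<Longrightarrow> u y x = fst (f y x) + snd (f y x) * ?z" by metis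
  define A where "A y x = fst (f y x)" for y x
  define B where "B y x = snd (f y x)" for y x
  have AB: "\<And>y x. A y x \<in> Zhalf_zeta (2 ^ k)" "\<And>y x. B y x \<in> Zhalf_zeta (2 ^ k)"
      "\<And>y x. y \<in> states m \<Longrightarrow> u y x = A y x + B y x * ?z" using f by (simp_all add: A_def B_def)
  let ?v = "cat_embed ?w m A B"
  have "unitary_family (2 ^ k) (Suc m) ?v" by (rule cat_embed_unitary[OF _ u AB]) (use k in auto)
  from represents_double[OF k8 IH[OF this]] obtain P where
    P: "P \<in> ops ?N ?G" "\<And>y x. y \<in> states (Suc m) \<Longrightarrow> x \<in> states ?N \<Longrightarrow> P (ket y) x = ?v y x"
    by (auto simp: represents_family_def)
  interpret op_monoid "ops ?N ?G" by unfold_locales (auto intro: ops_id ops_comp)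
  have g: "H' \<in> ?G" "Tgate (2 ^ Suc k) \<in> ?G" using k8 by (auto simp: gate_set_def)
  have had: "had m \<in> ops ?N ?G" by (rule had_op[OF g(1)]) simp
  have T: "phase ?z {m} \<in> ops ?N ?G" by (rule T_op[OF g(2)]) simp
  have cT: "phase (cnj ?z) {m} \<in> ops ?N ?G" using phase_pow[OF T, of "2 ^ Suc k - 1"] cnj_zeta_pow[of "2 ^ Suc k"] by simp
  have zc: "?z * cnj ?z = 1" by (rule zeta_cnj)
  have zw: "cnj ?z * ?w = ?z"
  proof -
    have "cnj ?z * ?w = cnj ?z * (?z * ?z)" by (simp only: zeta_Suc_sq)
    also have "\<dots> = (?z * cnj ?z) * ?z" by (simp only: mult_ac)
    finally show ?thesis unfolding zc by simp
  qed
  \<comment> \<open>Prepare the catalyst on qubit \<open>m\<close>, run \<open>P\<close>, undo the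
    preparation. The prepared state is \<open>zeta 8\<close> times the unit eigenvector, a scalar
    that \<open>hadi m\<close> removes.\<close>
  let ?R = "\<lambda>\<psi>. hadi m (phase ?z {m} (P (phase (cnj ?z) {m} (had m \<psi>))))"
  have R: "?R \<in> ops ?N ?G" by (rule S_comp[OF hadi_in[OF had] S_comp[OF T S_comp[OF P(1) S_comp[OF cT had]]]])
  have "?R (ket y) x = u y x" if y: "y \<in> states m" and x: "x \<in> states ?N" for y x
  proof -
    let ?y1 = "y(m := True)"
    have ym: "\<not> y m" using y by (simp add: states_def)
    have yS: "y \<in> states (Suc m)" "?y1 \<in> states (Suc m)" using y by (auto simp: states_def)
    have prep: "phase (cnj ?z) {m} (had m (ket y)) = (\<lambda>x. (1 + \<i>) / 2 * ket y x + ((1 + \<i>) / 2 * cnj ?z) * ket ?y1 x)"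
    proof
      fix x
      have a: "x(m := True) \<noteq> y" using ym by auto
      have b: "x(m := False) = y \<longleftrightarrow> (if x m then x = ?y1 else x = y)"
        using ym by (auto simp: fun_upd_idem)
      have c: "x m \<Longrightarrow> x \<noteq> y" "\<not> x m \<Longrightarrow> x \<noteq> ?y1" using ym by auto
      show "phase (cnj ?z) {m} (had m (ket y)) x = (1 + \<i>) / 2 * ket y x + ((1 + \<i>) / 2 * cnj ?z) * ket ?y1 x"
        using a b c by (cases "x m") (simp_all add: phase_def diag_def had_def ket_def)
    qed
    define \<phi> where "\<phi> = P (phase (cnj ?z) {m} (had m (ket y)))"
    have \<phi>0: "\<phi> x = (1 + \<i>) / 2 * ((if x m then cnj ?z else 1) * u y (x(m := False)))" if x: "x \<in> states ?N" for x
    proof -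
      \<comment> \<open>\<open>P\<close> is known on basis states only; linearity carries this to
        the superposition.\<close>
      have "\<phi> x = (1 + \<i>) / 2 * ?v y x + ((1 + \<i>) / 2 * cnj ?z) * ?v ?y1 x"
        unfolding \<phi>_def prep ops_linear[OF P(1) x] P(2)[OF yS(1) x] P(2)[OF yS(2) x] ..
      also have "\<dots> = (1 + \<i>) / 2 * (?v y x + cnj ?z * ?v ?y1 x)" by (simp only: distrib_left mult.assoc)
      also have "?v y x + cnj ?z * ?v ?y1 x = (if x m then cnj ?z else 1) * u y (x(m := False))"
      proof -
        have y0: "y(m := False) = y" "?y1(m := False) = y" using ym by (simp_all add: fun_upd_idem)
        have z1: "cnj ?z * (B y (x(m := False)) * ?z) = B y (x(m := False))"
        proof -
          have "cnj ?z * (B y (x(m := False)) * ?z) = (?z * cnj ?z) * B y (x(m := False))" by (simp only: mult_ac)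
          then show ?thesis unfolding zc by simp
        qed
        have z2: "cnj ?z * (?w * B y (x(m := False))) = B y (x(m := False)) * ?z"
        proof -
          have "cnj ?z * (?w * B y (x(m := False))) = (cnj ?z * ?w) * B y (x(m := False))" by (simp only: mult.assoc)
          then show ?thesis unfolding zw by (simp only: mult.commute)
        qed
        show ?thesis unfolding AB(3)[OF y] using ym y0 z1 z2
          by (cases "x m") (simp_all add: cat_embed_def Let_def distrib_left)
      qed
      finally show ?thesis .
    qed
    have \<phi>: "phase ?z {m} \<phi> x = (1 + \<i>) / 2 * u y (x(m := False))" if x: "x \<in> states ?N" for x
    proof (cases "x m")
      case True
      have "phase ?z {m} \<phi> x = ?z * ((1 + \<i>) / 2 * (cnj ?z * u y (x(m := False))))"
        using \<phi>0[OF x] True by (simp add: phase_def diag_def)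
      also have "\<dots> = (?z * cnj ?z) * ((1 + \<i>) / 2 * u y (x(m := False)))" by (simp only: mult_ac)
      finally show ?thesis unfolding zc by simp
    next
      case False
      then show ?thesis using \<phi>0[OF x] by (simp add: phase_def diag_def)
    qed
    have xs: "x(m := b) \<in> states ?N" for b using x by simp
    \<comment> \<open>With the phase undone, both values of bit \<open>m\<close> have the same
      amplitude, so \<open>hadi m\<close> returns the catalyst to 0.\<close>
    have "?R (ket y) x = (1 - \<i>) / 2 * ((1 + \<i>) / 2 * u y (x(m := False)) + sgn_bit (x m) * ((1 + \<i>) / 2 * u y (x(m := False))))"
      unfolding \<phi>_def[symmetric] hadi_eq \<phi>[OF xs] by simp
    also have "\<dots> = (if x m then 0 else u y (x(m := False)))" by (simp add: sgn_bit_def field_simps)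
    also have "\<dots> = u y x"
    proof (cases "x m")
      case True
      then have "x \<notin> states m" by (auto simp: states_def)
      then show ?thesis using True u y by (simp add: unitary_family_def)
    qed (simp add: fun_upd_idem)
    finally show ?thesis .
  qed
  then show ?thesis unfolding represents_family_def by (intro bexI[OF _ R]) blast
qed

text \<open>One ancilla at order 8 and one catalyst per doubling: \<open>Suc k\<close> is
  \<open>(k + 3) - 2\<close>. The induction needs \<open>m\<close> arbitrary, since the catalyst
  enlarges the register.\<close>

lemma represents_all:
  assumes "m \<ge> 1" "unitary_family (2 ^ (k + 3)) m u"
  shows "represents_family (gate_set (2 ^ (k + 3))) m (Suc k) u"
  using assms
proof (induction k arbitrary: m u)
  case 0
  then show ?case using represents_base[of m 8 u] by (simp add: eval_nat_numeral)
next
  case (Suc k)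
  have "represents_family (gate_set (2 ^ Suc (k + 3))) m (Suc (Suc k)) u"
    by (rule represents_catalytic) (use Suc in auto)
  then show ?case by simp
qed

section \<open>Matrices\<close>

text \<open>Ancillas are the least significant bits of an index, so multiplication by
  \<open>2 ^ a\<close> appends ancillas in 0, which leave the assignment unchanged.\<close>

lemma bits_shift: "bits (m + a) (2 ^ a * j) = bits m j"
proof
  fix q
  show "bits (m + a) (2 ^ a * j) q = bits m j q"
  proof (cases "q < m")
    case True
    then have "m + a - 1 - q = a + (m - 1 - q)" by simp
    then have "2 ^ a * j div 2 ^ (m + a - 1 - q) = j div 2 ^ (m - 1 - q)"
      by (simp only: power_add) (simp add: div_mult2_eq)
    then show ?thesis using True by (simp add: bits_def)
  next
    case False
    show ?thesis
    proof (cases "q < m + a")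
      case True
      define e where "e = m + a - 1 - q"
      have "a = e + Suc (a - 1 - e)" using True False by (simp add: e_def)
      then have eq: "(2::nat) ^ a * j = 2 ^ e * (2 * (2 ^ (a - 1 - e) * j))"
        by (metis mult.assoc power_Suc power_add)
      have "2 ^ a * j div 2 ^ e = 2 * (2 ^ (a - 1 - e) * j)"
        unfolding eq by (rule nonzero_mult_div_cancel_left) simp
      then show ?thesis using False by (simp add: bits_def e_def)
    qed (use False in \<open>simp add: bits_def\<close>)
  qed
qed

text \<open>Only columns with all ancillas in 0 are tested, and by linearity unit vectors
  suffice.\<close>

lemma exactly_represents_iff:
  assumes C: "C \<in> carrier_mat (2 ^ (m + a)) (2 ^ (m + a))" and U: "U \<in> carrier_mat (2 ^ m) (2 ^ m)"
  shows "exactly_represents m a C U \<longleftrightarrow>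
    (\<forall>r<2 ^ (m + a). \<forall>j<2 ^ m. C $$ (r, 2 ^ a * j) = (if r mod 2 ^ a = 0 then U $$ (r div 2 ^ a, j) else 0))"
proof -
  let ?a = "2 ^ a :: nat"
  have lt: "?a * j < 2 ^ (m + a)" if "j < 2 ^ m" for j using that by (simp add: power_add mult.commute)
  have dv: "r div ?a < 2 ^ m" if "r < 2 ^ (m + a)" for r using that by (simp add: power_add less_mult_imp_div_less)
  have L: "(C *\<^sub>v anc_ext a u) $ r = (\<Sum>j<2 ^ m. C $$ (r, ?a * j) * u $ j)"
    if u: "u \<in> carrier_vec (2 ^ m)" and r: "r < 2 ^ (m + a)" for u r
  proof -
    have "(C *\<^sub>v anc_ext a u) $ r = (\<Sum>c<2 ^ (m + a). C $$ (r, c) * (if c mod ?a = 0 then u $ (c div ?a) else 0))"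
      using C u r by (simp add: scalar_prod_def anc_ext_def power_add atLeast0LessThan)
    also have "\<dots> = (\<Sum>c\<in>(\<lambda>j. ?a * j) ` {..<2 ^ m}. C $$ (r, c) * (if c mod ?a = 0 then u $ (c div ?a) else 0))"
    proof (rule sum.mono_neutral_right)
      show "\<forall>c\<in>{..<2 ^ (m + a)} - (\<lambda>j. ?a * j) ` {..<2 ^ m}. C $$ (r, c) * (if c mod ?a = 0 then u $ (c div ?a) else 0) = 0"
      proof
        fix c assume c: "c \<in> {..<2 ^ (m + a)} - (\<lambda>j. ?a * j) ` {..<2 ^ m}"
        have "c mod ?a \<noteq> 0"
        proof
          assume "c mod ?a = 0"
          then have "c = ?a * (c div ?a)" by auto
          then show False using c dv[of c] by blast
        qed
        then show "C $$ (r, c) * (if c mod ?a = 0 then u $ (c div ?a) else 0) = 0" by simp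
      qed
    qed (use lt in auto)
    also have "\<dots> = (\<Sum>j<2 ^ m. C $$ (r, ?a * j) * u $ j)"
      by (subst sum.reindex) (auto simp: inj_on_def)
    finally show ?thesis .
  qed
  have Rr: "anc_ext a (U *\<^sub>v u) $ r = (\<Sum>j<2 ^ m. (if r mod ?a = 0 then U $$ (r div ?a, j) else 0) * u $ j)"
    if u: "u \<in> carrier_vec (2 ^ m)" and r: "r < 2 ^ (m + a)" for u r
    using U u r dv[OF r] by (simp add: anc_ext_def scalar_prod_def power_add atLeast0LessThan)
  have dims: "dim_vec (C *\<^sub>v anc_ext a u) = 2 ^ (m + a)" "dim_vec (anc_ext a (U *\<^sub>v u)) = 2 ^ (m + a)" for u
    using C U by (auto simp: anc_ext_def power_add)
  show ?thesis
  proof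
    assume ex: "exactly_represents m a C U"
    show "\<forall>r<2 ^ (m + a). \<forall>j<2 ^ m. C $$ (r, ?a * j) = (if r mod ?a = 0 then U $$ (r div ?a, j) else 0)"
    proof (intro allI impI)
      fix r j :: nat assume r: "r < 2 ^ (m + a)" and j: "j < 2 ^ m"
      let ?u = "unit_vec (2 ^ m) j :: complex vec"
      have u: "?u \<in> carrier_vec (2 ^ m)" by simp
      have "(C *\<^sub>v anc_ext a ?u) $ r = anc_ext a (U *\<^sub>v ?u) $ r" using ex u by (simp add: exactly_represents_def)
      moreover have "(\<Sum>i<2 ^ m. f i * ?u $ i) = f j" for f :: "nat \<Rightarrow> complex"
      proof -
        have "(\<Sum>i<2 ^ m. f i * ?u $ i) = (\<Sum>i<2 ^ m. if i = j then f i else 0)"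
          by (intro sum.cong) (use j in auto)
        then show ?thesis using j by simp
      qed
      ultimately show "C $$ (r, ?a * j) = (if r mod ?a = 0 then U $$ (r div ?a, j) else 0)"
        unfolding L[OF u r] Rr[OF u r] by simp
    qed
  next
    assume h: "\<forall>r<2 ^ (m + a). \<forall>j<2 ^ m. C $$ (r, ?a * j) = (if r mod ?a = 0 then U $$ (r div ?a, j) else 0)"
    show "exactly_represents m a C U" unfolding exactly_represents_def
    proof (intro ballI eq_vecI)
      fix u i assume u: "u \<in> carrier_vec (2 ^ m)" and "i < dim_vec (anc_ext a (U *\<^sub>v u))"
      then have i: "i < 2 ^ (m + a)" using dims by simp
      show "(C *\<^sub>v anc_ext a u) $ i = anc_ext a (U *\<^sub>v u) $ i"
        unfolding L[OF u i] Rr[OF u i] using h i by (intro sum.cong) auto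
    qed (simp only: dims)
  qed
qed

definition matrix_family :: "nat \<Rightarrow> complex mat \<Rightarrow> bits \<Rightarrow> bits \<Rightarrow> complex" where
  "matrix_family m U y x = (if x \<in> states m \<and> y \<in> states m
     then U $$ (inv_into {..<2 ^ m} (bits m) x, inv_into {..<2 ^ m} (bits m) y) else 0)"

lemma matrix_family_bits:
  assumes "i < 2 ^ m" "j < 2 ^ m" shows "matrix_family m U (bits m j) (bits m i) = U $$ (i, j)"
proof -
  have "inj_on (bits m) {..<2 ^ m}" using bij_bits by (auto simp: bij_betw_def)
  then show ?thesis using assms by (simp add: matrix_family_def inv_into_f_f)
qed

lemma representable_if_family:
  assumes U: "U \<in> carrier_mat (2 ^ m) (2 ^ m)" and rep: "represents_family \<G> m a (matrix_family m U)"
  shows "representable \<G> m a U"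
proof -
  obtain P where P: "P \<in> ops (m + a) \<G>" "\<And>y x. y \<in> states m \<Longrightarrow> x \<in> states (m + a) \<Longrightarrow> P (ket y) x = matrix_family m U y x"
    using rep unfolding represents_family_def by blast
  obtain C where C: "C \<in> circuits (m + a) \<G>" "realizes (m + a) C P" using P(1) by (rule opsE)
  let ?a = "2 ^ a :: nat"
  have lt: "?a * j < 2 ^ (m + a)" if "j < 2 ^ m" for j using that by (simp add: power_add mult.commute)
  have "exactly_represents m a C U"
    unfolding exactly_represents_iff[OF circuits_carrier[OF C(1)] U]
  proof (intro allI impI)
    fix r j :: nat assume r: "r < 2 ^ (m + a)" and j: "j < 2 ^ m"
    have "C $$ (r, ?a * j) = (\<Sum>c<2 ^ (m + a). if c = ?a * j then C $$ (r, c) else 0)" using lt[OF j] by simp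
    also have "\<dots> = (\<Sum>c<2 ^ (m + a). C $$ (r, c) * ket (bits m j) (bits (m + a) c))"
    proof (intro sum.cong refl)
      fix c assume c: "c \<in> {..<(2::nat) ^ (m + a)}"
      have "bits (m + a) c = bits m j \<longleftrightarrow> c = ?a * j"
        using c lt[OF j] bits_eq_iff[of c "m + a" "?a * j"] by (simp add: bits_shift)
      then show "(if c = ?a * j then C $$ (r, c) else 0) = C $$ (r, c) * ket (bits m j) (bits (m + a) c)"
        by (simp add: ket_def)
    qed
    also have "\<dots> = matrix_family m U (bits m j) (bits (m + a) r)"
      unfolding realizesD[OF C(2) r] by (rule P(2)) auto
    also have "\<dots> = (if r mod ?a = 0 then U $$ (r div ?a, j) else 0)"
    proof (cases "r mod ?a = 0")
      case True
      then have r': "r = ?a * (r div ?a)" by auto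
      have "r div ?a < 2 ^ m" using r by (simp add: power_add less_mult_imp_div_less)
      then show ?thesis using True j matrix_family_bits[of "r div ?a" m j U] bits_shift[of m a "r div ?a"] r' by simp
    next
      case False
      have "bits (m + a) r \<notin> states m"
      proof
        assume "bits (m + a) r \<in> states m"
        then obtain i where i: "i < 2 ^ m" "bits (m + a) r = bits m i" using states_bits by blast
        then have "r = ?a * i" using bits_eq_iff[OF r lt[OF i(1)]] by (simp add: bits_shift)
        then show False using False by simp
      qed
      then show ?thesis using False by (simp add: matrix_family_def)
    qed
    finally show "C $$ (r, ?a * j) = (if r mod ?a = 0 then U $$ (r div ?a, j) else 0)" .
  qed
  then show ?thesis using C(1) unfolding representable_def by blast
qed

lemma matrix_family_unitary:
  assumes U: "unitary_mat (2 ^ m) U" and ring: "\<forall>i<2 ^ m. \<forall>j<2 ^ m. U $$ (i, j) \<in> Zhalf_zeta n"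
  shows "unitary_family n m (matrix_family m U)"
  unfolding unitary_family_def
proof (intro conjI ballI allI impI)
  fix y assume y: "y \<in> states m"
  then obtain j where j: "j < 2 ^ m" "y = bits m j" using states_bits by blast
  show "matrix_family m U y x = 0" if "x \<notin> states m" for x using that by (simp add: matrix_family_def)
  show "matrix_family m U y x \<in> Zhalf_zeta n" for x
  proof (cases "x \<in> states m")
    case True
    then obtain i where "i < 2 ^ m" "x = bits m i" using states_bits by blast
    then show ?thesis using j ring by (simp add: matrix_family_bits)
  qed (simp add: matrix_family_def Zhalf_0)
next
  fix y z assume "y \<in> states m" "z \<in> states m"
  then obtain j l where j: "j < 2 ^ m" "y = bits m j" and l: "l < 2 ^ m" "z = bits m l" using states_bits by blast
  have Uc: "U \<in> carrier_mat (2 ^ m) (2 ^ m)" and UU: "mat_adjoint U * U = 1\<^sub>m (2 ^ m)"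
    using U by (auto simp: unitary_mat_def)
  have "inner_on (states m) (matrix_family m U y) (matrix_family m U z) = (\<Sum>i<2 ^ m. U $$ (i, j) * cnj (U $$ (i, l)))"
    unfolding inner_on_def j l sum_bits[symmetric] by (intro sum.cong) (use j l in \<open>auto simp: matrix_family_bits\<close>)
  also have "\<dots> = (mat_adjoint U * U) $$ (l, j)"
    using Uc j l by (simp add: mat_adjoint_def mat_of_rows_def scalar_prod_def atLeast0LessThan mult.commute)
  also have "\<dots> = (if y = z then 1 else 0)" unfolding UU using j l bits_eq_iff by auto
  finally show "inner_on (states m) (matrix_family m U y) (matrix_family m U z) = (if y = z then 1 else 0)" .
qed

section \<open>Converse direction: entries of circuits stay in the ring\<close>

lemma i_in_Zhalf: assumes "k \<ge> 2" shows "\<i> \<in> Zhalf_zeta (2 ^ k)"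
proof -
  obtain j where k: "k = j + 2" using assms by (metis add.commute le_Suc_ex)
  have "\<i> \<in> Zhalf_zeta (2 ^ (j + 2))"
  proof -
    have "zeta (2 ^ (j + 2)) ^ (2 ^ j) = \<i>"
      by (simp add: zeta_def DeMoivre power_add)
    then show ?thesis using Zhalf_pow[OF Zhalf_zeta.root] by metis
  qed
  then show ?thesis unfolding k .
qed

lemma gate_entries:
  assumes k: "k \<ge> 1" and G: "G \<in> gate_set (2 ^ k)" and ij: "i < dim_row G" "j < dim_col G"
  shows "G $$ (i, j) \<in> Zhalf_zeta (2 ^ k)"
proof -
  note R = Zhalf_zeta.one Zhalf_zeta.half Zhalf_zeta.uminus[OF Zhalf_zeta.half] Zhalf_0 Zhalf_zeta.root
    Zhalf_zeta.uminus[OF Zhalf_zeta.one]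
  have "- (1/2) \<in> Zhalf_zeta (2 ^ k)" using R by simp
  moreover
  have "(1 + \<i>) / 2 \<in> Zhalf_zeta (2 ^ k) \<and> - (1 + \<i>) / 2 \<in> Zhalf_zeta (2 ^ k) \<and> \<i> \<in> Zhalf_zeta (2 ^ k)" if "k \<ge> 2"
  proof -
    have "(1 + \<i>) * (1/2) \<in> Zhalf_zeta (2 ^ k)" by (intro Zhalf_zeta.mult Zhalf_zeta.add R i_in_Zhalf that)
    moreover have "- (1 + \<i>) / 2 = - ((1 + \<i>) * (1/2))" by (simp only: minus_divide_left times_divide_eq_right mult_1_right)
    then have "- (1 + \<i>) / 2 \<in> Zhalf_zeta (2 ^ k)" using Zhalf_zeta.uminus[OF calculation] by (simp only:)
    ultimately show ?thesis using i_in_Zhalf[OF that] by simp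
  qed
  moreover have "k \<ge> 2" if "(2::nat) ^ k \<noteq> 2" using that k by (cases "k = 1") auto
  ultimately show ?thesis using G ij R
    by (auto simp: gate_set_def Xgate_def CXgate_def CCXgate_def HHgate_def H'_def Sgate_def Tgate_def split: if_splits)
qed

lemma mult_mat_entry:
  assumes "A \<in> carrier_mat n n" "B \<in> carrier_mat n n" "r < n" "c < n"
  shows "(A * B) $$ (r, c) = (\<Sum>d<n. A $$ (r, d) * B $$ (d, c))"
  using assms by (simp add: scalar_prod_def atLeast0LessThan)

lemma circuit_entries:
  assumes k: "k \<ge> 1" and C: "C \<in> circuits N (gate_set (2 ^ k))"
  shows "r < 2 ^ N \<Longrightarrow> c < 2 ^ N \<Longrightarrow> C $$ (r, c) \<in> Zhalf_zeta (2 ^ k)"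
  using C
proof (induction arbitrary: r c rule: circuits.induct)
  case empty
  then show ?case by (auto simp: Zhalf_0 Zhalf_zeta.one)
next
  case (step C G qs)
  have sub: "subidx N qs i < 2 ^ length qs" for i
  proof -
    have "subidx N qs i \<le> (\<Sum>t<length qs. 2 ^ (length qs - 1 - t))"
      unfolding subidx_def by (intro sum_mono) (simp add: qbit_def)
    also have "\<dots> = (\<Sum>t<length qs. 2 ^ t)"
      using sum.nat_diff_reindex[of "\<lambda>t. 2 ^ t" "length qs"] by simp
    also have "\<dots> < 2 ^ length qs" by (simp add: lessThan_atLeast0 sum_power2)
    finally show ?thesis .
  qed
  have "embed_gate N G qs $$ (r, d) \<in> Zhalf_zeta (2 ^ k)" if "d < 2 ^ N" for d
    using that step.prems sub step.hyps(3) gate_entries[OF k step.hyps(2)] by (auto simp: embed_gate_def Zhalf_0)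
  moreover have "(embed_gate N G qs * C) $$ (r, c) = (\<Sum>d<2 ^ N. embed_gate N G qs $$ (r, d) * C $$ (d, c))"
    by (rule mult_mat_entry[OF embed_carrier circuits_carrier[OF step.hyps(1)] step.prems])
  ultimately show ?case using step by (auto intro!: Zhalf_sum Zhalf_zeta.mult)
qed

lemma representable_entries:
  assumes k: "k \<ge> 1" and U: "U \<in> carrier_mat (2 ^ m) (2 ^ m)" and rep: "representable (gate_set (2 ^ k)) m a U"
    and ij: "i < 2 ^ m" "j < 2 ^ m"
  shows "U $$ (i, j) \<in> Zhalf_zeta (2 ^ k)"
proof -
  obtain C where C: "C \<in> circuits (m + a) (gate_set (2 ^ k))" "exactly_represents m a C U"
    using rep by (auto simp: representable_def)
  have lt: "2 ^ a * l < (2::nat) ^ (m + a)" if "l < 2 ^ m" for l using that by (simp add: power_add mult.commute)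
  have "C $$ (2 ^ a * i, 2 ^ a * j) = U $$ (i, j)"
    using C(2)[unfolded exactly_represents_iff[OF circuits_carrier[OF C(1)] U]] lt[OF ij(1)] ij(2) by simp
  then show ?thesis using circuit_entries[OF k C(1) lt[OF ij(1)] lt[OF ij(2)]] by simp
qed

theorem theorem1:
  fixes k m :: nat and U :: "complex mat"
  assumes "k \<ge> 1" and "m \<ge> 1" and "unitary_mat (2 ^ m) U"
  shows "((\<exists>a. representable (gate_set (2 ^ k)) m a U) \<longleftrightarrow>
           (\<forall>i < 2 ^ m. \<forall>j < 2 ^ m. U $$ (i, j) \<in> Zhalf_zeta (2 ^ k)))
       \<and> ((\<forall>i < 2 ^ m. \<forall>j < 2 ^ m. U $$ (i, j) \<in> Zhalf_zeta (2 ^ k)) \<longrightarrow>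
           (if k \<le> 2 then representable (gate_set (2 ^ k)) m 1 U
            else (\<exists>a \<le> k - 2. representable (gate_set (2 ^ k)) m a U)))"
proof -
  have U: "U \<in> carrier_mat (2 ^ m) (2 ^ m)" using assms(3) by (simp add: unitary_mat_def)
  have "if k \<le> 2 then representable (gate_set (2 ^ k)) m 1 U
      else (\<exists>a \<le> k - 2. representable (gate_set (2 ^ k)) m a U)"
    if ring: "\<forall>i < 2 ^ m. \<forall>j < 2 ^ m. U $$ (i, j) \<in> Zhalf_zeta (2 ^ k)"
  proof (cases "k \<le> 2")
    case True
    then have "k = 1 \<or> k = 2" using assms(1) by linarith
    then have "2 ^ k \<in> {2,4,8::nat}" by auto
    then show ?thesis
      using True representable_if_family[OF U represents_base[OF assms(2) _ matrix_family_unitary[OF assms(3) ring]]] by simp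
  next
    case False
    then have "k = (k - 3) + 3" by simp
    then have "representable (gate_set (2 ^ k)) m (Suc (k - 3)) U"
      using representable_if_family[OF U] represents_all[OF assms(2), of "k - 3"] matrix_family_unitary[OF assms(3) ring] by metis
    moreover have "Suc (k - 3) \<le> k - 2" using False by simp
    ultimately show ?thesis using False by auto
  qed
  moreover have "U $$ (i, j) \<in> Zhalf_zeta (2 ^ k)" if "representable (gate_set (2 ^ k)) m a U" "i < 2 ^ m" "j < 2 ^ m" for a i j
    by (rule representable_entries[OF assms(1) U that])
  ultimately show ?thesis by (metis (full_types))
qed

end
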